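(* Let $\Gamma$ be a plane branch and $\mathcal{C}$ its class of analytic conjugacy. Let $\Gamma'\in\mathcal{C}$. Then there exist a holomorphic deformation $\Gamma'_\epsilon$ of $\Gamma'$ by a singular holomorphic vector field, defined in a neighborhood of $\epsilon=0$, with $\Gamma'_0=\Gamma'$, and a simple continuous curve $\gamma:[0,1]\to\mathbb{C}$ such that $\gamma(0)=0$ and $\Gamma$ is connected by a geodesic to $\Gamma'_{\gamma(t)}$ for any $t\in(0,1]$.
   Context: A plane branch is a reduced irreducible germ of analytic curve at $(0,0)\in\mathbb{C}^2$. Two branches $\Gamma_1,\Gamma_2$ are analytically conjugated if there is a germ of biholomorphism $\varphi\in\mathrm{Diff}(\mathbb{C}^2,0)$ (fixing the origin) with $\varphi(\Gamma_1)=\Gamma_2$; the class of analytic conjugacy of $\Gamma$ is the set of branches analytically conjugated to $\Gamma$. A singular holomorphic vector field is a germ of holomorphic vector field at $(0,0)$ vanishing at $(0,0)$; $\exp(X)$ denotes its time $1$ flow. Two branches $\Gamma_1,\Gamma_2$ are connected by a geodesic if there is a singular holomorphic vector field $X$ with $\exp(X)(\Gamma_1)=\Gamma_2$. If $X$ is a singular holomorphic vector field with one-parameter group $\{\psi_s\}_{s\in\mathbb{C}}$, the holomorphic deformation of a branch $\Gamma'=(f=0)$ by $X$ is the family $\Gamma'_\epsilon=\psi_{-\epsilon}(\Gamma')=(f\circ\psi_\epsilon=0)$. A simple curve is an injective one. *)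

theory Defs
  imports "HOL-Analysis.Analysis"
begin

text \<open>
  Holomorphic means complex differentiable at every point of an open set: a real
  (Frechet) derivative exists and is homogeneous for complex scalars. A germ is given by a
  total function, of which only the values near the origin matter.
\<close>

definition holo_fun_on :: "(complex ^ 2 \<Rightarrow> complex) \<Rightarrow> (complex ^ 2) set \<Rightarrow> bool" where
  "holo_fun_on f V \<longleftrightarrow> open V \<and>
     (\<forall>z\<in>V. \<exists>D. (f has_derivative D) (at z) \<and> (\<forall>c v. D (c *s v) = c * D v))"

definition holo_map_on :: "(complex ^ 2 \<Rightarrow> complex ^ 2) \<Rightarrow> (complex ^ 2) set \<Rightarrow> bool" where
  "holo_map_on F V \<longleftrightarrow> (\<forall>i. holo_fun_on (\<lambda>z. F z $ i) V)"

definition holo_fun_germ :: "(complex ^ 2 \<Rightarrow> complex) \<Rightarrow> bool" where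
  "holo_fun_germ f \<longleftrightarrow> (\<exists>V. 0 \<in> V \<and> holo_fun_on f V)"

definition holo_map_germ :: "(complex ^ 2 \<Rightarrow> complex ^ 2) \<Rightarrow> bool" where
  "holo_map_germ F \<longleftrightarrow> (\<exists>V. 0 \<in> V \<and> holo_map_on F V)"

definition germ_eq :: "(complex ^ 2 \<Rightarrow> 'a) \<Rightarrow> (complex ^ 2 \<Rightarrow> 'a) \<Rightarrow> bool" where
  "germ_eq f g \<longleftrightarrow> (\<forall>\<^sub>F z in nhds 0. f z = g z)"

definition unit_germ :: "(complex ^ 2 \<Rightarrow> complex) \<Rightarrow> bool" where
  "unit_germ f \<longleftrightarrow> (\<exists>g. holo_fun_germ g \<and> germ_eq (\<lambda>z. f z * g z) (\<lambda>z. 1))"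

text \<open>
  This is \<^const>\<open>irreducible\<close> in the ring of germs of holomorphic functions at the origin,
  written out on representatives.
\<close>

definition irreducible_germ :: "(complex ^ 2 \<Rightarrow> complex) \<Rightarrow> bool" where
  "irreducible_germ f \<longleftrightarrow> holo_fun_germ f \<and> \<not> germ_eq f (\<lambda>z. 0) \<and> \<not> unit_germ f \<and>
     (\<forall>g h. holo_fun_germ g \<longrightarrow> holo_fun_germ h \<longrightarrow> germ_eq f (\<lambda>z. g z * h z) \<longrightarrow>
        unit_germ g \<or> unit_germ h)"

definition biholo_germ :: "(complex ^ 2 \<Rightarrow> complex ^ 2) \<Rightarrow> bool" where
  "biholo_germ \<phi> \<longleftrightarrow> holo_map_germ \<phi> \<and> \<phi> 0 = 0 \<and>
     (\<exists>\<theta>. holo_map_germ \<theta> \<and> \<theta> 0 = 0 \<and>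
        germ_eq (\<lambda>z. \<theta> (\<phi> z)) (\<lambda>z. z) \<and> germ_eq (\<lambda>z. \<phi> (\<theta> z)) (\<lambda>z. z))"

text \<open>
  The germ at the origin of a set \<open>A\<close> is encoded as the filter of sets containing
  \<open>A \<inter> U\<close> for some neighbourhood \<open>U\<close> of the origin. Equality of filters is then equality of
  germs, and \<^const>\<open>filtermap\<close> is the direct image of a germ of a set under a germ of a map;
  both facts are recorded below.
\<close>

type_synonym set_germ = "(complex ^ 2) filter"

definition germ_of :: "(complex ^ 2) set \<Rightarrow> set_germ" where
  "germ_of A = inf (nhds 0) (principal A)"

lemma eventually_germ_of:
  "eventually P (germ_of A) \<longleftrightarrow> (\<forall>\<^sub>F z in nhds 0. z \<in> A \<longrightarrow> P z)"
  by (simp add: germ_of_def eventually_inf_principal)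

lemma germ_of_eq_iff: "germ_of A = germ_of B \<longleftrightarrow> (\<forall>\<^sub>F z in nhds 0. z \<in> A \<longleftrightarrow> z \<in> B)"
proof
  assume eq: "germ_of A = germ_of B"
  have "eventually (\<lambda>z. z \<in> A) (germ_of A)" "eventually (\<lambda>z. z \<in> B) (germ_of B)"
    by (simp_all add: eventually_germ_of)
  then have "eventually (\<lambda>z. z \<in> A) (germ_of B)" "eventually (\<lambda>z. z \<in> B) (germ_of A)"
    by (simp_all only: eq)
  then have "\<forall>\<^sub>F z in nhds 0. z \<in> B \<longrightarrow> z \<in> A" "\<forall>\<^sub>F z in nhds 0. z \<in> A \<longrightarrow> z \<in> B"
    by (simp_all add: eventually_germ_of)
  then show "\<forall>\<^sub>F z in nhds 0. z \<in> A \<longleftrightarrow> z \<in> B"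
    by eventually_elim auto
next
  assume ev: "\<forall>\<^sub>F z in nhds 0. z \<in> A \<longleftrightarrow> z \<in> B"
  show "germ_of A = germ_of B"
    unfolding filter_eq_iff eventually_germ_of
  proof
    fix P
    show "(\<forall>\<^sub>F z in nhds 0. z \<in> A \<longrightarrow> P z) \<longleftrightarrow> (\<forall>\<^sub>F z in nhds 0. z \<in> B \<longrightarrow> P z)"
      by (rule eventually_subst) (use ev in eventually_elim, auto)
  qed
qed

lemma filtermap_germ_of:
  assumes \<phi>: "filterlim \<phi> (nhds 0) (nhds 0)" and \<theta>: "filterlim \<theta> (nhds 0) (nhds 0)"
    and inv: "germ_eq (\<lambda>z. \<theta> (\<phi> z)) (\<lambda>z. z)" "germ_eq (\<lambda>z. \<phi> (\<theta> z)) (\<lambda>z. z)"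
  shows "filtermap \<phi> (germ_of A) = germ_of {w. \<theta> w \<in> A}"
  unfolding filter_eq_iff eventually_filtermap eventually_germ_of
proof (intro allI iffI)
  fix P assume "\<forall>\<^sub>F z in nhds 0. z \<in> A \<longrightarrow> P (\<phi> z)"
  then have "\<forall>\<^sub>F w in nhds 0. \<theta> w \<in> A \<longrightarrow> P (\<phi> (\<theta> w))"
    using \<theta> by (auto simp: filterlim_iff)
  then show "\<forall>\<^sub>F w in nhds 0. w \<in> {w. \<theta> w \<in> A} \<longrightarrow> P w"
    using inv(2) unfolding germ_eq_def by eventually_elim auto
next
  fix P assume "\<forall>\<^sub>F w in nhds 0. w \<in> {w. \<theta> w \<in> A} \<longrightarrow> P w"
  then have "\<forall>\<^sub>F z in nhds 0. \<theta> (\<phi> z) \<in> A \<longrightarrow> P (\<phi> z)"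
    using \<phi> by (auto simp: filterlim_iff)
  then show "\<forall>\<^sub>F z in nhds 0. z \<in> A \<longrightarrow> P (\<phi> z)"
    using inv(1) unfolding germ_eq_def by eventually_elim auto
qed

text \<open>A reduced germ of curve is determined by its germ of zero set.\<close>

definition plane_branch :: "set_germ \<Rightarrow> bool" where
  "plane_branch \<Gamma> \<longleftrightarrow> (\<exists>f. irreducible_germ f \<and> \<Gamma> = germ_of {z. f z = 0})"

definition analytically_conjugated :: "set_germ \<Rightarrow> set_germ \<Rightarrow> bool" where
  "analytically_conjugated \<Gamma>\<^sub>1 \<Gamma>\<^sub>2 \<longleftrightarrow> (\<exists>\<phi>. biholo_germ \<phi> \<and> filtermap \<phi> \<Gamma>\<^sub>1 = \<Gamma>\<^sub>2)"

definition conjugacy_class :: "set_germ \<Rightarrow> set_germ set" where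
  "conjugacy_class \<Gamma> = {\<Gamma>'. plane_branch \<Gamma>' \<and> analytically_conjugated \<Gamma>' \<Gamma>}"

definition singular_vector_field :: "(complex ^ 2 \<Rightarrow> complex ^ 2) \<Rightarrow> bool" where
  "singular_vector_field X \<longleftrightarrow> holo_map_germ X \<and> X 0 = 0"

text \<open>
  \<open>\<psi> s\<close> represents the germ at the origin of the time \<open>s\<close> flow of \<open>X\<close>. The neighbourhood \<open>U\<close>
  of initial points may shrink as the bound \<open>R\<close> on the complex time grows; trajectories stay in
  a domain \<open>V\<close> where \<open>X\<close> is holomorphic, so that the germs \<open>\<psi> s\<close> are determined by the germ
  of \<open>X\<close>. The values of \<open>\<psi> s\<close> away from the origin are irrelevant.
\<close>

definition is_flow ::
    "(complex ^ 2 \<Rightarrow> complex ^ 2) \<Rightarrow> (complex \<Rightarrow> complex ^ 2 \<Rightarrow> complex ^ 2) \<Rightarrow> bool" where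
  "is_flow X \<psi> \<longleftrightarrow> (\<exists>V. holo_map_on X V \<and>
     (\<forall>R>0. \<exists>U. open U \<and> 0 \<in> U \<and>
        (\<forall>z\<in>U. \<psi> 0 z = z \<and>
           (\<forall>s\<in>ball 0 R. \<psi> s z \<in> V \<and>
              ((\<lambda>s. \<psi> s z) has_derivative (\<lambda>h. h *s X (\<psi> s z))) (at s)))))"

definition connected_by_geodesic :: "set_germ \<Rightarrow> set_germ \<Rightarrow> bool" where
  "connected_by_geodesic \<Gamma>\<^sub>1 \<Gamma>\<^sub>2 \<longleftrightarrow>
     (\<exists>X \<psi>. singular_vector_field X \<and> is_flow X \<psi> \<and> filtermap (\<psi> 1) \<Gamma>\<^sub>1 = \<Gamma>\<^sub>2)"

definition holomorphic_deformation ::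
    "complex set \<Rightarrow> (complex ^ 2 \<Rightarrow> complex ^ 2) \<Rightarrow> set_germ \<Rightarrow> (complex \<Rightarrow> set_germ) \<Rightarrow> bool" where
  "holomorphic_deformation E X \<Gamma> \<Delta> \<longleftrightarrow>
     (\<exists>\<psi>. is_flow X \<psi> \<and> (\<forall>\<epsilon>\<in>E. \<Delta> \<epsilon> = filtermap (\<psi> (- \<epsilon>)) \<Gamma>))"

end

theory Submission
  imports Defs "HOL-Complex_Analysis.Conformal_Mappings" "HOL-Computational_Algebra.Fundamental_Theorem_Algebra"
begin

text \<open>
  Let \<open>\<Gamma>' = (f = 0)\<close>, \<open>\<Gamma> = (g = 0)\<close> and \<open>\<phi>(\<Gamma>') = \<Gamma>\<close>. Deform \<open>\<Gamma>'\<close> by a linear field \<open>X\<close> with eigenvalues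
  3 and 2 whose flow \<open>S\<close> at time \<open>\<epsilon>\<close> moves the tangent lines of \<open>\<Gamma>'\<close>. For small real \<open>\<epsilon> > 0\<close> the
  germs \<open>f \<circ> S\<close> and \<open>g\<close> have coprime lowest forms, so that they generate all germs of order at
  least the sum of their orders, and the linear part of \<open>\<sigma> = \<phi> \<circ> S\<close> has no resonance up to that
  order: both conditions exclude finitely many values of \<open>e\<^sup>\<epsilon>\<close>. Solving the homological equation to
  finite order gives \<open>p\<close> with \<open>p \<circ> \<sigma> - \<alpha> p\<close> of high order, hence
  \<open>\<alpha> (p \<circ> \<sigma>\<inverse>) - p = (f \<circ> S) k + g l\<close>. Then \<open>G = p + (f \<circ> S) k\<close> agrees with \<open>p\<close> on the deformed branch and
  with \<open>\<alpha> (p \<circ> \<sigma>\<inverse>)\<close> on \<open>\<Gamma>\<close>, that is, \<open>G = \<alpha> (G \<circ> \<sigma>\<inverse>)\<close> on \<open>\<Gamma>\<close>. Two such functions are coordinates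
  in which \<open>\<sigma>\<inverse>\<close> restricted to \<open>\<Gamma>\<close> is diagonal linear, hence the time 1 flow of a vector field.
  No small divisors occur, as everything is done to finite order.
\<close>

subsection \<open>Separately holomorphic functions on a polydisc\<close>

text \<open>A germ of biholomorphism need not be the time 1 map of a holomorphic field: resonances
  and small divisors obstruct its linearization. But only the restriction to \<Gamma> counts, and
  there an error in an ideal that vanishes on \<Gamma> is harmless. The equation \<open>g\<close>
  alone generates too small an ideal to absorb every remainder of high order. The deformation
  supplies a second equation: once the deformed branch shares no tangent with \<Gamma>, the two
  equations generate a power of the maximal ideal, and a finite jet of the linearization suffices.

  The weights 3 and 2 have two tasks. Their difference makes the flow rescale slopes by a power of
  \<open>u = exp \<epsilon>\<close>. Their size makes \<open>u \<rightarrow> 0\<close> a strong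
  contraction: in the symmetrized resonance condition the determinant term has order 5 in
  \<open>u\<close>, the other terms at least 6. With weights 2 and 1, two terms would start at order
  3 for \<open>i + j = 2\<close> and their leading parts could cancel.

  Orders of vanishing are treated as powers of the maximal ideal, with Hadamard's lemma in the place
  of power series.\<close>

definition sep_holo :: "(complex \<Rightarrow> complex \<Rightarrow> complex) \<Rightarrow> real \<Rightarrow> bool" where
  "sep_holo F r \<longleftrightarrow> continuous_on (ball 0 r \<times> ball 0 r) (\<lambda>(x, y). F x y) \<and>
     (\<forall>y\<in>ball 0 r. (\<lambda>x. F x y) holomorphic_on ball 0 r) \<and>
     (\<forall>x\<in>ball 0 r. F x holomorphic_on ball 0 r)"

lemma sep_holo_swap: "sep_holo F r \<Longrightarrow> sep_holo (\<lambda>x y. F y x) r"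
proof -
  assume F: "sep_holo F r"
  have "continuous_on (ball 0 r \<times> ball 0 r) (\<lambda>p. (\<lambda>(x, y). F x y) (snd p, fst p))"
    by (rule continuous_on_compose2[of "ball 0 r \<times> ball 0 r"])
      (use F in \<open>auto simp: sep_holo_def intro!: continuous_intros\<close>)
  then show ?thesis
    using F by (simp add: sep_holo_def case_prod_unfold)
qed

lemma sep_holoD:
  assumes "sep_holo F r" "S \<subseteq> ball 0 r"
  shows "y \<in> ball 0 r \<Longrightarrow> (\<lambda>x. F x y) holomorphic_on S" "x \<in> ball 0 r \<Longrightarrow> F x holomorphic_on S"
  using assms holomorphic_on_subset unfolding sep_holo_def by blast+

lemma sep_holo_subset:
  assumes F: "sep_holo F r" and r': "r' \<le> r"
  shows "sep_holo F r'"
proof -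
  have sub: "ball 0 r' \<subseteq> ball (0::complex) r" using r' by auto
  have "continuous_on (ball 0 r' \<times> ball 0 r') (\<lambda>(x, y). F x y)"
    by (rule continuous_on_subset[of "ball 0 r \<times> ball 0 r"])
      (use F sub in \<open>auto simp: sep_holo_def\<close>)
  then show ?thesis
    using sep_holoD[OF F sub] sub unfolding sep_holo_def by blast
qed

lemma sep_holo_continuous:
  assumes "sep_holo F r" "continuous_on S f" "continuous_on S g"
    and "\<And>s. s \<in> S \<Longrightarrow> f s \<in> ball 0 r" "\<And>s. s \<in> S \<Longrightarrow> g s \<in> ball 0 r"
  shows "continuous_on S (\<lambda>s. F (f s) (g s))"
proof -
  have "continuous_on S (\<lambda>s. (\<lambda>(x, y). F x y) (f s, g s))"
    by (rule continuous_on_compose2[of "ball 0 r \<times> ball 0 r"])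
      (use assms in \<open>auto simp: sep_holo_def intro!: continuous_intros\<close>)
  then show ?thesis by simp
qed

text \<open>Cauchy's formula over a fixed interval: the integrand is jointly continuous in
  \<open>x\<close>, \<open>y\<close> and \<open>t\<close>, so continuity and holomorphy of the
  partial derivative reduce to theorems on integrals with a parameter.\<close>

lemma sep_holo_deriv_integral:
  assumes F: "sep_holo F r" and R: "R < r" and x: "x \<in> ball 0 R" and y: "y \<in> ball 0 r"
  shows "deriv (\<lambda>x. F x y) x =
    1 / (2 * of_real pi * \<i>) * integral (cbox 0 1) (\<lambda>t. F (circlepath 0 R t) y / (circlepath 0 R t - x)^2
        * vector_derivative (circlepath 0 R) (at t))"
proof -
  have hol: "(\<lambda>x. F x y) holomorphic_on cball 0 R"
    by (rule sep_holoD[OF F _ y]) (use R in auto)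
  have "contour_integral (circlepath 0 R) (\<lambda>u. F u y / (u - x)^2) = (2 * pi * \<i>) * deriv (\<lambda>x. F x y) x"
    by (rule Cauchy_contour_integral_circlepath_2)
      (use hol x holomorphic_on_subset[OF hol ball_subset_cball] in
        \<open>auto intro!: holomorphic_on_imp_continuous_on\<close>)
  then show ?thesis by (simp add: contour_integral_integral)
qed

lemma circlepath_in_ball: "0 \<le> R \<Longrightarrow> R < r \<Longrightarrow> circlepath 0 R t \<in> ball 0 r"
  by (simp add: circlepath norm_mult)

lemma circlepath_ne: "x \<in> ball 0 R \<Longrightarrow> circlepath 0 R t \<noteq> x"
  by (auto simp: circlepath norm_mult)

lemma continuous_on_circlepath [continuous_intros]:
  "continuous_on S f \<Longrightarrow> continuous_on S (\<lambda>s. circlepath z R (f s))"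
  unfolding circlepath by (intro continuous_intros)

lemma continuous_on_vector_derivative_circlepath [continuous_intros]:
  "continuous_on S f \<Longrightarrow> continuous_on S (\<lambda>s. vector_derivative (circlepath z R) (at (f s)))"
  unfolding vector_derivative_circlepath by (intro continuous_intros)

text \<open>Only the differentiated variable loses radius. This asymmetry matters in
  \<open>sep_holo_deriv\<close>, where the other variable runs over the circle of radius
  \<open>R\<close>, which does not lie in the open ball of that radius.\<close>

lemma sep_holo_deriv_continuous:
  assumes F: "sep_holo F r" and R: "R < r"
  shows "continuous_on (ball 0 R \<times> ball 0 r) (\<lambda>(x, y). deriv (\<lambda>x. F x y) x)"
proof (cases "R > 0")
  case True
  have "continuous_on (ball 0 R \<times> ball 0 r) (\<lambda>p. integral (cbox 0 1)
      (\<lambda>t. F (circlepath 0 R t) (snd p) / (circlepath 0 R t - fst p)^2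
        * vector_derivative (circlepath 0 R) (at t)))"
    apply (rule integral_continuous_on_param)
    unfolding case_prod_unfold
    apply (intro continuous_intros sep_holo_continuous[OF F])
    using True R circlepath_in_ball[of R r] circlepath_ne[of _ R] by auto
  then have "continuous_on (ball 0 R \<times> ball 0 r) (\<lambda>p. 1 / (2 * of_real pi * \<i>) * integral (cbox 0 1)
      (\<lambda>t. F (circlepath 0 R t) (snd p) / (circlepath 0 R t - fst p)^2
        * vector_derivative (circlepath 0 R) (at t)))"
    by (intro continuous_intros)
  then show ?thesis
    by (rule continuous_on_eq) (use sep_holo_deriv_integral[OF F R] in auto)
qed (auto simp: ball_empty)

lemma sep_holo_deriv:
  assumes F: "sep_holo F r" and R0: "0 < R" and R: "R < r"
  shows "sep_holo (\<lambda>x y. deriv (\<lambda>x. F x y) x) R"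
proof -
  have hol_y: "deriv (\<lambda>x. F x y) holomorphic_on ball 0 R" if "y \<in> ball 0 R" for y
  proof (rule holomorphic_deriv)
    show "(\<lambda>x. F x y) holomorphic_on ball 0 R"
      using sep_holo_subset[OF F, of R] R that by (auto simp: sep_holo_def)
  qed auto
  have hol_x: "(\<lambda>y. deriv (\<lambda>x. F x y) x) holomorphic_on ball 0 R" if x: "x \<in> ball 0 R" for x
  proof -
    have F_x: "F u holomorphic_on ball 0 r" if "u \<in> ball 0 r" for u
      using F that by (auto simp: sep_holo_def)
    \<comment> \<open>Holomorphy in the passive variable: Cauchy's integral is differentiated in
      \<open>y\<close> under the integral sign.\<close>
    have der: "((\<lambda>y. integral (cbox 0 1) (\<lambda>t. F (circlepath 0 R t) y / (circlepath 0 R t - x)^2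
          * vector_derivative (circlepath 0 R) (at t))) has_field_derivative
        integral (cbox 0 1) (\<lambda>t. deriv (F (circlepath 0 R t)) y / (circlepath 0 R t - x)^2
          * vector_derivative (circlepath 0 R) (at t))) (at y within ball 0 R)"
      if y: "y \<in> ball 0 R" for y
    proof (rule leibniz_rule_field_derivative)
      fix y t assume y: "y \<in> ball (0::complex) R" and t: "t \<in> cbox (0::real) 1"
      have "(F (circlepath 0 R t) has_field_derivative deriv (F (circlepath 0 R t)) y) (at y)"
        by (rule holomorphic_derivI[OF F_x[OF circlepath_in_ball]]) (use y R R0 in auto)
      then show "((\<lambda>y. F (circlepath 0 R t) y / (circlepath 0 R t - x)^2
          * vector_derivative (circlepath 0 R) (at t)) has_field_derivative
          deriv (F (circlepath 0 R t)) y / (circlepath 0 R t - x)^2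
          * vector_derivative (circlepath 0 R) (at t)) (at y within ball 0 R)"
        by (intro DERIV_cmult_right DERIV_cdivide) (rule has_field_derivative_at_within)
    next
      fix y assume y: "y \<in> ball (0::complex) R"
      show "(\<lambda>t. F (circlepath 0 R t) y / (circlepath 0 R t - x)\<^sup>2
          * vector_derivative (circlepath 0 R) (at t)) integrable_on cbox 0 1"
        apply (rule integrable_continuous)
        apply (intro continuous_intros sep_holo_continuous[OF F])
        using y R0 R circlepath_in_ball[of R r] circlepath_ne[of _ R] x by auto
    next
      have "continuous_on (ball 0 R \<times> cbox 0 1)
          (\<lambda>p. (\<lambda>(x, y). deriv (F y) x) (fst p, circlepath 0 R (snd p)))"
        by (rule continuous_on_compose2[OF sep_holo_deriv_continuous[OF sep_holo_swap[OF F] R]])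
          (use R0 R circlepath_in_ball[of R r] in \<open>auto intro!: continuous_intros\<close>)
      then have *: "continuous_on (ball 0 R \<times> cbox 0 1) (\<lambda>p. deriv (F (circlepath 0 R (snd p))) (fst p))"
        by simp
      show "continuous_on (ball 0 R \<times> cbox 0 1)
          (\<lambda>(y, t). deriv (F (circlepath 0 R t)) y / (circlepath 0 R t - x)\<^sup>2
            * vector_derivative (circlepath 0 R) (at t))"
        unfolding case_prod_unfold
        apply (intro continuous_intros *)
        using circlepath_ne[OF x] by auto
    qed (use y in auto)
    have "(\<lambda>y. integral (cbox 0 1) (\<lambda>t. F (circlepath 0 R t) y / (circlepath 0 R t - x)^2
          * vector_derivative (circlepath 0 R) (at t))) holomorphic_on ball 0 R"
      unfolding holomorphic_on_def field_differentiable_def by (intro ballI exI) (erule der)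
    then have "(\<lambda>y. 1 / (2 * of_real pi * \<i>) * integral (cbox 0 1) (\<lambda>t. F (circlepath 0 R t) y / (circlepath 0 R t - x)^2
          * vector_derivative (circlepath 0 R) (at t))) holomorphic_on ball 0 R"
      by (rule holomorphic_on_mult[OF holomorphic_on_const])
    then show ?thesis
    proof (rule holomorphic_transform)
      fix y assume "y \<in> ball (0::complex) R"
      then have "y \<in> ball 0 r" using R by auto
      from sep_holo_deriv_integral[OF F R x this]
      show "1 / (2 * of_real pi * \<i>) * integral (cbox 0 1) (\<lambda>t. F (circlepath 0 R t) y / (circlepath 0 R t - x)^2
          * vector_derivative (circlepath 0 R) (at t)) = deriv (\<lambda>x. F x y) x" by (rule sym)
    qed
  qed
  have "continuous_on (ball 0 R \<times> ball 0 R) (\<lambda>(x, y). deriv (\<lambda>x. F x y) x)"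
    by (rule continuous_on_subset[OF sep_holo_deriv_continuous[OF F R]]) (use R in auto)
  then show ?thesis
    unfolding sep_holo_def by (intro conjI ballI) (assumption, erule hol_y, erule hol_x)
qed

text \<open>Osgood's lemma: one of the two partial derivatives is continuous by Cauchy's formula.\<close>

lemma sep_holo_has_derivative:
  fixes z :: "complex ^ 2"
  assumes F: "sep_holo F r" and z: "z $ 1 \<in> ball 0 r" "z $ 2 \<in> ball 0 r"
  shows "((\<lambda>z. F (z $ 1) (z $ 2)) has_derivative
     (\<lambda>v. deriv (\<lambda>x. F x (z $ 2)) (z $ 1) * v $ 1 + deriv (F (z $ 1)) (z $ 2) * v $ 2)) (at z)"
proof -
  define R where "R = (max (cmod (z $ 1)) (cmod (z $ 2)) + r) / 2"
  have R: "R < r" and zR: "z $ 1 \<in> ball 0 R" "z $ 2 \<in> ball 0 R"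
    using z by (auto simp: R_def)
  have "0 < R" using zR(1) by (simp add: le_less_trans[OF norm_ge_zero])
  define B where "B = ball (0::complex) R"
  have "((\<lambda>(x, y). F x y) has_derivative
      (\<lambda>(tx, ty). deriv (\<lambda>x. F x (z $ 2)) (z $ 1) * tx + blinfun_mult_right (deriv (F (z $ 1)) (z $ 2)) ty))
      (at (z $ 1, z $ 2) within B \<times> B)"
  proof (rule has_derivative_partialsI)
    have "(\<lambda>x. F x (z $ 2)) holomorphic_on ball 0 r"
      using F z by (auto simp: sep_holo_def)
    then have "((\<lambda>x. F x (z $ 2)) has_field_derivative deriv (\<lambda>x. F x (z $ 2)) (z $ 1)) (at (z $ 1))"
      by (rule holomorphic_derivI) (use z in auto)
    then show "((\<lambda>x. F x (z $ 2)) has_derivative (*) (deriv (\<lambda>x. F x (z $ 2)) (z $ 1)))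
        (at (z $ 1) within B)"
      unfolding has_field_derivative_def by (rule has_derivative_at_withinI)
  next
    fix x y assume "x \<in> B" "y \<in> B"
    then have xy: "x \<in> ball 0 r" "y \<in> ball 0 r" using R by (auto simp: B_def)
    then have "F x holomorphic_on ball 0 r" using F by (auto simp: sep_holo_def)
    then have "(F x has_field_derivative deriv (F x) y) (at y)"
      by (rule holomorphic_derivI) (use xy in auto)
    then show "(F x has_derivative blinfun_apply (blinfun_mult_right (deriv (F x) y))) (at y within B)"
      unfolding has_field_derivative_def by (auto intro: has_derivative_at_withinI)
  next
    have "sep_holo (\<lambda>x y. deriv (F x) y) R"
      using sep_holo_swap[OF sep_holo_deriv[OF sep_holo_swap[OF F] \<open>0 < R\<close> R]] by simp
    then have "continuous_on (B \<times> B) (\<lambda>p. deriv (F (fst p)) (snd p))"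
      by (rule sep_holo_continuous) (auto simp: B_def intro!: continuous_intros)
    then have "continuous_on (B \<times> B) (\<lambda>p. blinfun_mult_right (deriv (F (fst p)) (snd p)))"
      by (intro bounded_linear.continuous_on[OF bounded_linear_blinfun_mult_right])
    then show "continuous (at (z $ 1, z $ 2) within B \<times> B)
        (\<lambda>(x, y). blinfun_mult_right (deriv (F x) y))"
      using zR by (auto simp: B_def continuous_on_eq_continuous_within case_prod_unfold)
  qed (use zR in \<open>auto simp: B_def\<close>)
  then have *: "((\<lambda>(x, y). F x y) has_derivative
      (\<lambda>(tx, ty). deriv (\<lambda>x. F x (z $ 2)) (z $ 1) * tx + deriv (F (z $ 1)) (z $ 2) * ty))
      (at (z $ 1, z $ 2))"
    using zR at_within_open[of "(z $ 1, z $ 2)" "B \<times> B"] by (simp add: B_def open_Times)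
  have "((\<lambda>z::complex ^ 2. (z $ 1, z $ 2)) has_derivative (\<lambda>v. (v $ 1, v $ 2))) (at z)"
    by (intro has_derivative_Pair bounded_linear_imp_has_derivative bounded_linear_vec_nth)
  from diff_chain_at[OF this *] show ?thesis
    by (simp add: o_def)
qed

subsection \<open>Germs of holomorphic functions\<close>

text \<open>Differentiability at a single point, with the complex linear derivative given by its two
  coefficients instead of by homogeneity, so that calculus becomes arithmetic with \<open>a\<close>
  and \<open>b\<close>.\<close>

definition holo_at :: "(complex ^ 2 \<Rightarrow> complex) \<Rightarrow> complex ^ 2 \<Rightarrow> bool" where
  "holo_at f z \<longleftrightarrow> (\<exists>a b. (f has_derivative (\<lambda>v. a * v $ 1 + b * v $ 2)) (at z))"

lemma vec2_decompose: "(v :: complex ^ 2) = v $ 1 *s axis 1 1 + v $ 2 *s axis 2 1"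
  by (simp add: vec_eq_iff forall_2 axis_def)

lemma holo_fun_on_iff: "holo_fun_on f V \<longleftrightarrow> open V \<and> (\<forall>z\<in>V. holo_at f z)"
proof -
  have "(\<exists>D. (f has_derivative D) (at z) \<and> (\<forall>c v. D (c *s v) = c * D v)) \<longleftrightarrow> holo_at f z" for z
  proof
    assume "\<exists>D. (f has_derivative D) (at z) \<and> (\<forall>c v. D (c *s v) = c * D v)"
    then obtain D where D: "(f has_derivative D) (at z)" and hom: "\<And>c v. D (c *s v) = c * D v"
      by blast
    interpret linear D using D by (rule has_derivative_linear)
    have "D = (\<lambda>v. D (axis 1 1) * v $ 1 + D (axis 2 1) * v $ 2)"
    proof
      fix v
      have "D v = D (v $ 1 *s axis 1 1 + v $ 2 *s axis 2 1)"
        using vec2_decompose[of v] by simp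
      then show "D v = D (axis 1 1) * v $ 1 + D (axis 2 1) * v $ 2"
        by (simp add: add hom)
    qed
    then show "holo_at f z" using D unfolding holo_at_def by metis
  next
    assume "holo_at f z"
    then obtain a b where "(f has_derivative (\<lambda>v. a * v $ 1 + b * v $ 2)) (at z)"
      by (auto simp: holo_at_def)
    then show "\<exists>D. (f has_derivative D) (at z) \<and> (\<forall>c v. D (c *s v) = c * D v)"
      by (intro exI conjI allI) (auto simp: algebra_simps)
  qed
  then show ?thesis by (simp add: holo_fun_on_def)
qed

lemma holo_fun_germ_iff: "holo_fun_germ f \<longleftrightarrow> (\<forall>\<^sub>F z in nhds 0. holo_at f z)"
  unfolding holo_fun_germ_def holo_fun_on_iff eventually_nhds by blast

lemma holo_map_germ_iff: "holo_map_germ F \<longleftrightarrow> (\<forall>i. holo_fun_germ (\<lambda>z. F z $ i))"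
proof
  assume "\<forall>i. holo_fun_germ (\<lambda>z. F z $ i)"
  then have "\<forall>\<^sub>F z in nhds 0. holo_at (\<lambda>z. F z $ 1) z \<and> holo_at (\<lambda>z. F z $ 2) z"
    by (intro eventually_conj) (auto simp: holo_fun_germ_iff)
  then show "holo_map_germ F"
    unfolding holo_map_germ_def holo_map_on_def holo_fun_on_iff eventually_nhds forall_2 by blast
qed (auto simp: holo_map_germ_def holo_map_on_def holo_fun_germ_def)

lemma holo_at_const [simp]: "holo_at (\<lambda>z. c) z"
  unfolding holo_at_def by (rule exI[of _ 0], rule exI[of _ 0]) (simp add: has_derivative_const)

lemma holo_at_nth [simp]: "holo_at (\<lambda>z. z $ i) z"
proof -
  have "((\<lambda>z::complex^2. z $ i) has_derivative (\<lambda>v. v $ i)) (at z)"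
    by (intro bounded_linear_imp_has_derivative bounded_linear_vec_nth)
  then have "((\<lambda>z. z $ i) has_derivative (\<lambda>v. (if i = 1 then 1 else 0) * v $ 1 + (if i = 1 then 0 else 1) * v $ 2)) (at z)"
    using exhaust_2[of i] by auto
  then show ?thesis unfolding holo_at_def by blast
qed

lemma holo_at_add: "holo_at f z \<Longrightarrow> holo_at g z \<Longrightarrow> holo_at (\<lambda>z. f z + g z) z"
  unfolding holo_at_def
proof (elim exE)
  fix a b c d
  assume "(f has_derivative (\<lambda>v. a * v $ 1 + b * v $ 2)) (at z)"
    "(g has_derivative (\<lambda>v. c * v $ 1 + d * v $ 2)) (at z)"
  from has_derivative_add[OF this]
  have "((\<lambda>z. f z + g z) has_derivative (\<lambda>v. (a + c) * v $ 1 + (b + d) * v $ 2)) (at z)"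
    by (simp add: algebra_simps)
  then show "\<exists>a b. ((\<lambda>z. f z + g z) has_derivative (\<lambda>v. a * v $ 1 + b * v $ 2)) (at z)"
    by blast
qed

lemma holo_at_mult: "holo_at f z \<Longrightarrow> holo_at g z \<Longrightarrow> holo_at (\<lambda>z. f z * g z) z"
  unfolding holo_at_def
proof (elim exE)
  fix a b c d
  assume "(f has_derivative (\<lambda>v. a * v $ 1 + b * v $ 2)) (at z)"
    "(g has_derivative (\<lambda>v. c * v $ 1 + d * v $ 2)) (at z)"
  from has_derivative_mult[OF this]
  have "((\<lambda>z. f z * g z) has_derivative
      (\<lambda>v. (f z * c + a * g z) * v $ 1 + (f z * d + b * g z) * v $ 2)) (at z)"
    by (simp add: algebra_simps)
  then show "\<exists>a b. ((\<lambda>z. f z * g z) has_derivative (\<lambda>v. a * v $ 1 + b * v $ 2)) (at z)"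
    by blast
qed

lemma holo_at_imp_isCont: "holo_at f z \<Longrightarrow> isCont f z"
  unfolding holo_at_def using has_derivative_continuous by blast

lemma holo_at_compose_field:
  assumes "holo_at f z" and h: "(h has_field_derivative h') (at (f z))"
  shows "holo_at (\<lambda>z. h (f z)) z"
proof -
  obtain a b where "(f has_derivative (\<lambda>v. a * v $ 1 + b * v $ 2)) (at z)"
    using assms by (auto simp: holo_at_def)
  from diff_chain_at[OF this h[unfolded has_field_derivative_def]]
  have "((\<lambda>z. h (f z)) has_derivative (\<lambda>v. (h' * a) * v $ 1 + (h' * b) * v $ 2)) (at z)"
    by (simp add: o_def algebra_simps)
  then show ?thesis unfolding holo_at_def by blast
qed

lemma has_derivative_vec2:
  fixes F :: "'a::real_normed_vector \<Rightarrow> complex ^ 2"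
  assumes "\<And>i. ((\<lambda>z. F z $ i) has_derivative (\<lambda>v. D v $ i)) (at z)"
  shows "(F has_derivative D) (at z)"
proof -
  have *: "bounded_linear (axis i :: complex \<Rightarrow> complex ^ 2)" for i
    by (intro linear_conv_bounded_linear[THEN iffD1] linearI)
      (auto simp: axis_def vec_eq_iff)
  have eq: "w = axis 1 (w $ 1) + axis 2 (w $ 2)" for w :: "complex ^ 2"
    by (simp add: vec_eq_iff forall_2 axis_def)
  have "((\<lambda>z. axis 1 (F z $ 1) + axis 2 (F z $ 2) :: complex ^ 2) has_derivative
      (\<lambda>v. axis 1 (D v $ 1) + axis 2 (D v $ 2))) (at z)"
    by (intro has_derivative_add bounded_linear.has_derivative[OF *] assms)
  then show ?thesis by (simp add: eq[symmetric])
qed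

lemma holo_at_compose:
  assumes F: "\<And>i. holo_at (\<lambda>z. F z $ i) z" and f: "holo_at f (F z)"
  shows "holo_at (\<lambda>z. f (F z)) z"
proof -
  have "\<forall>i. \<exists>a b. ((\<lambda>z. F z $ i) has_derivative (\<lambda>v. a * v $ 1 + b * v $ 2)) (at z)"
    using F by (auto simp: holo_at_def)
  then obtain a b where ab: "\<And>i. ((\<lambda>z. F z $ i) has_derivative (\<lambda>v. a i * v $ 1 + b i * v $ 2)) (at z)"
    unfolding choice_iff by blast
  have "(F has_derivative (\<lambda>v. \<chi> i. a i * v $ 1 + b i * v $ 2)) (at z)"
    by (rule has_derivative_vec2) (simp add: ab)
  moreover obtain c d where "(f has_derivative (\<lambda>v. c * v $ 1 + d * v $ 2)) (at (F z))"
    using f by (auto simp: holo_at_def)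
  ultimately have "((f \<circ> F) has_derivative
      (\<lambda>v. c * v $ 1 + d * v $ 2) \<circ> (\<lambda>v. \<chi> i. a i * v $ 1 + b i * v $ 2)) (at z)"
    by (rule diff_chain_at)
  then have "((\<lambda>z. f (F z)) has_derivative
      (\<lambda>v. (c * a 1 + d * a 2) * v $ 1 + (c * b 1 + d * b 2) * v $ 2)) (at z)"
    by (simp add: o_def algebra_simps)
  then show ?thesis unfolding holo_at_def by blast
qed

lemma holo_fun_germ_const [simp]: "holo_fun_germ (\<lambda>z. c)"
  by (simp add: holo_fun_germ_iff)

lemma holo_fun_germ_nth [simp]: "holo_fun_germ (\<lambda>z. z $ i)"
  by (simp add: holo_fun_germ_iff)

lemma holo_fun_germ_add: "holo_fun_germ f \<Longrightarrow> holo_fun_germ g \<Longrightarrow> holo_fun_germ (\<lambda>z. f z + g z)"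
  unfolding holo_fun_germ_iff by (erule (1) eventually_elim2) (rule holo_at_add)

lemma holo_fun_germ_mult: "holo_fun_germ f \<Longrightarrow> holo_fun_germ g \<Longrightarrow> holo_fun_germ (\<lambda>z. f z * g z)"
  unfolding holo_fun_germ_iff by (erule (1) eventually_elim2) (rule holo_at_mult)

lemma holo_fun_germ_imp_isCont: "holo_fun_germ f \<Longrightarrow> isCont f 0"
  using eventually_nhds_x_imp_x holo_at_imp_isCont holo_fun_germ_iff by blast

lemma holo_fun_germ_tendsto: "holo_fun_germ f \<Longrightarrow> (f \<longlongrightarrow> f 0) (nhds 0)"
  using holo_fun_germ_imp_isCont isCont_def tendsto_at_iff_tendsto_nhds by blast

lemma holo_fun_germ_inverse:
  assumes f: "holo_fun_germ f" and "f 0 \<noteq> 0"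
  shows "holo_fun_germ (\<lambda>z. inverse (f z))"
proof -
  have "\<forall>\<^sub>F z in nhds 0. f z \<noteq> 0"
    by (rule tendsto_imp_eventually_ne[OF holo_fun_germ_tendsto[OF f] assms(2)])
  then show ?thesis
    using f unfolding holo_fun_germ_iff
  proof eventually_elim
    case (elim z)
    then show ?case
      by (intro holo_at_compose_field[where h = inverse]) (auto intro!: derivative_eq_intros)
  qed
qed

lemma holo_map_germ_tendsto:
  assumes "holo_map_germ F" shows "(F \<longlongrightarrow> F 0) (nhds 0)"
  using assms by (intro vec_tendstoI holo_fun_germ_tendsto) (simp add: holo_map_germ_iff)

lemma holo_fun_germ_compose:
  assumes f: "holo_fun_germ f" and F: "holo_map_germ F" "F 0 = 0"
  shows "holo_fun_germ (\<lambda>z. f (F z))"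
proof -
  have "filterlim F (nhds 0) (nhds 0)"
    using holo_map_germ_tendsto[OF F(1)] F(2) by simp
  then have "\<forall>\<^sub>F z in nhds 0. holo_at f (F z)"
    using f unfolding holo_fun_germ_iff filterlim_iff by blast
  moreover have "\<forall>\<^sub>F z in nhds 0. holo_at (\<lambda>z. F z $ 1) z" "\<forall>\<^sub>F z in nhds 0. holo_at (\<lambda>z. F z $ 2) z"
    using F by (auto simp: holo_map_germ_iff holo_fun_germ_iff)
  ultimately show ?thesis
    unfolding holo_fun_germ_iff
  proof eventually_elim
    case (elim z)
    then have "\<forall>i. holo_at (\<lambda>z. F z $ i) z" by (simp add: forall_2)
    then show ?case using elim(1) holo_at_compose by blast
  qed
qed

lemma holo_map_germ_compose:
  assumes "holo_map_germ G" "holo_map_germ F" "F 0 = 0"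
  shows "holo_map_germ (\<lambda>z. G (F z))"
  unfolding holo_map_germ_iff
  using holo_fun_germ_compose[of "\<lambda>z. G z $ i" F for i] assms by (simp add: holo_map_germ_iff)

definition vec2 :: "complex \<Rightarrow> complex \<Rightarrow> complex ^ 2" where
  "vec2 x y = (\<chi> i. if i = 1 then x else y)"

lemma vec2_nth [simp]: "vec2 x y $ 1 = x" "vec2 x y $ 2 = y"
  by (simp_all add: vec2_def)

lemma vec2_eta [simp]: "vec2 (z $ 1) (z $ 2) = z"
  by (simp add: vec_eq_iff forall_2)

lemma norm_vec2_le: "norm (vec2 x y) \<le> norm x + norm y"
  using L2_set_le_sum[of UNIV "\<lambda>i. norm (vec2 x y $ i)"] by (simp add: norm_vec_def sum_2)

lemma has_derivative_vec2_curry: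
  "((\<lambda>x. vec2 x y) has_derivative (\<lambda>h. vec2 h 0)) (at x)"
  "((\<lambda>y. vec2 x y) has_derivative (\<lambda>h. vec2 0 h)) (at y)"
proof -
  show "((\<lambda>x. vec2 x y) has_derivative (\<lambda>h. vec2 h 0)) (at x)"
  proof (rule has_derivative_vec2)
    fix i :: 2 show "((\<lambda>x. vec2 x y $ i) has_derivative (\<lambda>h. vec2 h 0 $ i)) (at x)"
      by (cases "i = 1") (auto simp: vec2_def)
  qed
  show "((\<lambda>y. vec2 x y) has_derivative (\<lambda>h. vec2 0 h)) (at y)"
  proof (rule has_derivative_vec2)
    fix i :: 2 show "((\<lambda>y. vec2 x y $ i) has_derivative (\<lambda>h. vec2 0 h $ i)) (at y)"
      by (cases "i = 1") (auto simp: vec2_def)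
  qed
qed

lemma continuous_on_vec2 [continuous_intros]:
  assumes "continuous_on S f" "continuous_on S g"
  shows "continuous_on S (\<lambda>s. vec2 (f s) (g s))"
  unfolding vec2_def
proof (rule continuous_on_vec_lambda)
  fix i :: 2 show "continuous_on S (\<lambda>s. if i = 1 then f s else g s)"
    using assms by (cases "i = 1") auto
qed

lemma holo_fun_germ_imp_sep_holo:
  assumes "holo_fun_germ f"
  obtains r where "r > 0" "sep_holo (\<lambda>x y. f (vec2 x y)) r"
    "\<And>x y. x \<in> ball 0 r \<Longrightarrow> y \<in> ball 0 r \<Longrightarrow> holo_at f (vec2 x y)"
proof -
  obtain d where d: "d > 0" "\<And>z. norm z < d \<Longrightarrow> holo_at f z"
    using assms unfolding holo_fun_germ_iff eventually_nhds_metric by auto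
  \<comment> \<open>The norm is at most the sum of the moduli of the coordinates, hence the radius
    \<open>d/2\<close> for the polydisc.\<close>
  have ball: "norm (vec2 x y) < d" if "x \<in> ball 0 (d/2)" "y \<in> ball 0 (d/2)" for x y
    using norm_vec2_le[of x y] that by auto
  have at: "holo_at f (vec2 x y)" if "x \<in> ball 0 (d/2)" "y \<in> ball 0 (d/2)" for x y
    using d(2) ball that by blast
  have "sep_holo (\<lambda>x y. f (vec2 x y)) (d/2)"
    unfolding sep_holo_def
  proof (intro conjI ballI)
    have "continuous_on (ball 0 d) f"
      by (auto intro!: continuous_at_imp_continuous_on holo_at_imp_isCont d(2))
    then have "continuous_on (ball 0 (d/2) \<times> ball 0 (d/2)) (\<lambda>p. f (vec2 (fst p) (snd p)))"
      by (rule continuous_on_compose2) (use ball in \<open>auto intro!: continuous_intros\<close>)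
    then show "continuous_on (ball 0 (d/2) \<times> ball 0 (d/2)) (\<lambda>(x, y). f (vec2 x y))"
      by (simp add: case_prod_unfold)
  next
    fix y :: complex assume y: "y \<in> ball 0 (d/2)"
    have "(\<lambda>x. f (vec2 x y)) field_differentiable at x" if x: "x \<in> ball 0 (d/2)" for x
    proof -
      obtain a b where "(f has_derivative (\<lambda>v. a * v $ 1 + b * v $ 2)) (at (vec2 x y))"
        using at[OF x y] by (auto simp: holo_at_def)
      from diff_chain_at[OF has_derivative_vec2_curry(1) this]
      have "((\<lambda>x. f (vec2 x y)) has_field_derivative a) (at x)"
        by (simp add: o_def has_field_derivative_def)
      then show ?thesis by (auto simp: field_differentiable_def)
    qed
    then show "(\<lambda>x. f (vec2 x y)) holomorphic_on ball 0 (d/2)"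
      by (simp add: holomorphic_on_open field_differentiable_def)
  next
    fix x :: complex assume x: "x \<in> ball 0 (d/2)"
    have "(\<lambda>y. f (vec2 x y)) field_differentiable at y" if y: "y \<in> ball 0 (d/2)" for y
    proof -
      obtain a b where "(f has_derivative (\<lambda>v. a * v $ 1 + b * v $ 2)) (at (vec2 x y))"
        using at[OF x y] by (auto simp: holo_at_def)
      from diff_chain_at[OF has_derivative_vec2_curry(2) this]
      have "((\<lambda>y. f (vec2 x y)) has_field_derivative b) (at y)"
        by (simp add: o_def has_field_derivative_def)
      then show ?thesis by (auto simp: field_differentiable_def)
    qed
    then show "(\<lambda>y. f (vec2 x y)) holomorphic_on ball 0 (d/2)"
      by (simp add: holomorphic_on_open field_differentiable_def)
  qed
  then show ?thesis
    by (rule that[rotated]) (use d(1) at in simp_all)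
qed

lemma eventually_polydisc:
  assumes "r > 0" shows "\<forall>\<^sub>F z :: complex ^ 2 in nhds 0. z $ 1 \<in> ball 0 r \<and> z $ 2 \<in> ball 0 r"
  unfolding eventually_nhds_metric using assms
  by (intro exI[of _ r]) (auto intro: le_less_trans[OF Finite_Cartesian_Product.norm_nth_le])

lemma sep_holo_imp_holo_fun_germ:
  assumes F: "sep_holo F r" and "r > 0"
  shows "holo_fun_germ (\<lambda>z. F (z $ 1) (z $ 2))"
  using eventually_polydisc[OF \<open>r > 0\<close>] unfolding holo_fun_germ_iff
proof eventually_elim
  case (elim z)
  then show ?case
    using sep_holo_has_derivative[OF F] unfolding holo_at_def by blast
qed

text \<open>The gain is that the coefficients of the derivative are germs again; Cauchy's formula
  supplies this regularity.\<close>

lemma holo_fun_germ_partials: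
  assumes "holo_fun_germ f"
  obtains f1 f2 where "holo_fun_germ f1" "holo_fun_germ f2"
    "\<forall>\<^sub>F z in nhds 0. (f has_derivative (\<lambda>v. f1 z * v $ 1 + f2 z * v $ 2)) (at z)"
proof -
  obtain r where r: "r > 0" and F: "sep_holo (\<lambda>x y. f (vec2 x y)) r"
    using holo_fun_germ_imp_sep_holo[OF assms] by metis
  define F where "F = (\<lambda>x y. f (vec2 x y))"
  note F = F[folded F_def]
  have "sep_holo (\<lambda>x y. deriv (\<lambda>x. F x y) x) (r/2)"
    by (rule sep_holo_deriv[OF F]) (use r in auto)
  then have 1: "holo_fun_germ (\<lambda>z. deriv (\<lambda>x. F x (z $ 2)) (z $ 1))"
    by (rule sep_holo_imp_holo_fun_germ) (use r in auto)
  have "sep_holo (\<lambda>x y. deriv (F x) y) (r/2)"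
    by (rule sep_holo_swap, rule sep_holo_deriv[OF sep_holo_swap[OF F]]) (use r in auto)
  then have 2: "holo_fun_germ (\<lambda>z. deriv (F (z $ 1)) (z $ 2))"
    by (rule sep_holo_imp_holo_fun_germ) (use r in auto)
  have "\<forall>\<^sub>F z in nhds 0. (f has_derivative (\<lambda>v. deriv (\<lambda>x. F x (z $ 2)) (z $ 1) * v $ 1
      + deriv (F (z $ 1)) (z $ 2) * v $ 2)) (at z)"
    using eventually_polydisc[OF r]
  proof eventually_elim
    case (elim z)
    then show ?case using sep_holo_has_derivative[OF F, of z] by (simp add: F_def)
  qed
  with 1 2 that show ?thesis by blast
qed

section \<open>Hadamard's lemma by integration along rays\<close>

lemma sep_holo_radial_holomorphic:
  assumes F: "sep_holo F r" and R: "0 < R" "R < r" and y: "y \<in> ball 0 R"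
  shows "(\<lambda>x. integral (cbox 0 1) (\<lambda>t. F (of_real t * x) (of_real t * y))) holomorphic_on ball 0 R"
proof -
  have in_R: "of_real t * x \<in> ball 0 R" if "t \<in> cbox 0 1" "x \<in> ball 0 R" for t and x :: complex
    using that mult_left_le_one_le[of "cmod x" t] by (auto simp: norm_mult)
  have in_r: "of_real t * x \<in> ball 0 r" if "t \<in> cbox 0 1" "x \<in> ball 0 R" for t and x :: complex
    using in_R[OF that] R by auto
  have "((\<lambda>x. integral (cbox 0 1) (\<lambda>t. F (of_real t * x) (of_real t * y))) has_field_derivative
      integral (cbox 0 1) (\<lambda>t. deriv (\<lambda>x. F x (of_real t * y)) (of_real t * x) * of_real t))
      (at x within ball 0 R)" if x: "x \<in> ball 0 R" for x
  proof (rule leibniz_rule_field_derivative)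
    fix x t assume x: "x \<in> ball (0::complex) R" and t: "t \<in> cbox (0::real) 1"
    have "(\<lambda>x. F x (of_real t * y)) holomorphic_on ball 0 r"
      by (rule sep_holoD[OF F]) (use in_r[OF t y] in auto)
    then have "((\<lambda>x. F x (of_real t * y)) has_field_derivative
        deriv (\<lambda>x. F x (of_real t * y)) (of_real t * x)) (at (of_real t * x))"
      by (rule holomorphic_derivI) (use in_r[OF t x] in auto)
    moreover have "((\<lambda>x. of_real t * x) has_field_derivative of_real t) (at x within ball 0 R)"
      by (auto intro!: derivative_eq_intros)
    ultimately show "((\<lambda>x. F (of_real t * x) (of_real t * y)) has_field_derivative
        deriv (\<lambda>x. F x (of_real t * y)) (of_real t * x) * of_real t) (at x within ball 0 R)"
      by (rule DERIV_chain2)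
  next
    fix x assume x: "x \<in> ball (0::complex) R"
    show "(\<lambda>t. F (of_real t * x) (of_real t * y)) integrable_on cbox 0 1"
      by (intro integrable_continuous sep_holo_continuous[OF F] continuous_intros in_r x y)
  next
    have "continuous_on (ball 0 R \<times> cbox 0 1)
        (\<lambda>p. deriv (\<lambda>x. F x (of_real (snd p) * y)) (of_real (snd p) * fst p))"
      by (rule sep_holo_continuous[OF sep_holo_deriv[OF F R]])
        (use in_R y in \<open>auto simp del: mem_ball intro!: continuous_intros\<close>)
    then show "continuous_on (ball 0 R \<times> cbox 0 1)
        (\<lambda>(x, t). deriv (\<lambda>x. F x (of_real t * y)) (of_real t * x) * of_real t)"
      unfolding case_prod_unfold by (intro continuous_on_mult continuous_intros)
  qed (use x in auto)
  then show ?thesis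
    unfolding holomorphic_on_def field_differentiable_def by (intro ballI exI)
qed

lemma sep_holo_radial:
  assumes F: "sep_holo F r" and R: "0 < R" "R < r"
  shows "sep_holo (\<lambda>x y. integral (cbox 0 1) (\<lambda>t. F (of_real t * x) (of_real t * y))) R"
  unfolding sep_holo_def
proof (intro conjI ballI)
  have in_r: "of_real t * x \<in> ball 0 r" if "t \<in> cbox 0 1" "x \<in> ball 0 R" for t and x :: complex
    using that R mult_left_le_one_le[of "cmod x" t] by (auto simp: norm_mult)
  have "continuous_on (ball 0 R \<times> ball 0 R)
      (\<lambda>p. integral (cbox 0 1) (\<lambda>t. F (of_real t * fst p) (of_real t * snd p)))"
    apply (rule integral_continuous_on_param)
    unfolding case_prod_unfold
    by (rule sep_holo_continuous[OF F])
      (use in_r in \<open>auto simp del: mem_ball mem_box intro!: continuous_intros\<close>)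
  then show "continuous_on (ball 0 R \<times> ball 0 R)
      (\<lambda>(x, y). integral (cbox 0 1) (\<lambda>t. F (of_real t * x) (of_real t * y)))"
    by (simp add: case_prod_unfold)
next
  fix y :: complex assume "y \<in> ball 0 R"
  then show "(\<lambda>x. integral (cbox 0 1) (\<lambda>t. F (of_real t * x) (of_real t * y))) holomorphic_on ball 0 R"
    by (rule sep_holo_radial_holomorphic[OF F R])
next
  fix x :: complex assume "x \<in> ball 0 R"
  then show "(\<lambda>y. integral (cbox 0 1) (\<lambda>t. F (of_real t * x) (of_real t * y))) holomorphic_on ball 0 R"
    by (rule sep_holo_radial_holomorphic[OF sep_holo_swap[OF F] R])
qed

text \<open>The fundamental theorem of calculus for \<open>t \<mapsto> f (t z)\<close>: the
  cofactors are the means of the partial derivatives over the segment from 0 to \<open>z\<close>,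
  and \<open>sep_holo_radial\<close> shows that such means are holomorphic.\<close>

lemma holo_fun_germ_hadamard:
  assumes f: "holo_fun_germ f"
  obtains h1 h2 where "holo_fun_germ h1" "holo_fun_germ h2"
    "\<forall>\<^sub>F z in nhds 0. f z = f 0 + z $ 1 * h1 z + z $ 2 * h2 z"
proof -
  obtain f1 f2 where f12: "holo_fun_germ f1" "holo_fun_germ f2"
    and der: "\<forall>\<^sub>F z in nhds 0. (f has_derivative (\<lambda>v. f1 z * v $ 1 + f2 z * v $ 2)) (at z)"
    by (rule holo_fun_germ_partials[OF f])
  define H where "H = (\<lambda>g (z::complex^2). integral (cbox 0 1) (\<lambda>t. g (of_real t *s z) :: complex))"
  have H: "holo_fun_germ (H g)" "\<forall>\<^sub>F z in nhds 0. (\<lambda>t. g (of_real t *s z)) integrable_on cbox 0 1"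
    if g: "holo_fun_germ g" for g
  proof -
    obtain r where r: "r > 0" and F: "sep_holo (\<lambda>x y. g (vec2 x y)) r"
      using holo_fun_germ_imp_sep_holo[OF g] by metis
    have eq: "vec2 (c * z $ 1) (c * z $ 2) = c *s z" for c z
      by (simp add: vec_eq_iff forall_2)
    have "holo_fun_germ (\<lambda>z. integral (cbox 0 1)
        (\<lambda>t. g (vec2 (of_real t * z $ 1) (of_real t * z $ 2))))"
      by (rule sep_holo_imp_holo_fun_germ[OF sep_holo_radial[OF F, of "r/2"]]) (use r in auto)
    then show "holo_fun_germ (H g)" by (simp add: H_def eq)
    show "\<forall>\<^sub>F z in nhds 0. (\<lambda>t. g (of_real t *s z)) integrable_on cbox 0 1"
      using eventually_polydisc[OF r]
    proof eventually_elim
      case (elim z)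
      have in_r: "of_real t * x \<in> ball 0 r" if "t \<in> cbox 0 1" "x \<in> ball 0 r" for t and x :: complex
        using that mult_left_le_one_le[of "cmod x" t] by (auto simp: norm_mult)
      have "continuous_on (cbox 0 1) (\<lambda>t. g (vec2 (of_real t * z $ 1) (of_real t * z $ 2)))"
        by (rule sep_holo_continuous[OF F]) (use in_r elim in \<open>auto simp del: mem_ball mem_box intro!: continuous_intros\<close>)
      then show ?case by (intro integrable_continuous) (simp add: eq)
    qed
  qed
  obtain d where d: "d > 0" "\<And>z. norm z < d \<Longrightarrow> (f has_derivative (\<lambda>v. f1 z * v $ 1 + f2 z * v $ 2)) (at z)"
    using der unfolding eventually_nhds_metric by auto
  have "\<forall>\<^sub>F z in nhds 0. norm (z::complex^2) < d"
    unfolding eventually_nhds_metric using d(1) by (intro exI[of _ d]) auto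
  then have "\<forall>\<^sub>F z in nhds 0. f z = f 0 + z $ 1 * H f1 z + z $ 2 * H f2 z"
    using H(2)[OF f12(1)] H(2)[OF f12(2)]
  proof eventually_elim
    case (elim z)
    have "((\<lambda>t. f1 (of_real t *s z) * z $ 1 + f2 (of_real t *s z) * z $ 2)
        has_integral f (of_real 1 *s z) - f (of_real 0 *s z)) {0..1}"
    proof (rule fundamental_theorem_of_calculus)
      fix t :: real assume t: "t \<in> {0..1}"
      have eq: "(\<lambda>t. of_real t *s z) = (\<lambda>t. t *\<^sub>R z)"
        by (rule ext) (simp add: vec_eq_iff scaleR_conv_of_real[where 'a = complex])
      have "norm (t *\<^sub>R z) < d"
        using elim(1) t mult_left_le_one_le[of "norm z" t] by auto
      from d(2)[OF this]
      have "(f has_derivative (\<lambda>v. f1 (t *\<^sub>R z) * v $ 1 + f2 (t *\<^sub>R z) * v $ 2)) (at (t *\<^sub>R z))" .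
      moreover have "((\<lambda>t. t *\<^sub>R z) has_derivative (\<lambda>h. h *\<^sub>R z)) (at t within {0..1})"
        by (auto intro!: derivative_eq_intros)
      ultimately have "((\<lambda>t. f (t *\<^sub>R z)) has_derivative
          (\<lambda>h. f1 (t *\<^sub>R z) * (h *\<^sub>R z) $ 1 + f2 (t *\<^sub>R z) * (h *\<^sub>R z) $ 2)) (at t within {0..1})"
        using has_derivative_compose by blast
      then show "((\<lambda>t. f (of_real t *s z)) has_vector_derivative
          f1 (of_real t *s z) * z $ 1 + f2 (of_real t *s z) * z $ 2) (at t within {0..1})"
        unfolding has_vector_derivative_def fun_cong[OF eq] by (simp add: algebra_simps)
    qed auto
    then have "f z - f 0 = integral {0..1} (\<lambda>t. f1 (of_real t *s z) * z $ 1 + f2 (of_real t *s z) * z $ 2)"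
      by (simp add: integral_unique)
    also have "\<dots> = H f1 z * z $ 1 + H f2 z * z $ 2"
      using elim by (simp add: H_def integral_add integrable_on_mult_left)
    finally show ?case by (simp add: algebra_simps)
  qed
  with H(1) f12 that show ?thesis by blast
qed

subsection \<open>The ring of germs\<close>

lemma germ_eq_refl [simp]: "germ_eq f f"
  by (simp add: germ_eq_def)

lemma germ_eq_sym: "germ_eq f g \<Longrightarrow> germ_eq g f"
  unfolding germ_eq_def by (erule eventually_mono) simp

lemma germ_eq_trans: "germ_eq f g \<Longrightarrow> germ_eq g h \<Longrightarrow> germ_eq f h"
  unfolding germ_eq_def by (erule (1) eventually_elim2) simp

lemma germ_eq_at_0: "germ_eq f g \<Longrightarrow> f 0 = g 0"
  unfolding germ_eq_def by (rule eventually_nhds_x_imp_x)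

\<comment> \<open>A partial quotient, as only functions holomorphic near the origin have a class.
  Once germs form a commutative ring, congruences modulo powers of an ideal are plain ring
  computations.\<close>
quotient_type hgerm = "complex ^ 2 \<Rightarrow> complex" /
  partial: "\<lambda>f g. holo_fun_germ f \<and> holo_fun_germ g \<and> germ_eq f g"
proof (rule part_equivpI)
  show "\<exists>f. holo_fun_germ f \<and> holo_fun_germ f \<and> germ_eq f f"
    by (intro exI[of _ "\<lambda>z. 0"]) simp
  show "symp (\<lambda>f g. holo_fun_germ f \<and> holo_fun_germ g \<and> germ_eq f g)"
    by (rule sympI) (blast intro: germ_eq_sym)
  show "transp (\<lambda>f g. holo_fun_germ f \<and> holo_fun_germ g \<and> germ_eq f g)"
    by (rule transpI) (blast intro: germ_eq_trans)
qed

lemma holo_fun_germ_uminus: "holo_fun_germ f \<Longrightarrow> holo_fun_germ (\<lambda>z. - f z)"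
  using holo_fun_germ_mult[of "\<lambda>z. - 1" f] by simp

lemma holo_fun_germ_diff: "holo_fun_germ f \<Longrightarrow> holo_fun_germ g \<Longrightarrow> holo_fun_germ (\<lambda>z. f z - g z)"
  using holo_fun_germ_add[OF _ holo_fun_germ_uminus, of f g] by simp

instantiation hgerm :: comm_ring_1
begin

lift_definition zero_hgerm :: hgerm is "\<lambda>z. 0" by simp
lift_definition one_hgerm :: hgerm is "\<lambda>z. 1" by simp
lift_definition plus_hgerm :: "hgerm \<Rightarrow> hgerm \<Rightarrow> hgerm" is "\<lambda>f g z. f z + g z"
  by (auto simp: germ_eq_def intro: holo_fun_germ_add elim: eventually_elim2)
lift_definition minus_hgerm :: "hgerm \<Rightarrow> hgerm \<Rightarrow> hgerm" is "\<lambda>f g z. f z - g z"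
  by (auto simp: germ_eq_def intro: holo_fun_germ_diff elim: eventually_elim2)
lift_definition uminus_hgerm :: "hgerm \<Rightarrow> hgerm" is "\<lambda>f z. - f z"
  by (auto simp: germ_eq_def intro: holo_fun_germ_uminus elim: eventually_mono)
lift_definition times_hgerm :: "hgerm \<Rightarrow> hgerm \<Rightarrow> hgerm" is "\<lambda>f g z. f z * g z"
  by (auto simp: germ_eq_def intro: holo_fun_germ_mult elim: eventually_elim2)

instance
proof
  fix a b c :: hgerm
  show "a + b + c = a + (b + c)"
    by transfer (auto simp: add.assoc intro!: holo_fun_germ_add)
  show "a + b = b + a"
    by transfer (auto simp: add.commute intro!: holo_fun_germ_add)
  show "0 + a = a"
    by transfer auto
  show "- a + a = 0"
    by transfer auto
  show "a - b = a + - b"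
    by transfer (auto intro!: holo_fun_germ_diff)
  show "a * b * c = a * (b * c)"
    by transfer (auto simp: mult.assoc intro!: holo_fun_germ_mult)
  show "a * b = b * a"
    by transfer (auto simp: mult.commute intro!: holo_fun_germ_mult)
  show "1 * a = a"
    by transfer auto
  show "(a + b) * c = a * c + b * c"
    by transfer (auto simp: distrib_right intro!: holo_fun_germ_mult holo_fun_germ_add)
  have "\<not> germ_eq (\<lambda>z. 0 :: complex) (\<lambda>z. 1)"
    using germ_eq_at_0[of "\<lambda>z. 0 :: complex" "\<lambda>z. 1"] by auto
  then show "(0 :: hgerm) \<noteq> 1"
    by transfer auto
qed

end

abbreviation germ :: "(complex ^ 2 \<Rightarrow> complex) \<Rightarrow> hgerm" where "germ \<equiv> abs_hgerm"

lemma germ_eq_iff: "holo_fun_germ f \<Longrightarrow> holo_fun_germ g \<Longrightarrow> germ f = germ g \<longleftrightarrow> germ_eq f g"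
  using Quotient3_rel[OF Quotient3_hgerm, of f g] by auto

lemma rep_hgerm: "holo_fun_germ (rep_hgerm h)" "germ (rep_hgerm h) = h"
  using Quotient3_rep_reflp[OF Quotient3_hgerm, of h] Quotient3_abs_rep[OF Quotient3_hgerm, of h]
  by auto

lemma hgerm_cases:
  obtains f where "holo_fun_germ f" "h = germ f"
  using rep_hgerm[of h] by metis

lemma germ_add: "holo_fun_germ f \<Longrightarrow> holo_fun_germ g \<Longrightarrow> germ (\<lambda>z. f z + g z) = germ f + germ g"
  by (simp add: plus_hgerm.abs_eq eq_onp_def)

lemma germ_mult: "holo_fun_germ f \<Longrightarrow> holo_fun_germ g \<Longrightarrow> germ (\<lambda>z. f z * g z) = germ f * germ g"
  by (simp add: times_hgerm.abs_eq eq_onp_def)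

lemma germ_diff: "holo_fun_germ f \<Longrightarrow> holo_fun_germ g \<Longrightarrow> germ (\<lambda>z. f z - g z) = germ f - germ g"
  by (simp add: minus_hgerm.abs_eq eq_onp_def)

definition const :: "complex \<Rightarrow> hgerm" where "const c = germ (\<lambda>z. c)"

definition coord :: "2 \<Rightarrow> hgerm" where "coord i = germ (\<lambda>z. z $ i)"

lift_definition val :: "hgerm \<Rightarrow> complex" is "\<lambda>f. f 0"
  by (auto dest: germ_eq_at_0)

lemma val_germ: "holo_fun_germ f \<Longrightarrow> val (germ f) = f 0"
  by (simp add: val.abs_eq eq_onp_def)

lemma const_0 [simp]: "const 0 = 0" and const_1 [simp]: "const 1 = 1"
  by (simp_all add: const_def zero_hgerm.abs_eq one_hgerm.abs_eq)

lemma const_add: "const (a + b) = const a + const b"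
  and const_mult: "const (a * b) = const a * const b"
  and const_diff: "const (a - b) = const a - const b"
  by (simp_all add: const_def germ_add[symmetric] germ_mult[symmetric] germ_diff[symmetric])

lemma const_power: "const (a ^ n) = const a ^ n"
  by (induction n) (simp_all add: const_mult)

lemma val_add [simp]: "val (a + b) = val a + val b"
  and val_mult [simp]: "val (a * b) = val a * val b"
  and val_diff [simp]: "val (a - b) = val a - val b"
  and val_const [simp]: "val (const c) = c"
  and val_coord [simp]: "val (coord i) = 0"
proof -
  obtain f g where "holo_fun_germ f" "a = germ f" "holo_fun_germ g" "b = germ g"
    by (metis hgerm_cases)
  then show "val (a + b) = val a + val b" "val (a * b) = val a * val b" "val (a - b) = val a - val b"
    by (simp_all add: germ_add[symmetric] germ_mult[symmetric] germ_diff[symmetric] val_germ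
        holo_fun_germ_add holo_fun_germ_mult holo_fun_germ_diff)
qed (simp_all add: const_def coord_def val_germ)

text \<open>The ring of germs is local, with the kernel of \<open>val\<close> as maximal ideal;
  \<open>nakayama_hgerm\<close> relies on this.\<close>

lemma val_ne_0_imp_unit:
  assumes "val h \<noteq> 0" shows "\<exists>k. h * k = 1"
proof -
  obtain f where f: "holo_fun_germ f" "h = germ f" by (rule hgerm_cases)
  then have f0: "f 0 \<noteq> 0" using assms by (simp add: val_germ)
  have "\<forall>\<^sub>F z in nhds 0. f z \<noteq> 0"
    by (rule tendsto_imp_eventually_ne[OF holo_fun_germ_tendsto[OF f(1)] f0])
  then have "germ_eq (\<lambda>z. f z * inverse (f z)) (\<lambda>z. 1)"
    unfolding germ_eq_def by eventually_elim simp
  moreover note hol = holo_fun_germ_inverse[OF f(1) f0]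
  ultimately have "germ (\<lambda>z. f z * inverse (f z)) = germ (\<lambda>z. 1)"
    using f(1) holo_fun_germ_mult[OF f(1) hol] by (simp add: germ_eq_iff)
  then have "h * germ (\<lambda>z. inverse (f z)) = 1"
    using f hol by (simp add: germ_mult one_hgerm.abs_eq)
  then show ?thesis by blast
qed

lemma hgerm_hadamard: "\<exists>a b. h = const (val h) + coord 1 * a + coord 2 * b"
proof -
  obtain f where f: "holo_fun_germ f" "h = germ f" by (rule hgerm_cases)
  obtain a b where ab: "holo_fun_germ a" "holo_fun_germ b"
    and eq: "\<forall>\<^sub>F z in nhds 0. f z = f 0 + z $ 1 * a z + z $ 2 * b z"
    by (rule holo_fun_germ_hadamard[OF f(1)])
  have "h = germ (\<lambda>z. f 0 + z $ 1 * a z + z $ 2 * b z)"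
    using f ab eq by (simp add: germ_eq_iff holo_fun_germ_add holo_fun_germ_mult germ_eq_def)
  then show ?thesis
    using f ab by (auto simp: germ_add germ_mult holo_fun_germ_add holo_fun_germ_mult const_def coord_def val_germ)
qed

text \<open>Composition through a chosen representative; \<open>pull_germ\<close> shows that the
  choice does not matter once \<open>F\<close> is holomorphic and fixes the origin.\<close>

definition pull :: "(complex ^ 2 \<Rightarrow> complex ^ 2) \<Rightarrow> hgerm \<Rightarrow> hgerm" where
  "pull F h = germ (\<lambda>z. rep_hgerm h (F z))"

definition map_germ0 :: "(complex ^ 2 \<Rightarrow> complex ^ 2) \<Rightarrow> bool" where
  "map_germ0 F \<longleftrightarrow> holo_map_germ F \<and> F 0 = 0"

lemma map_germ0_tendsto: "map_germ0 F \<Longrightarrow> filterlim F (nhds 0) (nhds 0)"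
  using holo_map_germ_tendsto[of F] by (simp add: map_germ0_def)

lemma holo_fun_germ_pull: "map_germ0 F \<Longrightarrow> holo_fun_germ f \<Longrightarrow> holo_fun_germ (\<lambda>z. f (F z))"
  unfolding map_germ0_def by (blast intro: holo_fun_germ_compose)

lemma pull_germ:
  assumes F: "map_germ0 F" and f: "holo_fun_germ f"
  shows "pull F (germ f) = germ (\<lambda>z. f (F z))"
proof -
  have "germ_eq (rep_hgerm (germ f)) f"
    using rep_hgerm[of "germ f"] f by (simp add: germ_eq_iff[symmetric])
  then have "germ_eq (\<lambda>z. rep_hgerm (germ f) (F z)) (\<lambda>z. f (F z))"
    using map_germ0_tendsto[OF F] unfolding germ_eq_def filterlim_iff by blast
  then show ?thesis
    using F f unfolding pull_def by (simp add: germ_eq_iff holo_fun_germ_pull rep_hgerm)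
qed

lemma pull_add: "map_germ0 F \<Longrightarrow> pull F (a + b) = pull F a + pull F b"
  and pull_mult: "map_germ0 F \<Longrightarrow> pull F (a * b) = pull F a * pull F b"
  and pull_diff: "map_germ0 F \<Longrightarrow> pull F (a - b) = pull F a - pull F b"
  and pull_const [simp]: "map_germ0 F \<Longrightarrow> pull F (const c) = const c"
  and val_pull [simp]: "map_germ0 F \<Longrightarrow> val (pull F a) = val a"
proof -
  assume F: "map_germ0 F"
  obtain f g where "holo_fun_germ f" "a = germ f" "holo_fun_germ g" "b = germ g"
    by (metis hgerm_cases)
  then show "pull F (a + b) = pull F a + pull F b" "pull F (a * b) = pull F a * pull F b"
      "pull F (a - b) = pull F a - pull F b" "val (pull F a) = val a"
    using F by (simp_all add: germ_add[symmetric] germ_mult[symmetric] germ_diff[symmetric]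
        pull_germ holo_fun_germ_pull holo_fun_germ_add holo_fun_germ_mult holo_fun_germ_diff val_germ)
      (simp add: map_germ0_def)
  show "pull F (const c) = const c"
    using F by (simp add: const_def pull_germ)
qed

lemma pull_power: "map_germ0 F \<Longrightarrow> pull F (a ^ n) = pull F a ^ n"
  using pull_const[of F 1] by (induction n) (simp_all add: pull_mult)

lemma pull_sum: "map_germ0 F \<Longrightarrow> pull F (sum f S) = (\<Sum>i\<in>S. pull F (f i))"
  using pull_const[of F 0] by (induction S rule: infinite_finite_induct) (simp_all add: pull_add)

lemma pull_coord: "map_germ0 F \<Longrightarrow> pull F (coord i) = germ (\<lambda>z. F z $ i)"
  by (simp add: coord_def pull_germ)

section \<open>Powers of the maximal ideal\<close>

primrec mpow :: "nat \<Rightarrow> hgerm set" where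
  "mpow 0 = UNIV"
| "mpow (Suc k) = {coord 1 * a + coord 2 * b | a b. a \<in> mpow k \<and> b \<in> mpow k}"

lemma mpow_mult_left: "a \<in> mpow k \<Longrightarrow> c * a \<in> mpow k"
proof (induction k arbitrary: a)
  case (Suc k)
  then obtain u v where "a = coord 1 * u + coord 2 * v" "u \<in> mpow k" "v \<in> mpow k" by auto
  moreover from this have "c * a = coord 1 * (c * u) + coord 2 * (c * v)" by (simp add: algebra_simps)
  ultimately show ?case using Suc.IH by auto
qed simp

lemma mpow_mult_right: "a \<in> mpow k \<Longrightarrow> a * c \<in> mpow k"
  using mpow_mult_left[of a k c] by (simp add: mult.commute)

lemma mpow_add: "a \<in> mpow k \<Longrightarrow> b \<in> mpow k \<Longrightarrow> a + b \<in> mpow k"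
proof (induction k arbitrary: a b)
  case (Suc k)
  then obtain u v u' v' where "a = coord 1 * u + coord 2 * v" "u \<in> mpow k" "v \<in> mpow k"
    "b = coord 1 * u' + coord 2 * v'" "u' \<in> mpow k" "v' \<in> mpow k" by auto
  moreover from this have "a + b = coord 1 * (u + u') + coord 2 * (v + v')" by (simp add: algebra_simps)
  ultimately show ?case using Suc.IH by auto
qed simp

lemma mpow_0 [simp]: "0 \<in> mpow k"
  by (induction k) (auto intro!: exI[of _ 0])

lemma mpow_uminus: "a \<in> mpow k \<Longrightarrow> - a \<in> mpow k"
  using mpow_mult_left[of a k "- 1"] by simp

lemma mpow_diff: "a \<in> mpow k \<Longrightarrow> b \<in> mpow k \<Longrightarrow> a - b \<in> mpow k"
  using mpow_add[OF _ mpow_uminus, of a k b] by simp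

lemma mpow_sum: "(\<And>i. i \<in> S \<Longrightarrow> f i \<in> mpow k) \<Longrightarrow> sum f S \<in> mpow k"
  by (induction S rule: infinite_finite_induct) (auto intro: mpow_add)

lemma mpow_mult: "a \<in> mpow j \<Longrightarrow> b \<in> mpow k \<Longrightarrow> a * b \<in> mpow (j + k)"
proof (induction j arbitrary: a)
  case 0 then show ?case by (simp add: mpow_mult_left)
next
  case (Suc j)
  then obtain u v where "a = coord 1 * u + coord 2 * v" "u \<in> mpow j" "v \<in> mpow j" by auto
  moreover from this have "a * b = coord 1 * (u * b) + coord 2 * (v * b)" by (simp add: algebra_simps)
  ultimately show ?case using Suc.IH Suc.prems by auto
qed

lemma mpow_SucD: "a \<in> mpow (Suc k) \<Longrightarrow> a \<in> mpow k"
  by (auto intro!: mpow_add mpow_mult_left)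

lemma mpow_mono:
  assumes "a \<in> mpow k" "j \<le> k" shows "a \<in> mpow j"
  using assms(2,1) by (induction rule: inc_induct) (auto intro: mpow_SucD simp del: mpow.simps)

text \<open>Hadamard's lemma is exactly what makes the kernel of \<open>val\<close> the ideal
  generated by the two coordinates.\<close>

lemma mpow_1_iff: "h \<in> mpow (Suc 0) \<longleftrightarrow> val h = 0"
proof
  assume "val h = 0"
  then show "h \<in> mpow (Suc 0)" using hgerm_hadamard[of h] by auto
qed auto

lemma mpow_power: "a \<in> mpow (Suc 0) \<Longrightarrow> a ^ n \<in> mpow n"
proof (induction n)
  case (Suc n)
  then show ?case using mpow_mult[of a "Suc 0" "a ^ n" n] by (simp del: mpow.simps)
qed simp

lemma pull_mpow:
  assumes F: "map_germ0 F" and "h \<in> mpow k" shows "pull F h \<in> mpow k"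
  using assms(2)
proof (induction k arbitrary: h)
  case (Suc k)
  then obtain u v where h: "h = coord 1 * u + coord 2 * v" and uv: "u \<in> mpow k" "v \<in> mpow k" by auto
  have "pull F (coord i) * pull F w \<in> mpow (Suc 0 + k)" if "w \<in> mpow k" for i w
    using Suc.IH[OF that] F by (intro mpow_mult) (auto simp: mpow_1_iff simp del: mpow.simps)
  then show ?case
    unfolding h by (simp add: pull_add pull_mult F mpow_add uv del: mpow.simps)
qed simp

text \<open>Links the ideal-theoretic order with growth; it serves the identity theorem below and
  the uniqueness of leading coefficients.\<close>

lemma mpow_bound:
  assumes "holo_fun_germ f" "germ f \<in> mpow k"
  shows "\<exists>C. \<forall>\<^sub>F z in nhds 0. norm (f z) \<le> C * norm z ^ k"
  using assms
proof (induction k arbitrary: f)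
  case 0
  have "\<forall>\<^sub>F z in nhds 0. norm (f z) < norm (f 0) + 1"
    by (rule order_tendstoD(2)[OF tendsto_norm[OF holo_fun_germ_tendsto[OF 0(1)]]]) simp
  then show ?case by (intro exI[of _ "norm (f 0) + 1"]) (auto elim: eventually_mono)
next
  case (Suc k)
  then obtain u v where h: "germ f = coord 1 * u + coord 2 * v" and uv: "u \<in> mpow k" "v \<in> mpow k" by auto
  obtain a b where ab: "holo_fun_germ a" "u = germ a" "holo_fun_germ b" "v = germ b"
    by (metis hgerm_cases)
  have "germ f = germ (\<lambda>z. z $ 1 * a z + z $ 2 * b z)"
    using ab by (simp add: h coord_def germ_add germ_mult holo_fun_germ_mult)
  then have eq: "\<forall>\<^sub>F z in nhds 0. f z = z $ 1 * a z + z $ 2 * b z"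
    using ab Suc.prems(1) by (simp add: germ_eq_iff holo_fun_germ_mult holo_fun_germ_add germ_eq_def)
  obtain A B where "\<forall>\<^sub>F z in nhds 0. norm (a z) \<le> A * norm z ^ k" "\<forall>\<^sub>F z in nhds 0. norm (b z) \<le> B * norm z ^ k"
    using Suc.IH[of a] Suc.IH[of b] ab uv by auto
  with eq have "\<forall>\<^sub>F z in nhds 0. norm (f z) \<le> (A + B) * norm z ^ Suc k"
  proof eventually_elim
    case (elim z)
    have "norm (f z) \<le> norm (z $ 1) * norm (a z) + norm (z $ 2) * norm (b z)"
      unfolding elim(1) by (rule order_trans[OF norm_triangle_ineq]) (simp add: norm_mult)
    also have "\<dots> \<le> norm z * (A * norm z ^ k) + norm z * (B * norm z ^ k)"
      by (intro add_mono mult_mono elim Finite_Cartesian_Product.norm_nth_le) auto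
    finally show ?case by (simp add: algebra_simps)
  qed
  then show ?case by blast
qed

text \<open>On each complex line through the origin the germ becomes a function of one variable with
  a zero of infinite order, hence zero. This is what gives a nonzero germ a finite order and a
  lowest form.\<close>

lemma mpow_all_imp_0:
  assumes "\<And>k. h \<in> mpow k" shows "h = 0"
proof -
  obtain f where f: "holo_fun_germ f" "h = germ f" by (rule hgerm_cases)
  obtain d where d: "d > 0" "\<And>z. norm z < d \<Longrightarrow> holo_at f z"
    using f(1) unfolding holo_fun_germ_iff eventually_nhds_metric by auto
  have "f z = 0" if z: "norm z < d" for z
  proof (cases "z = 0")
    case True
    then show ?thesis using assms[of "Suc 0"] f by (simp add: mpow_1_iff val_germ del: mpow.simps)
  next
    case False
    \<comment> \<open>\<open>R > 1\<close> puts the point \<open>t = 1\<close>, where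
      \<open>F\<close> takes the value \<open>f z\<close>, inside the disc.\<close>
    define R where "R = d / norm z"
    have R: "R > 1" using z False by (simp add: R_def)
    define F where "F = (\<lambda>t. f (t *s z))"
    have norm_s: "norm (t *s z) = norm t * norm z" for t
      by (simp add: norm_vec_def norm_mult L2_set_right_distrib)
    have hol: "F holomorphic_on ball 0 R"
    proof -
      have "F field_differentiable at t" if "t \<in> ball 0 R" for t
      proof -
        have "norm (t *s z) < d" using that False by (simp add: norm_s R_def field_simps)
        then obtain a b where ab: "(f has_derivative (\<lambda>v. a * v $ 1 + b * v $ 2)) (at (t *s z))"
          using d(2)[of "t *s z"] unfolding holo_at_def by blast
        have "((\<lambda>t. t *s z) has_derivative (\<lambda>h. h *s z)) (at t)"
          by (rule has_derivative_vec2) (auto intro!: derivative_eq_intros)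
        from diff_chain_at[OF this ab]
        have "(F has_derivative (\<lambda>h. (a * z $ 1 + b * z $ 2) * h)) (at t)"
          by (simp add: F_def o_def algebra_simps)
        then show ?thesis
          by (auto simp: field_differentiable_def has_field_derivative_def intro: exI[of _ "a * z $ 1 + b * z $ 2"])
      qed
      then show ?thesis by (simp add: holomorphic_on_open field_differentiable_def)
    qed
    have small: "\<exists>C. \<forall>\<^sub>F t in nhds 0. norm (F t) \<le> C * norm t ^ k" for k
    proof -
      obtain C where C: "\<forall>\<^sub>F z in nhds 0. norm (f z) \<le> C * norm z ^ k"
        using mpow_bound[OF f(1)] assms[of k] f(2) by blast
      have "filterlim (\<lambda>t. t *s z) (nhds 0) (nhds (0::complex))"
        unfolding tendsto_norm_zero_iff[of "\<lambda>t. t *s z", symmetric] norm_s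
        by (auto intro!: tendsto_eq_intros filterlim_ident)
      with C have "\<forall>\<^sub>F t in nhds 0. norm (F t) \<le> C * norm (t *s z) ^ k"
        unfolding filterlim_iff F_def by blast
      then show ?thesis
        by (intro exI[of _ "C * norm z ^ k"]) (simp add: norm_s power_mult_distrib algebra_simps)
    qed
    have "F 1 = 0"
    proof (rule ccontr)
      assume F1: "F 1 \<noteq> 0"
      have nonconst: "\<not> F constant_on ball 0 R"
      proof
        assume "F constant_on ball 0 R"
        then have "F 1 = F 0" using R by (auto simp: constant_on_def)
        moreover have "F 0 = 0" using assms[of "Suc 0"] f
          by (simp add: mpow_1_iff val_germ F_def del: mpow.simps)
        ultimately show False using F1 by simp
      qed
      have F0: "F 0 = 0" using assms[of "Suc 0"] f by (simp add: mpow_1_iff val_germ F_def del: mpow.simps)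
      have in_ball: "0 \<in> ball (0::complex) R" using R by simp
      obtain g r n where n: "0 < n" "0 < r" "ball (0::complex) r \<subseteq> ball 0 R" and g: "g holomorphic_on ball 0 r"
        and Fg: "\<And>w. w \<in> ball 0 r \<Longrightarrow> F w = (w - 0) ^ n * g w" and g0: "\<And>w. w \<in> ball 0 r \<Longrightarrow> g w \<noteq> 0"
        by (rule holomorphic_factor_zero_nonconstant[OF hol open_ball connected_ball in_ball F0 nonconst])
          (rule that)
      \<comment> \<open>A zero of exact order \<open>n\<close> admits no bound by a multiple of
        \<open>norm t ^ Suc n\<close>: dividing by \<open>t ^ n\<close> would give
        \<open>g 0 = 0\<close>.\<close>
      obtain C where C: "\<forall>\<^sub>F t in nhds 0. norm (F t) \<le> C * norm t ^ Suc n"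
        using small by blast
      have "\<forall>\<^sub>F t in at 0. t \<in> ball 0 r \<and> t \<noteq> (0::complex) \<and> norm (F t) \<le> C * norm t ^ Suc n"
        using n C eventually_nhds_in_open[of "ball 0 r" "0::complex"]
        by (auto simp: eventually_at_filter intro: eventually_elim2)
      then have "\<forall>\<^sub>F t in at 0. norm (g t) \<le> C * norm t"
      proof eventually_elim
        case (elim t)
        then have "norm t ^ n * norm (g t) \<le> norm t ^ n * (C * norm t)"
          using Fg[of t] by (simp add: norm_mult norm_power algebra_simps)
        then show ?case using elim by simp
      qed
      moreover have "((\<lambda>t. norm (g t)) \<longlongrightarrow> norm (g 0)) (at 0)"
      proof -
        have "isCont g 0"
          using g n(2) by (metis centre_in_ball continuous_on_eq_continuous_at holomorphic_on_imp_continuous_on open_ball)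
        then show ?thesis by (simp add: isCont_def tendsto_norm)
      qed
      moreover have "((\<lambda>t::complex. C * norm t) \<longlongrightarrow> C * norm (0::complex)) (at 0)"
        by (intro tendsto_intros)
      ultimately have "norm (g 0) \<le> C * norm (0::complex)"
        by (intro tendsto_le[of "at (0::complex)"]) auto
      then show False using g0[of 0] n(2) by simp
    qed
    then show ?thesis by (simp add: F_def)
  qed
  then have "germ_eq f (\<lambda>z. 0)"
    unfolding germ_eq_def eventually_nhds_metric using d(1) by auto
  then show ?thesis using f by (simp add: zero_hgerm.abs_eq germ_eq_iff)
qed

subsection \<open>Binary forms and the ideal generated by two germs\<close>

declare mpow.simps(2) [simp del]

text \<open>The coefficients are germs, so that one expression serves both as a form with constant
  coefficients and as an exact expansion including the remainder.\<close>

definition hform :: "hgerm \<Rightarrow> hgerm \<Rightarrow> nat \<Rightarrow> (nat \<Rightarrow> hgerm) \<Rightarrow> hgerm" where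
  "hform x y n c = (\<Sum>i\<le>n. c i * y ^ i * x ^ (n - i))"

text \<open>The homogenization \<open>x ^ n * p (y / x)\<close>, so roots of \<open>p\<close> are
  slopes. The formal degree \<open>n\<close> is kept apart from \<open>degree p\<close>; for a
  nonzero form they agree exactly when \<open>x\<close> does not divide it.\<close>

abbreviation pform :: "hgerm \<Rightarrow> hgerm \<Rightarrow> nat \<Rightarrow> complex poly \<Rightarrow> hgerm" where
  "pform x y n p \<equiv> hform x y n (\<lambda>i. const (coeff p i))"

text \<open>Writing the old coordinates through \<open>x\<close>, \<open>y\<close> is what allows
  every element of \<open>mpow n\<close> to be expanded in monomials in \<open>x\<close>,
  \<open>y\<close>.\<close>

definition lin_coords :: "hgerm \<Rightarrow> hgerm \<Rightarrow> bool" where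
  "lin_coords x y \<longleftrightarrow> val x = 0 \<and> val y = 0 \<and>
     (\<exists>a b c d. coord 1 = const a * x + const b * y \<and> coord 2 = const c * x + const d * y)"

lemma lin_coords_mpow: "lin_coords x y \<Longrightarrow> x \<in> mpow (Suc 0)" "lin_coords x y \<Longrightarrow> y \<in> mpow (Suc 0)"
  by (simp_all add: lin_coords_def mpow_1_iff)

lemma lin_coords_swap: "lin_coords x y \<Longrightarrow> lin_coords y x"
  unfolding lin_coords_def by (metis add.commute)

lemma monomial_mpow: "lin_coords x y \<Longrightarrow> i \<le> n \<Longrightarrow> y ^ i * x ^ (n - i) \<in> mpow n"
  using mpow_mult[OF mpow_power mpow_power, of y x i "n - i"] lin_coords_mpow by simp

lemma hform_mpow:
  assumes xy: "lin_coords x y" and c: "\<And>i. i \<le> n \<Longrightarrow> c i \<in> mpow j"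
  shows "hform x y n c \<in> mpow (j + n)"
  unfolding hform_def mult.assoc using mpow_mult[OF c monomial_mpow[OF xy]] by (intro mpow_sum) auto

lemma hform_mpow_0: "lin_coords x y \<Longrightarrow> hform x y n c \<in> mpow n"
  using hform_mpow[of x y n c 0] by simp

lemma hform_add: "hform x y n (\<lambda>i. c i + d i) = hform x y n c + hform x y n d"
  by (simp add: hform_def sum.distrib distrib_right)

lemma hform_diff: "hform x y n (\<lambda>i. c i - d i) = hform x y n c - hform x y n d"
  by (simp add: hform_def sum_subtractf left_diff_distrib)

lemma hform_cmult: "hform x y n (\<lambda>i. a * c i) = a * hform x y n c"
  by (simp add: hform_def sum_distrib_left mult.assoc)

lemma hform_cong: "(\<And>i. i \<le> n \<Longrightarrow> c i = d i) \<Longrightarrow> hform x y n c = hform x y n d"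
  by (simp add: hform_def)

lemma hform_Suc: "hform x y (Suc n) c = x * hform x y n c + c (Suc n) * y ^ Suc n"
  by (simp add: hform_def sum_distrib_left Suc_diff_le algebra_simps)

lemma hform_Suc_shift: "hform x y (Suc n) c = c 0 * x ^ Suc n + y * hform x y n (\<lambda>i. c (Suc i))"
  unfolding hform_def by (subst sum.atMost_Suc_shift) (simp add: sum_distrib_left algebra_simps)

lemma mpow_imp_hform:
  assumes xy: "lin_coords x y"
  shows "h \<in> mpow (j + n) \<Longrightarrow> \<exists>c. (\<forall>i. c i \<in> mpow j) \<and> h = hform x y n c"
proof (induction n arbitrary: h)
  case 0
  then show ?case by (intro exI[of _ "\<lambda>_. h"]) (simp add: hform_def)
next
  case (Suc n)
  then obtain u v where h: "h = coord 1 * u + coord 2 * v" and uv: "u \<in> mpow (j + n)" "v \<in> mpow (j + n)"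
    by (auto simp: mpow.simps(2))
  obtain a b c d where "coord 1 = const a * x + const b * y" "coord 2 = const c * x + const d * y"
    using xy unfolding lin_coords_def by blast
  then have h: "h = x * (const a * u + const c * v) + y * (const b * u + const d * v)"
    by (simp add: h algebra_simps)
  have "const a * u + const c * v \<in> mpow (j + n)" "const b * u + const d * v \<in> mpow (j + n)"
    by (intro mpow_add mpow_mult_left uv)+
  then obtain c1 c2 where 1: "\<forall>i. c1 i \<in> mpow j" "const a * u + const c * v = hform x y n c1"
    and 2: "\<forall>i. c2 i \<in> mpow j" "const b * u + const d * v = hform x y n c2"
    using Suc.IH by metis
  \<comment> \<open>Multiplication by \<open>x\<close> keeps the index of a coefficient and by
    \<open>y\<close> shifts it by one; the defaults 0 fill the top index of the first sequence and
    index 0 of the second.\<close>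
  have "h = hform x y (Suc n) (\<lambda>i. (if i \<le> n then c1 i else 0) + (case i of 0 \<Rightarrow> 0 | Suc k \<Rightarrow> c2 k))"
  proof -
    have "hform x y n (\<lambda>i. if i \<le> n then c1 i else 0) = hform x y n c1"
      by (rule hform_cong) simp
    then have "hform x y (Suc n) (\<lambda>i. if i \<le> n then c1 i else 0) = x * hform x y n c1"
      by (simp add: hform_Suc)
    moreover have "hform x y (Suc n) (\<lambda>i. case i of 0 \<Rightarrow> 0 | Suc k \<Rightarrow> c2 k) = y * hform x y n c2"
      by (simp add: hform_Suc_shift)
    ultimately show ?thesis unfolding h 1 2 hform_add by simp
  qed
  moreover have "(if i \<le> n then c1 i else 0) + (case i of 0 \<Rightarrow> 0 | Suc k \<Rightarrow> c2 k) \<in> mpow j" for i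
    using 1 2 by (auto intro!: mpow_add split: nat.split)
  ultimately show ?case by (intro exI conjI allI)
qed

text \<open>Replacing each coefficient of an exact expansion by its value at the origin changes it
  by an element of the maximal ideal, which raises the order by one.\<close>

lemma mpow_taylor:
  assumes xy: "lin_coords x y" and h: "h \<in> mpow n"
  obtains c where "h - hform x y n (\<lambda>i. const (c i)) \<in> mpow (Suc n)"
proof -
  obtain c where c: "h = hform x y n c"
    using mpow_imp_hform[OF xy, of h 0 n] h by auto
  have "hform x y n (\<lambda>i. c i - const (val (c i))) \<in> mpow (Suc 0 + n)"
    by (rule hform_mpow[OF xy]) (simp add: mpow_1_iff)
  then show ?thesis
    using that[of "\<lambda>i. val (c i)"] by (simp add: c hform_diff)
qed

lemma mpow_taylor_poly:
  assumes xy: "lin_coords x y" and h: "h \<in> mpow n"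
  obtains p where "degree p \<le> n" "h - pform x y n p \<in> mpow (Suc n)"
proof -
  obtain c where c: "h - hform x y n (\<lambda>i. const (c i)) \<in> mpow (Suc n)"
    by (rule mpow_taylor[OF xy h])
  define p where "p = (\<Sum>i\<le>n. monom (c i) i)"
  have coeff: "coeff p i = (if i \<le> n then c i else 0)" for i
    by (simp add: p_def coeff_sum if_distrib[of "\<lambda>x. _ * x"] sum.delta' cong: if_cong)
  have "degree p \<le> n"
    by (rule degree_le) (simp add: coeff)
  moreover have "pform x y n p = hform x y n (\<lambda>i. const (c i))"
    by (rule hform_cong) (simp add: coeff)
  ultimately show ?thesis using c that by metis
qed

lemma pform_raise:
  assumes "degree q \<le> m" shows "pform x y (k + m) q = x ^ k * pform x y m q"
proof (induction k)
  case (Suc k)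
  have "coeff q (Suc (k + m)) = 0" using assms by (intro coeff_eq_0) simp
  then show ?case using Suc by (simp add: hform_Suc mult.assoc)
qed simp

text \<open>Turns Bezout identities between polynomials into identities between forms; formal
  degrees are used because the cofactors may have smaller degree than the forms they have to
  become.\<close>

lemma pform_mult:
  assumes "degree p \<le> n" and q: "degree q \<le> m"
  shows "pform x y (n + m) (p * q) = pform x y n p * pform x y m q"
  using assms(1)
proof (induction p arbitrary: n)
  case 0
  then show ?case by (simp add: hform_def)
next
  case (pCons a p)
  show ?case
  proof (cases n)
    case 0
    then have "p = 0" using pCons.prems by (auto split: if_splits)
    then show ?thesis using 0 by (simp add: const_mult hform_cmult) (simp add: hform_def)
  next
    case (Suc k)
    have p: "degree p \<le> k" using pCons.prems Suc by (auto split: if_splits)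
    have eq: "(\<lambda>i. const (coeff (pCons a p * q) i)) =
        (\<lambda>i. const a * const (coeff q i) + const (coeff (pCons 0 (p * q)) i))"
      by (simp add: const_mult const_add)
    have "pform x y (n + m) (pCons a p * q) =
        const a * pform x y (Suc k + m) q + y * pform x y (k + m) (p * q)"
      unfolding eq hform_add hform_cmult Suc by (simp add: hform_Suc_shift)
    also have "\<dots> = (const a * x ^ Suc k + y * pform x y k p) * pform x y m q"
      unfolding pform_raise[OF q] pCons.IH[OF p] by (simp add: algebra_simps)
    also have "\<dots> = pform x y n (pCons a p) * pform x y m q"
      unfolding Suc by (simp add: hform_Suc_shift)
    finally show ?thesis .
  qed
qed

text \<open>Elimination of one generator at a time: as \<open>1 - c s\<close> is a unit, the
  relation for \<open>e s\<close> can be solved for it and substituted in the others, whose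
  coefficients still vanish at the origin.\<close>

lemma nakayama_hgerm:
  fixes e :: "'i \<Rightarrow> hgerm"
  assumes "finite S" and I0: "0 \<in> I" and Iadd: "\<And>a b. a \<in> I \<Longrightarrow> b \<in> I \<Longrightarrow> a + b \<in> I"
    and Imult: "\<And>a c. a \<in> I \<Longrightarrow> c * a \<in> I"
    and "\<And>i. i \<in> S \<Longrightarrow> \<exists>c. (\<forall>t\<in>S. val (c t) = 0) \<and> e i - (\<Sum>t\<in>S. c t * e t) \<in> I"
  shows "\<forall>i\<in>S. e i \<in> I"
  using assms(1,5)
proof (induction S)
  case (insert s S)
  have sumI: "(\<Sum>t\<in>T. d t * e t) \<in> I" if "\<forall>t\<in>T. e t \<in> I" for d and T :: "'i set"
    using that by (induction T rule: infinite_finite_induct) (auto intro: I0 Iadd Imult)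
  obtain c where c: "\<forall>t\<in>insert s S. val (c t) = 0" "e s - (\<Sum>t\<in>insert s S. c t * e t) \<in> I"
    using insert.prems[of s] by blast
  obtain u where u: "(1 - c s) * u = 1"
    using val_ne_0_imp_unit[of "1 - c s"] c(1) val_const[of 1] by auto
  have "u * (e s - (\<Sum>t\<in>insert s S. c t * e t)) = ((1 - c s) * u) * e s - u * (\<Sum>t\<in>S. c t * e t)"
    using insert.hyps by (simp add: algebra_simps)
  then have "u * (e s - (\<Sum>t\<in>insert s S. c t * e t)) = e s - (\<Sum>t\<in>S. (u * c t) * e t)"
    by (simp add: u sum_distrib_left mult.assoc)
  then have es: "e s - (\<Sum>t\<in>S. (u * c t) * e t) \<in> I"
    using Imult[OF c(2), of u] by simp
  have "\<exists>d. (\<forall>t\<in>S. val (d t) = 0) \<and> e i - (\<Sum>t\<in>S. d t * e t) \<in> I" if i: "i \<in> S" for i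
  proof -
    obtain b where b: "\<forall>t\<in>insert s S. val (b t) = 0" "e i - (\<Sum>t\<in>insert s S. b t * e t) \<in> I"
      using insert.prems[of i] i by blast
    have eq: "e i - (\<Sum>t\<in>S. (b t + b s * (u * c t)) * e t) =
        (e i - (\<Sum>t\<in>insert s S. b t * e t)) + b s * (e s - (\<Sum>t\<in>S. (u * c t) * e t))"
      using insert.hyps by (simp add: algebra_simps sum.distrib sum_distrib_left)
    have "e i - (\<Sum>t\<in>S. (b t + b s * (u * c t)) * e t) \<in> I"
      unfolding eq by (rule Iadd[OF b(2) Imult[OF es]])
    then show ?thesis using b(1) c(1) by (intro exI[of _ "\<lambda>t. b t + b s * (u * c t)"]) simp
  qed
  from insert.IH[OF this] have S: "\<forall>i\<in>S. e i \<in> I" by blast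
  moreover have "e s \<in> I"
    using Iadd[OF es sumI[OF S, of "\<lambda>t. u * c t"]] by simp
  ultimately show ?case by blast
qed simp

text \<open>A nonzero element \<open>d\<close> of least degree in the ideal divides all others; if
  it were not constant, it would have a root, common to \<open>p\<close> and
  \<open>q\<close>.\<close>

lemma poly_bezout:
  fixes p q :: "complex poly"
  assumes "p \<noteq> 0" and no_root: "\<And>z. poly p z = 0 \<Longrightarrow> poly q z \<noteq> 0"
  shows "\<exists>a b. a * p + b * q = 1"
proof -
  define J where "J = {a * p + b * q | a b. True}"
  have "p = 1 * p + 0 * q" "q = 0 * p + 1 * q" by simp_all
  then have pq: "p \<in> J" "q \<in> J" unfolding J_def by blast+
  define d where "d = arg_min degree (\<lambda>d. d \<in> J \<and> d \<noteq> 0)"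
  have d: "d \<in> J" "d \<noteq> 0" and least: "\<And>e. e \<in> J \<Longrightarrow> degree e < degree d \<Longrightarrow> e = 0"
    using arg_min_nat_lemma[of "\<lambda>d. d \<in> J \<and> d \<noteq> 0" p degree] pq(1) assms(1)
    unfolding d_def by (auto simp: not_less[symmetric])
  obtain a b where ab: "d = a * p + b * q" using d(1) unfolding J_def by blast
  have dvd: "d dvd e" if eJ: "e \<in> J" for e
  proof -
    obtain a' b' where e: "e = a' * p + b' * q" using eJ unfolding J_def by blast
    define k where "k = e div d"
    have "e mod d = e - k * (a * p + b * q)" by (simp add: k_def ab[symmetric] minus_div_mult_eq_mod)
    also have "\<dots> = (a' - k * a) * p + (b' - k * b) * q"
      by (simp add: e algebra_simps)
    finally have "e mod d \<in> J" unfolding J_def by blast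
    then have "e mod d = 0"
      using least[of "e mod d"] degree_mod_less[OF d(2), of e] by auto
    then show ?thesis by auto
  qed
  have "degree d = 0"
  proof (rule ccontr)
    assume "degree d \<noteq> 0"
    then obtain z where "poly d z = 0"
      using fundamental_theorem_of_algebra[of d] by (auto simp: constant_degree)
    then have "poly p z = 0" "poly q z = 0"
      using dvd[OF pq(1)] dvd[OF pq(2)] by (auto elim!: dvdE)
    then show False using no_root by blast
  qed
  then obtain c where c: "d = [:c:]" by (rule degree_eq_zeroE)
  then have "smult (inverse c) d = 1" using d(2) by (simp add: one_pCons)
  then have "smult (inverse c) a * p + smult (inverse c) b * q = 1"
    by (simp add: ab smult_add_right)
  then show ?thesis by blast
qed

text \<open>The bounds let the identity be homogenized in total degree
  \<open>degree p + degree q\<close>. The first cofactor is bounded by reduction modulo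
  \<open>q\<close>, the second then by comparing degrees.\<close>

lemma poly_bezout_degree:
  fixes p q r :: "complex poly"
  assumes "p \<noteq> 0" "\<And>z. poly p z = 0 \<Longrightarrow> poly q z \<noteq> 0" "q \<noteq> 0" "degree r \<le> degree p + degree q"
  obtains a b where "r = a * p + b * q" "degree a \<le> degree q" "degree b \<le> degree p"
proof -
  obtain a0 b0 where ab: "a0 * p + b0 * q = 1"
    using poly_bezout[OF assms(1,2)] by blast
  define a s where "a = (r * a0) mod q" and "s = (r * a0) div q"
  define b where "b = r * b0 + s * p"
  have "a * p + b * q = (s * q + a) * p + r * b0 * q"
    by (simp add: b_def algebra_simps)
  also have "s * q + a = r * a0"
    by (simp add: a_def s_def)
  also have "r * a0 * p + r * b0 * q = r * (a0 * p + b0 * q)"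
    by (simp add: algebra_simps)
  finally have eq: "r = a * p + b * q" by (simp add: ab)
  have a: "degree a \<le> degree q"
    unfolding a_def using degree_mod_less[OF assms(3), of "r * a0"] by auto
  have "degree b \<le> degree p"
  proof (cases "b = 0")
    case False
    have "b * q = r - a * p" using eq by simp
    then have "degree b + degree q = degree (r - a * p)"
      using degree_mult_eq[OF False assms(3)] by metis
    also have "\<dots> \<le> degree p + degree q"
      using a degree_mult_le[of a p] by (intro degree_diff_le) (use assms(4) in auto)
    finally show ?thesis by simp
  qed simp
  with eq a that show ?thesis by blast
qed

text \<open>By Bezout the monomials of degree \<open>n + m\<close> are combinations of the two
  lowest forms. Replacing these forms by \<open>f\<close> and \<open>g\<close> leaves errors of
  order \<open>n + m + 1\<close>, that is, combinations of the same monomials with coefficients in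
  the maximal ideal, which Nakayama's lemma removes. Taking the degrees of \<open>p\<close> and
  \<open>q\<close> as formal degrees excludes a common root at infinity. The surplus
  \<open>j\<close> in the order of \<open>h\<close> passes to the cofactors.\<close>

lemma mpow_subset_ideal:
  assumes xy: "lin_coords x y" and pq: "p \<noteq> 0" "\<And>z. poly p z = 0 \<Longrightarrow> poly q z \<noteq> 0" "q \<noteq> 0"
    and f: "f - pform x y (degree p) p \<in> mpow (Suc (degree p))"
    and g: "g - pform x y (degree q) q \<in> mpow (Suc (degree q))"
    and h: "h \<in> mpow (j + (degree p + degree q))"
  obtains a b where "a \<in> mpow j" "b \<in> mpow j" "h = f * a + g * b"
proof -
  define n m where "n = degree p" and "m = degree q"
  define I where "I = {f * a + g * b | a b. True}"
  define e where "e = (\<lambda>i. y ^ i * x ^ (n + m - i))"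
  have "\<forall>i\<in>{..n + m}. e i \<in> I"
  proof (rule nakayama_hgerm)
    show "0 \<in> I" unfolding I_def by (intro CollectI exI[of _ 0]) simp
    show "a + b \<in> I" if ab: "a \<in> I" "b \<in> I" for a b
    proof -
      obtain a1 a2 where "a = f * a1 + g * a2" using ab(1) unfolding I_def by blast
      moreover obtain b1 b2 where "b = f * b1 + g * b2" using ab(2) unfolding I_def by blast
      ultimately have "a + b = f * (a1 + b1) + g * (a2 + b2)" by (simp add: algebra_simps)
      then show ?thesis unfolding I_def by blast
    qed
    show "c * a \<in> I" if aI: "a \<in> I" for a c
    proof -
      obtain a1 a2 where "a = f * a1 + g * a2" using aI unfolding I_def by blast
      then have "c * a = f * (c * a1) + g * (c * a2)" by (simp add: algebra_simps)
      then show ?thesis unfolding I_def by blast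
    qed
  next
    fix i assume i: "i \<in> {..n + m}"
    obtain a b where ab: "monom 1 i = a * p + b * q" "degree a \<le> m" "degree b \<le> n"
      by (rule poly_bezout_degree[OF pq, of "monom 1 i"]) (use i in \<open>auto simp: degree_monom_eq n_def m_def\<close>)
    have "e i = pform x y (n + m) (monom 1 i)"
      using i by (simp add: hform_def e_def if_distrib[of const] if_distrib[of "\<lambda>x. x * _"] mult.assoc
          cong: if_cong)
    also have "\<dots> = pform x y (m + n) (a * p) + pform x y (n + m) (b * q)"
      unfolding ab(1) by (simp add: const_add hform_add add.commute)
    also have "\<dots> = pform x y m a * pform x y n p + pform x y n b * pform x y m q"
      using ab by (subst (1 2) pform_mult) (auto simp: n_def m_def)
    finally have ei: "e i = pform x y m a * pform x y n p + pform x y n b * pform x y m q" .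
    define r where "r = e i - (f * pform x y m a + g * pform x y n b)"
    have "r = - (pform x y m a * (f - pform x y n p)) - pform x y n b * (g - pform x y m q)"
      by (simp add: r_def ei algebra_simps)
    also have "\<dots> \<in> mpow (Suc (n + m))"
      using mpow_mult[OF hform_mpow_0[OF xy, of m "\<lambda>i. const (coeff a i)"] f[folded n_def]]
        mpow_mult[OF hform_mpow_0[OF xy, of n "\<lambda>i. const (coeff b i)"] g[folded m_def]]
      by (intro mpow_diff mpow_uminus) (simp_all add: add.commute[of m n])
    finally have "r \<in> mpow (Suc 0 + (n + m))" by simp
    then obtain c where c: "\<forall>i. c i \<in> mpow (Suc 0)" "r = hform x y (n + m) c"
      using mpow_imp_hform[OF xy] by blast
    have "e i - (\<Sum>t\<le>n + m. c t * e t) = f * pform x y m a + g * pform x y n b"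
      using c(2) by (simp add: r_def hform_def e_def algebra_simps)
    then have "e i - (\<Sum>t\<le>n + m. c t * e t) \<in> I"
      unfolding I_def by auto
    then show "\<exists>c. (\<forall>t\<in>{..n + m}. val (c t) = 0) \<and> e i - (\<Sum>t\<le>n + m. c t * e t) \<in> I"
      using c(1) mpow_1_iff by blast
  qed simp
  then have "\<forall>i\<in>{..n + m}. \<exists>a b. e i = f * a + g * b"
    unfolding I_def by blast
  then obtain a b where ab: "\<And>i. i \<le> n + m \<Longrightarrow> e i = f * a i + g * b i"
    unfolding bchoice_iff by auto
  obtain c where c: "\<forall>i. c i \<in> mpow j" "h = hform x y (n + m) c"
    using mpow_imp_hform[OF xy] h unfolding n_def m_def by blast
  have "h = (\<Sum>i\<le>n + m. c i * (f * a i + g * b i))"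
    unfolding c(2) hform_def mult.assoc e_def[symmetric]
    by (intro sum.cong refl arg_cong2[of _ _ _ _ "(*)"]) (simp add: ab[symmetric] e_def)
  also have "\<dots> = f * (\<Sum>i\<le>n + m. c i * a i) + g * (\<Sum>i\<le>n + m. c i * b i)"
    by (simp add: sum_distrib_left sum.distrib algebra_simps)
  finally show ?thesis
    using c(1) by (intro that[of "\<Sum>i\<le>n + m. c i * a i" "\<Sum>i\<le>n + m. c i * b i"] mpow_sum mpow_mult_right) auto
qed

section \<open>The homological equation in finite order\<close>

lemma mpow_mult_cong:
  assumes "a - a' \<in> mpow (Suc j)" "a' \<in> mpow j" "b - b' \<in> mpow (Suc k)" "b' \<in> mpow k"
  shows "a * b - a' * b' \<in> mpow (Suc (j + k))"
proof -
  have "b \<in> mpow k" using mpow_add[OF mpow_SucD[OF assms(3)] assms(4)] by simp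
  have "(a - a') * b + a' * (b - b') \<in> mpow (Suc (j + k))"
    using mpow_mult[OF assms(1) \<open>b \<in> mpow k\<close>] mpow_mult[OF assms(2,3)] by (intro mpow_add) simp_all
  then show ?thesis by (simp add: algebra_simps)
qed

lemma mpow_power_cong:
  assumes "a - a' \<in> mpow 2" "a' \<in> mpow (Suc 0)"
  shows "a ^ n - a' ^ n \<in> mpow (Suc n)"
proof (induction n)
  case (Suc n)
  then show ?case
    using mpow_mult_cong[of a a' "Suc 0" "a ^ n" "a' ^ n" n] assms mpow_power[OF assms(2)]
    by (simp add: numeral_2_eq_2)
qed simp

text \<open>To leading order, pulling back multiplies the monomial
  \<open>y ^ i * x ^ (n - i)\<close> by \<open>\<alpha> ^ (n - i) * \<beta> ^ i\<close>; the
  nonlinear part of \<open>F\<close> only affects higher orders.\<close>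

lemma pull_hform_cong:
  assumes F: "map_germ0 F" and xy: "lin_coords x y"
    and x: "pull F x - const \<alpha> * x \<in> mpow 2" and y: "pull F y - const \<beta> * y \<in> mpow 2"
  shows "pull F (hform x y n (\<lambda>i. const (c i))) - hform x y n (\<lambda>i. const (c i * (\<alpha> ^ (n - i) * \<beta> ^ i)))
    \<in> mpow (Suc n)"
proof -
  have mon: "pull F y ^ i * pull F x ^ (n - i) - (const \<beta> * y) ^ i * (const \<alpha> * x) ^ (n - i) \<in> mpow (Suc n)"
    if "i \<le> n" for i
  proof -
    have "pull F y ^ i * pull F x ^ (n - i) - (const \<beta> * y) ^ i * (const \<alpha> * x) ^ (n - i)
        \<in> mpow (Suc (i + (n - i)))"
      using x y lin_coords_mpow[OF xy]
      by (intro mpow_mult_cong mpow_power_cong mpow_power mpow_mult_left)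
    then show ?thesis using that by simp
  qed
  have "(\<Sum>i\<le>n. const (c i) * (pull F y ^ i * pull F x ^ (n - i)
      - (const \<beta> * y) ^ i * (const \<alpha> * x) ^ (n - i))) \<in> mpow (Suc n)"
    using mon by (intro mpow_sum mpow_mult_left) auto
  then show ?thesis
    by (simp add: hform_def pull_sum[OF F] pull_mult[OF F] pull_power[OF F] F const_mult const_power
        sum_subtractf[symmetric] power_mult_distrib algebra_simps)
qed

text \<open>Each step removes the error of degree \<open>k\<close> by subtracting a form of that
  degree, which is possible as no \<open>\<alpha> ^ (k - i) * \<beta> ^ i\<close> equals \<alpha>.
  Corrections begin at degree 2, so \<open>p\<close> keeps the linear part \<open>x\<close>.\<close>

lemma eigen_germ_exists:
  assumes F: "map_germ0 F" and xy: "lin_coords x y"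
    and x: "pull F x - const \<alpha> * x \<in> mpow 2" and y: "pull F y - const \<beta> * y \<in> mpow 2"
    and nonres: "\<And>i j. 2 \<le> i + j \<Longrightarrow> i + j < K \<Longrightarrow> \<alpha> ^ i * \<beta> ^ j \<noteq> \<alpha>"
    and k: "2 \<le> k"
  shows "k \<le> K \<Longrightarrow> \<exists>p. p - x \<in> mpow 2 \<and> pull F p - const \<alpha> * p \<in> mpow k"
  using k
proof (induction k rule: dec_induct)
  case base
  then show ?case using x by (intro exI[of _ x]) simp
next
  case (step k)
  then obtain p where p: "p - x \<in> mpow 2" "pull F p - const \<alpha> * p \<in> mpow k" by auto
  obtain c where c: "(pull F p - const \<alpha> * p) - hform x y k (\<lambda>i. const (c i)) \<in> mpow (Suc k)"
    by (rule mpow_taylor[OF xy p(2)])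
  \<comment> \<open>The coefficients of the form \<open>w\<close> with
    \<open>pull F w - const \<alpha> * w\<close> equal, to leading order, to the error of degree
    \<open>k\<close>. The denominators are the divisors that could become small if \<open>k\<close>
    grew without bound.\<close>
  define d where "d = (\<lambda>i. c i / (\<alpha> ^ (k - i) * \<beta> ^ i - \<alpha>))"
  define w where "w = hform x y k (\<lambda>i. const (d i))"
  have "hform x y k (\<lambda>i. const (c i)) = hform x y k (\<lambda>i. const (d i * (\<alpha> ^ (k - i) * \<beta> ^ i)) - const \<alpha> * const (d i))"
  proof (rule hform_cong)
    fix i assume "i \<le> k"
    then have "\<alpha> ^ (k - i) * \<beta> ^ i \<noteq> \<alpha>" using nonres[of "k - i" i] step by auto
    then have "c i = d i * (\<alpha> ^ (k - i) * \<beta> ^ i - \<alpha>)"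
      by (simp add: d_def)
    then have "c i = d i * (\<alpha> ^ (k - i) * \<beta> ^ i) - \<alpha> * d i"
      by (simp add: right_diff_distrib)
    then show "const (c i) = const (d i * (\<alpha> ^ (k - i) * \<beta> ^ i)) - const \<alpha> * const (d i)"
      by (metis const_diff const_mult)
  qed
  then have c_eq: "hform x y k (\<lambda>i. const (c i)) =
      hform x y k (\<lambda>i. const (d i * (\<alpha> ^ (k - i) * \<beta> ^ i))) - const \<alpha> * w"
    by (simp add: hform_diff hform_cmult w_def)
  have w: "pull F w - hform x y k (\<lambda>i. const (d i * (\<alpha> ^ (k - i) * \<beta> ^ i))) \<in> mpow (Suc k)"
    unfolding w_def by (rule pull_hform_cong[OF F xy x y])
  have "pull F (p - w) - const \<alpha> * (p - w) =
      ((pull F p - const \<alpha> * p) - hform x y k (\<lambda>i. const (c i)))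
      - (pull F w - hform x y k (\<lambda>i. const (d i * (\<alpha> ^ (k - i) * \<beta> ^ i))))"
    unfolding c_eq by (simp add: pull_diff[OF F] algebra_simps)
  also have "\<dots> \<in> mpow (Suc k)" by (rule mpow_diff[OF c w])
  finally have "pull F (p - w) - const \<alpha> * (p - w) \<in> mpow (Suc k)" .
  moreover have "(p - w) - x \<in> mpow 2"
  proof -
    have "w \<in> mpow 2" unfolding w_def by (rule mpow_mono[OF hform_mpow_0[OF xy]]) (use step in auto)
    then have "(p - x) - w \<in> mpow 2" by (rule mpow_diff[OF p(1)])
    then show ?thesis by (simp add: algebra_simps)
  qed
  ultimately show ?case by blast
qed

subsection \<open>Local biholomorphisms and linearized flows\<close>

lemma germ_eq_has_derivative:
  assumes "germ_eq f g" "(f has_derivative D) (at 0)" shows "(g has_derivative D) (at 0)"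
  using assms germ_eq_at_0[OF assms(1)] unfolding germ_eq_def
  by (intro has_derivative_transform_eventually[of f D 0 UNIV g])
    (auto simp: eventually_at_filter elim: eventually_mono)

text \<open>The product rule at the origin, where both factors of each summand vanish.\<close>

lemma mpow_2_has_derivative:
  assumes "holo_fun_germ r" "germ r \<in> mpow 2" shows "(r has_derivative (\<lambda>v. 0)) (at 0)"
proof -
  obtain u v where uv: "germ r = coord 1 * u + coord 2 * v" "u \<in> mpow (Suc 0)" "v \<in> mpow (Suc 0)"
    using assms(2) by (auto simp: numeral_2_eq_2 mpow.simps(2)[of "Suc 0"])
  obtain a where a: "holo_fun_germ a" "u = germ a" by (rule hgerm_cases)
  obtain b where b: "holo_fun_germ b" "v = germ b" by (rule hgerm_cases)
  have 0: "a 0 = 0" "b 0 = 0" using uv a b by (simp_all add: mpow_1_iff val_germ)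
  have "germ r = germ (\<lambda>z. z $ 1 * a z + z $ 2 * b z)"
    using a b uv by (simp add: coord_def germ_add germ_mult holo_fun_germ_mult)
  then have eq: "germ_eq (\<lambda>z. z $ 1 * a z + z $ 2 * b z) r"
    using a b assms(1) by (simp add: germ_eq_iff holo_fun_germ_mult holo_fun_germ_add germ_eq_sym)
  have "holo_at a 0" "holo_at b 0"
    using a b eventually_nhds_x_imp_x unfolding holo_fun_germ_iff by blast+
  then obtain A B where A: "(a has_derivative A) (at 0)" and B: "(b has_derivative B) (at 0)"
    unfolding holo_at_def by blast
  have nth: "((\<lambda>z::complex^2. z $ i) has_derivative (\<lambda>v. v $ i)) (at 0)" for i
    by (intro bounded_linear_imp_has_derivative bounded_linear_vec_nth)
  have "((\<lambda>z. z $ 1 * a z + z $ 2 * b z) has_derivative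
      (\<lambda>v. ((0::complex^2) $ 1 * A v + v $ 1 * a 0) + ((0::complex^2) $ 2 * B v + v $ 2 * b 0))) (at 0)"
    by (intro has_derivative_add has_derivative_mult nth A B)
  then show ?thesis using germ_eq_has_derivative[OF eq] by (simp add: 0)
qed

text \<open>Actual open sets rather than germs, since a flow asks for trajectories that stay in a
  domain for all times of a disc.\<close>

definition local_biholo ::
    "(complex ^ 2 \<Rightarrow> complex ^ 2) \<Rightarrow> (complex ^ 2 \<Rightarrow> complex ^ 2) \<Rightarrow> (complex ^ 2) set \<Rightarrow> (complex ^ 2) set \<Rightarrow> bool" where
  "local_biholo G g U V \<longleftrightarrow> open U \<and> 0 \<in> U \<and> open V \<and> 0 \<in> V \<and> G 0 = 0 \<and>
     homeomorphism U V G g \<and> holo_map_on G U \<and> holo_map_on g V"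

lemma bounded_linear_matrix2:
  "bounded_linear (\<lambda>v::complex^2. vec2 (a * v $ 1 + b * v $ 2) (c * v $ 1 + d * v $ 2))"
  by (intro linear_conv_bounded_linear[THEN iffD1] linearI)
    (auto simp: vec_eq_iff forall_2 algebra_simps)

lemma inv_homogeneous:
  assumes "bij T" "\<And>c v. T (c *s v) = c *s T v" shows "inv T (c *s w) = c *s inv T w"
  using assms by (metis bij_inv_eq_iff)

text \<open>The coordinates are linear combinations of \<open>x\<close>, \<open>y\<close>, and
  \<open>G1\<close>, \<open>G2\<close> agree with \<open>x\<close>, \<open>y\<close> to first order.
  So the same combinations of \<open>G1\<close>, \<open>G2\<close> have the coordinates as
  derivatives, which gives a left inverse of the differential at the origin.\<close>

lemma local_biholo_exists:
  assumes xy: "lin_coords x y" and G: "G1 - x \<in> mpow 2" "G2 - y \<in> mpow 2"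
  obtains g U V where "local_biholo (\<lambda>z. vec2 (rep_hgerm G1 z) (rep_hgerm G2 z)) g U V"
proof -
  define g1 g2 where "g1 = rep_hgerm G1" and "g2 = rep_hgerm G2"
  have g12: "holo_fun_germ g1" "holo_fun_germ g2" "G1 = germ g1" "G2 = germ g2"
    unfolding g1_def g2_def by (simp_all add: rep_hgerm)
  define G where "G = (\<lambda>z. vec2 (g1 z) (g2 z))"
  obtain a1 b1 where a1: "holo_fun_germ a1" and b1: "holo_fun_germ b1"
    and D1: "\<forall>\<^sub>F z in nhds 0. (g1 has_derivative (\<lambda>v. a1 z * v $ 1 + b1 z * v $ 2)) (at z)"
    by (rule holo_fun_germ_partials[OF g12(1)])
  obtain a2 b2 where a2: "holo_fun_germ a2" and b2: "holo_fun_germ b2"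
    and D2: "\<forall>\<^sub>F z in nhds 0. (g2 has_derivative (\<lambda>v. a2 z * v $ 1 + b2 z * v $ 2)) (at z)"
    by (rule holo_fun_germ_partials[OF g12(2)])
  define T where "T = (\<lambda>z (v::complex^2). vec2 (a1 z * v $ 1 + b1 z * v $ 2) (a2 z * v $ 1 + b2 z * v $ 2))"
  have "\<forall>\<^sub>F z in nhds 0. (G has_derivative T z) (at z) \<and>
      holo_at a1 z \<and> holo_at b1 z \<and> holo_at a2 z \<and> holo_at b2 z \<and> holo_at g1 z \<and> holo_at g2 z"
    using D1 D2 a1 a2 b1 b2 unfolding holo_fun_germ_iff
  proof eventually_elim
    case (elim z)
    have "((\<lambda>z. G z $ i) has_derivative (\<lambda>v. T z v $ i)) (at z)" for i
      using elim(1,2) exhaust_2[of i] by (auto simp: G_def T_def)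
    then have "(G has_derivative T z) (at z)" by (rule has_derivative_vec2)
    then show ?case using elim unfolding holo_at_def by blast
  qed
  then obtain U0 where U0: "open U0" "0 \<in> U0" and
    U0': "\<And>z. z \<in> U0 \<Longrightarrow> (G has_derivative T z) (at z) \<and>
      holo_at a1 z \<and> holo_at b1 z \<and> holo_at a2 z \<and> holo_at b2 z \<and> holo_at g1 z \<and> holo_at g2 z"
    unfolding eventually_nhds by blast
  have T_bl: "bounded_linear (T z)" for z
    unfolding T_def by (rule bounded_linear_matrix2)
  have val0: "g1 0 = 0" "g2 0 = 0"
  proof -
    have "val (G1 - x) = 0" "val (G2 - y) = 0"
      using mpow_mono[OF G(1), of "Suc 0"] mpow_mono[OF G(2), of "Suc 0"] by (simp_all add: mpow_1_iff)
    then show "g1 0 = 0" "g2 0 = 0"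
      using xy g12 by (simp_all add: lin_coords_def val_germ)
  qed
  have left_inv: "\<exists>c d. coord i = const c * x + const d * y \<and> (\<forall>v. c * T 0 v $ 1 + d * T 0 v $ 2 = v $ i)" for i
  proof -
    obtain c d where cd: "coord i = const c * x + const d * y"
      using xy exhaust_2[of i] unfolding lin_coords_def by metis
    define r where "r = rep_hgerm (const c * (x - G1) + const d * (y - G2))"
    have "const c * (x - G1) + const d * (y - G2) \<in> mpow 2"
      using mpow_uminus[OF G(1)] mpow_uminus[OF G(2)] by (intro mpow_add mpow_mult_left) simp_all
    then have r: "holo_fun_germ r" "germ r \<in> mpow 2" "germ r = const c * (x - G1) + const d * (y - G2)"
      by (simp_all add: r_def rep_hgerm)
    have "germ (\<lambda>z. z $ i) = germ (\<lambda>z. c * g1 z + d * g2 z + r z)"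
      using g12 r cd by (simp add: germ_add germ_mult holo_fun_germ_add holo_fun_germ_mult coord_def const_def[symmetric] algebra_simps)
    then have eq: "germ_eq (\<lambda>z. c * g1 z + d * g2 z + r z) (\<lambda>z. z $ i)"
      using g12 r by (simp add: germ_eq_iff holo_fun_germ_add holo_fun_germ_mult germ_eq_sym)
    have "(g1 has_derivative (\<lambda>v. T 0 v $ 1)) (at 0)" "(g2 has_derivative (\<lambda>v. T 0 v $ 2)) (at 0)"
      using eventually_nhds_x_imp_x[OF D1] eventually_nhds_x_imp_x[OF D2] by (simp_all add: T_def)
    then have "((\<lambda>z. c * g1 z + d * g2 z + r z) has_derivative (\<lambda>v. c * T 0 v $ 1 + d * T 0 v $ 2 + 0)) (at 0)"
      by (intro has_derivative_add has_derivative_mult_right mpow_2_has_derivative[OF r(1,2)])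
    from germ_eq_has_derivative[OF eq this]
    have "(\<lambda>v. c * T 0 v $ 1 + d * T 0 v $ 2) = (\<lambda>v. v $ i)"
      by (intro has_derivative_unique[of "\<lambda>z. z $ i" _ 0])
        (auto intro: bounded_linear_imp_has_derivative bounded_linear_vec_nth)
    then show ?thesis using cd by metis
  qed
  obtain c1 d1 where i1: "\<And>v. c1 * T 0 v $ 1 + d1 * T 0 v $ 2 = v $ 1" using left_inv[of 1] by blast
  obtain c2 d2 where i2: "\<And>v. c2 * T 0 v $ 1 + d2 * T 0 v $ 2 = v $ 2" using left_inv[of 2] by blast
  define S where "S = Blinfun (\<lambda>w::complex^2. vec2 (c1 * w $ 1 + d1 * w $ 2) (c2 * w $ 1 + d2 * w $ 2))"
  have inv: "S o\<^sub>L Blinfun (T 0) = id_blinfun"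
    by (rule blinfun_eqI)
      (simp add: S_def bounded_linear_Blinfun_apply bounded_linear_matrix2 T_bl i1 i2)
  have cont: "continuous_on U0 (\<lambda>z. Blinfun (T z))"
  proof (rule continuous_on_blinfun_componentwise)
    fix i :: "complex ^ 2"
    have "continuous_on U0 a1" "continuous_on U0 b1" "continuous_on U0 a2" "continuous_on U0 b2"
      using U0' by (auto intro!: continuous_at_imp_continuous_on holo_at_imp_isCont)
    then show "continuous_on U0 (\<lambda>z. blinfun_apply (Blinfun (T z)) i)"
      unfolding bounded_linear_Blinfun_apply[OF T_bl] unfolding T_def by (intro continuous_intros)
  qed
  obtain U V g g' where UV: "open U" "U \<subseteq> U0" "0 \<in> U" "open V" "G 0 \<in> V" "homeomorphism U V G g"
    and g': "\<And>w. w \<in> V \<Longrightarrow> (g has_derivative g' w) (at w)"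
      "\<And>w. w \<in> V \<Longrightarrow> g' w = inv (blinfun_apply (Blinfun (T (g w))))"
      "\<And>w. w \<in> V \<Longrightarrow> bij (blinfun_apply (Blinfun (T (g w))))"
    by (rule inverse_function_theorem[OF U0(1) _ cont U0(2) inv, of G])
      (use U0' in \<open>auto simp: bounded_linear_Blinfun_apply[OF T_bl]\<close>)
  \<comment> \<open>The inverse function theorem is a real one; the derivative of the inverse is
    complex homogeneous because it inverts a complex homogeneous bijection.\<close>
  have "holo_map_on g V"
    unfolding holo_map_on_def holo_fun_on_def
  proof (intro allI conjI ballI)
    fix i w assume w: "w \<in> V"
    have "((\<lambda>w. g w $ i) has_derivative (\<lambda>v. g' w v $ i)) (at w)"
      by (rule bounded_linear.has_derivative[OF bounded_linear_vec_nth g'(1)[OF w]])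
    moreover have "g' w (c *s v) $ i = c * g' w v $ i" for c v
    proof -
      have "T z (c *s v) = c *s T z v" for c v z
        by (simp add: T_def vec_eq_iff forall_2 algebra_simps)
      then have "g' w (c *s v) = c *s g' w v"
        using g'(3)[OF w] unfolding g'(2)[OF w] bounded_linear_Blinfun_apply[OF T_bl]
        by (intro inv_homogeneous)
      then show ?thesis by simp
    qed
    ultimately show "\<exists>D. ((\<lambda>w. g w $ i) has_derivative D) (at w) \<and> (\<forall>c v. D (c *s v) = c * D v)"
      by (intro exI conjI allI)
  qed (use UV in auto)
  moreover have "holo_map_on G U"
    unfolding holo_map_on_def holo_fun_on_iff G_def using UV U0' by (auto simp: forall_2)
  moreover have "G 0 = 0"
    by (simp add: G_def val0 vec_eq_iff forall_2)
  ultimately have "local_biholo G g U V"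
    using UV unfolding local_biholo_def by simp
  then show ?thesis
    using that unfolding G_def g1_def g2_def by blast
qed

lemma local_biholo_germs:
  assumes "local_biholo G g U V"
  shows "map_germ0 G" "map_germ0 g" "\<forall>\<^sub>F z in nhds 0. g (G z) = z" "\<forall>\<^sub>F w in nhds 0. G (g w) = w"
proof -
  have UV: "open U" "0 \<in> U" "open V" "0 \<in> V" "G 0 = 0" "homeomorphism U V G g"
    "holo_map_on G U" "holo_map_on g V"
    using assms by (auto simp: local_biholo_def)
  show "\<forall>\<^sub>F z in nhds 0. g (G z) = z" "\<forall>\<^sub>F w in nhds 0. G (g w) = w"
    using UV unfolding eventually_nhds homeomorphism_def by blast+
  have "g 0 = 0" using UV unfolding homeomorphism_def by metis
  then show "map_germ0 G" "map_germ0 g"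
    using UV unfolding map_germ0_def holo_map_germ_def by blast+
qed

section \<open>Flows conjugate to linear diagonal ones\<close>

definition diag_flow :: "complex \<Rightarrow> complex \<Rightarrow> complex \<Rightarrow> complex ^ 2 \<Rightarrow> complex ^ 2" where
  "diag_flow a b s w = vec2 (exp (a * s) * w $ 1) (exp (b * s) * w $ 2)"

lemma diag_flow_nth [simp]:
  "diag_flow a b s w $ 1 = exp (a * s) * w $ 1" "diag_flow a b s w $ 2 = exp (b * s) * w $ 2"
  by (simp_all add: diag_flow_def)

lemma diag_flow_0 [simp]: "diag_flow a b 0 w = w" "diag_flow a b s 0 = 0"
  by (simp_all add: vec_eq_iff forall_2)

lemma map_germ0_diag_flow: "map_germ0 (diag_flow a b s)"
  unfolding map_germ0_def holo_map_germ_iff forall_2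
  by (auto intro: holo_fun_germ_mult)

lemma map_germ0_compose: "map_germ0 F \<Longrightarrow> map_germ0 G \<Longrightarrow> map_germ0 (\<lambda>z. F (G z))"
  unfolding map_germ0_def by (auto intro: holo_map_germ_compose)

lemma norm_diag_flow_le:
  assumes "norm s < R"
  shows "norm (diag_flow a b s w) \<le> (exp (norm a * R) + exp (norm b * R)) * norm w"
proof -
  have *: "norm (exp (c * s)) \<le> exp (norm c * R)" for c
    using assms by (intro order_trans[OF norm_exp]) (simp add: norm_mult mult_left_mono)
  have "norm (diag_flow a b s w) \<le> norm (exp (a * s)) * norm (w $ 1) + norm (exp (b * s)) * norm (w $ 2)"
    unfolding diag_flow_def using norm_vec2_le by (simp add: norm_mult order_trans[OF norm_vec2_le])
  also have "\<dots> \<le> exp (norm a * R) * norm w + exp (norm b * R) * norm w"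
    by (intro add_mono mult_mono * Finite_Cartesian_Product.norm_nth_le) auto
  finally show ?thesis by (simp add: algebra_simps)
qed

lemma local_biholo_flow:
  assumes bih: "local_biholo G g U V"
  shows "\<exists>Y. singular_vector_field Y \<and> is_flow Y (\<lambda>s z. g (diag_flow a b s (G z)))"
proof -
  have UV: "open U" "0 \<in> U" "open V" "0 \<in> V" "G 0 = 0" "homeomorphism U V G g"
    "holo_map_on G U" "holo_map_on g V"
    using bih by (auto simp: local_biholo_def)
  have hom: "\<And>z. z \<in> U \<Longrightarrow> g (G z) = z" "\<And>w. w \<in> V \<Longrightarrow> G (g w) = w"
    "\<And>z. z \<in> U \<Longrightarrow> G z \<in> V" "\<And>w. w \<in> V \<Longrightarrow> g w \<in> U" "continuous_on U G"
    using UV(6) unfolding homeomorphism_def by auto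
  have gi: "holo_fun_germ (\<lambda>w. g w $ i)" for i
    using UV unfolding holo_fun_germ_def holo_map_on_def by blast
  obtain p1 q1 where p1: "holo_fun_germ p1" and q1: "holo_fun_germ q1"
    and D1: "\<forall>\<^sub>F z in nhds 0. ((\<lambda>w. g w $ 1) has_derivative (\<lambda>v. p1 z * v $ 1 + q1 z * v $ 2)) (at z)"
    by (rule holo_fun_germ_partials[OF gi])
  obtain p2 q2 where p2: "holo_fun_germ p2" and q2: "holo_fun_germ q2"
    and D2: "\<forall>\<^sub>F z in nhds 0. ((\<lambda>w. g w $ 2) has_derivative (\<lambda>v. p2 z * v $ 1 + q2 z * v $ 2)) (at z)"
    by (rule holo_fun_germ_partials[OF gi])
  define P where "P = (\<lambda>w (v::complex^2). vec2 (p1 w * v $ 1 + q1 w * v $ 2) (p2 w * v $ 1 + q2 w * v $ 2))"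
  have "\<forall>\<^sub>F w in nhds 0. w \<in> V \<and> (g has_derivative P w) (at w) \<and>
      holo_at p1 w \<and> holo_at q1 w \<and> holo_at p2 w \<and> holo_at q2 w"
    using D1 D2 p1 p2 q1 q2 eventually_nhds_in_open[OF UV(3,4)] unfolding holo_fun_germ_iff
  proof eventually_elim
    case (elim w)
    have "((\<lambda>z. g z $ i) has_derivative (\<lambda>v. P w v $ i)) (at w)" for i
      using elim(1,2) exhaust_2[of i] by (auto simp: P_def)
    then have "(g has_derivative P w) (at w)" by (rule has_derivative_vec2)
    then show ?case using elim by blast
  qed
  then obtain d where d: "d > 0" and dV: "\<And>w. norm w < d \<Longrightarrow> w \<in> V \<and> (g has_derivative P w) (at w) \<and>
      holo_at p1 w \<and> holo_at q1 w \<and> holo_at p2 w \<and> holo_at q2 w"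
    unfolding eventually_nhds_metric by auto
  define W where "W = {z \<in> U. norm (G z) < d}"
  have openW: "open {z \<in> U. norm (G z) < e}" for e
  proof -
    have "open (U \<inter> G -` ball 0 e)" by (rule continuous_open_preimage[OF hom(5) UV(1) open_ball])
    moreover have "U \<inter> G -` ball 0 e = {z \<in> U. norm (G z) < e}" by auto
    ultimately show ?thesis by simp
  qed
  \<comment> \<open>The linear field with eigenvalues \<open>a\<close>, \<open>b\<close> carried
    over by \<open>g\<close>: the derivative at \<open>s = 0\<close> of the conjugated flow.\<close>
  define Y where "Y = (\<lambda>z. P (G z) (vec2 (a * G z $ 1) (b * G z $ 2)))"
  have Gh: "holo_at (\<lambda>z. G z $ i) z" if "z \<in> U" for i z
    using UV(7) that unfolding holo_map_on_def holo_fun_on_iff by blast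
  have "holo_map_on Y W"
    unfolding holo_map_on_def holo_fun_on_iff forall_2
  proof (intro conjI ballI)
    fix z assume "z \<in> W"
    then have z: "z \<in> U" "norm (G z) < d" by (auto simp: W_def)
    have comp: "holo_at (\<lambda>z. p (G z)) z" if "holo_at p (G z)" for p
      by (rule holo_at_compose[OF Gh[OF z(1)] that])
    show "holo_at (\<lambda>z. Y z $ 1) z" "holo_at (\<lambda>z. Y z $ 2) z"
      using dV[OF z(2)] unfolding Y_def P_def vec2_nth
      by (intro holo_at_add holo_at_mult comp holo_at_const Gh[OF z(1)]; simp)+
  qed (use openW W_def in auto)
  moreover have "0 \<in> W" using UV d by (simp add: W_def)
  moreover have "Y 0 = 0" using UV by (simp add: Y_def P_def vec_eq_iff forall_2)
  ultimately have "singular_vector_field Y"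
    unfolding singular_vector_field_def holo_map_germ_def by blast
  moreover have "is_flow Y (\<lambda>s z. g (diag_flow a b s (G z)))"
    unfolding is_flow_def
  proof (rule exI[of _ W], intro conjI allI impI)
    show "holo_map_on Y W" by fact
    fix R :: real assume R: "R > 0"
    define M where "M = exp (norm a * R) + exp (norm b * R)"
    have M: "M > 0" by (simp add: M_def add_pos_pos)
    \<comment> \<open>\<open>M\<close> bounds the expansion of the linear flow for times in the disc
      of radius \<open>R\<close>, so trajectories starting in \<open>N\<close> stay, in the
      coordinates \<open>G\<close>, inside the ball of radius \<open>d\<close>.\<close>
    define N where "N = {z \<in> U. norm (G z) < d / M}"
    have "\<exists>N. open N \<and> 0 \<in> N \<and> (\<forall>z\<in>N. z \<in> U \<and> norm (G z) < d / M)"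
      by (rule exI[of _ N]) (use openW UV d M in \<open>auto simp: N_def\<close>)
    moreover have "g (diag_flow a b 0 (G z)) = z \<and> (\<forall>s\<in>ball 0 R. g (diag_flow a b s (G z)) \<in> W \<and>
        ((\<lambda>s. g (diag_flow a b s (G z))) has_derivative (\<lambda>h. h *s Y (g (diag_flow a b s (G z))))) (at s))"
      if z: "z \<in> U" "norm (G z) < d / M" for z
    proof (intro conjI ballI)
      show "g (diag_flow a b 0 (G z)) = z" using hom z by simp
      fix s assume "s \<in> ball (0::complex) R"
      then have s: "norm s < R" by simp
      define w where "w = diag_flow a b s (G z)"
      have "norm w \<le> M * norm (G z)" unfolding w_def M_def by (rule norm_diag_flow_le[OF s])
      also have "\<dots> < d" using z(2) M by (simp add: field_simps)
      finally have w: "norm w < d" .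
      then have wV: "w \<in> V" and gw: "(g has_derivative P w) (at w)" using dV by blast+
      show "g (diag_flow a b s (G z)) \<in> W"
        using wV w hom unfolding w_def[symmetric] by (simp add: W_def)
      have exp_der: "((\<lambda>s. exp (c * s) * t) has_derivative (\<lambda>h. h * (c * (exp (c * s) * t)))) (at s)" for c t
        by (auto intro!: derivative_eq_intros simp: algebra_simps)
      have "((\<lambda>s. diag_flow a b s (G z) $ i) has_derivative
          (\<lambda>h. vec2 (h * (a * w $ 1)) (h * (b * w $ 2)) $ i)) (at s)" for i
        using exp_der[of a "G z $ 1"] exp_der[of b "G z $ 2"] exhaust_2[of i] by (auto simp: w_def)
      then have "((\<lambda>s. diag_flow a b s (G z)) has_derivative
          (\<lambda>h. vec2 (h * (a * w $ 1)) (h * (b * w $ 2)))) (at s)"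
        by (rule has_derivative_vec2)
      from diff_chain_at[OF this, of g "P w"] gw
      have "((\<lambda>s. g (diag_flow a b s (G z))) has_derivative
          (\<lambda>h. P w (vec2 (h * (a * w $ 1)) (h * (b * w $ 2))))) (at s)"
        by (simp add: o_def w_def)
      moreover have "P w (vec2 (h * (a * w $ 1)) (h * (b * w $ 2))) = h *s Y (g w)" for h
        unfolding Y_def hom(2)[OF wV] by (simp add: P_def vec_eq_iff forall_2 algebra_simps)
      ultimately show "((\<lambda>s. g (diag_flow a b s (G z))) has_derivative
          (\<lambda>h. h *s Y (g (diag_flow a b s (G z))))) (at s)"
        by (simp add: w_def)
    qed
    ultimately show "\<exists>N. open N \<and> 0 \<in> N \<and> (\<forall>z\<in>N. g (diag_flow a b 0 (G z)) = z \<and>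
        (\<forall>s\<in>ball 0 R. g (diag_flow a b s (G z)) \<in> W \<and>
        ((\<lambda>s. g (diag_flow a b s (G z))) has_derivative (\<lambda>h. h *s Y (g (diag_flow a b s (G z))))) (at s)))"
      by blast
  qed
  ultimately show ?thesis by blast
qed

subsection \<open>Adapted coordinates and resonances\<close>

lemma pull_pull:
  assumes "map_germ0 F" "map_germ0 G" shows "pull G (pull F h) = pull (\<lambda>z. F (G z)) h"
proof -
  obtain f where "holo_fun_germ f" "h = germ f" by (rule hgerm_cases)
  then show ?thesis
    using assms holo_fun_germ_pull[OF assms(1)] map_germ0_compose[OF assms] by (simp add: pull_germ)
qed

lemma pull_eq_self:
  assumes F: "map_germ0 F" and "\<forall>\<^sub>F z in nhds 0. F z = z" shows "pull F h = h"
proof -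
  obtain f where f: "holo_fun_germ f" "h = germ f" by (rule hgerm_cases)
  have "germ_eq (\<lambda>z. f (F z)) f"
    using assms(2) unfolding germ_eq_def by eventually_elim simp
  then show ?thesis
    using f holo_fun_germ_pull[OF F f(1)] by (simp add: pull_germ F germ_eq_iff)
qed

lemma pull_pull_eq_self:
  assumes "map_germ0 F" "map_germ0 G" "\<forall>\<^sub>F z in nhds 0. F (G z) = z" shows "pull G (pull F h) = h"
  using pull_eq_self[OF map_germ0_compose[OF assms(1,2)] assms(3)] pull_pull[OF assms(1,2)] by simp

text \<open>Restricted to the first axis, \<open>c * t ^ n\<close> would be of order
  \<open>n + 1\<close>. Restriction to other lines brings the comparison of leading coefficients
  back to this case.\<close>

lemma const_coord_power_mpow:
  assumes "const c * coord 1 ^ n \<in> mpow (Suc n)" shows "c = 0"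
proof -
  have pow: "holo_fun_germ (\<lambda>z. (z::complex^2) $ 1 ^ k) \<and> germ (\<lambda>z. z $ 1 ^ k) = coord 1 ^ k" for k
    by (induction k)
      (auto simp: one_hgerm.abs_eq germ_mult coord_def intro: holo_fun_germ_mult)
  have "germ (\<lambda>z. c * z $ 1 ^ n) \<in> mpow (Suc n)" "holo_fun_germ (\<lambda>z. c * z $ 1 ^ n)"
    using assms pow[of n] by (auto simp: germ_mult const_def intro: holo_fun_germ_mult)
  then obtain C where C: "\<forall>\<^sub>F z in nhds (0::complex^2). norm (c * z $ 1 ^ n) \<le> C * norm z ^ Suc n"
    using mpow_bound by blast
  have "filterlim (\<lambda>t. vec2 t 0) (nhds 0) (nhds (0::complex))"
  proof -
    have "continuous_on UNIV (\<lambda>t. vec2 t 0)" by (intro continuous_intros)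
    then have "isCont (\<lambda>t. vec2 t 0) 0" by (simp add: continuous_on_eq_continuous_at)
    moreover have "vec2 0 0 = 0" by (simp add: vec_eq_iff forall_2)
    ultimately show ?thesis using tendsto_at_iff_tendsto_nhds[of "\<lambda>t. vec2 t 0" 0] by (simp add: isCont_def)
  qed
  with C have "\<forall>\<^sub>F t in nhds 0. norm (c * vec2 t 0 $ 1 ^ n) \<le> C * norm (vec2 t 0) ^ Suc n"
    unfolding filterlim_iff by blast
  moreover have "norm (vec2 t 0) = norm t" for t
    by (simp add: norm_vec_def L2_set_def sum_2)
  ultimately have "\<forall>\<^sub>F t in at (0::complex). norm c \<le> C * norm t"
    unfolding eventually_at_filter
    by (elim eventually_mono) (auto simp: norm_mult norm_power algebra_simps)
  moreover have "((\<lambda>t::complex. C * norm t) \<longlongrightarrow> C * norm (0::complex)) (at 0)"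
    by (intro tendsto_intros)
  ultimately have "norm c \<le> C * norm (0::complex)"
    by (intro tendsto_le[of "at (0::complex)" _ _ "\<lambda>_. norm c"]) auto
  then show ?thesis by simp
qed

text \<open>Pulling back along this projection onto the line of slope \<open>s\<close> restricts a
  germ to that line, parametrized by the first coordinate, without leaving the ring of germs in two
  variables.\<close>

definition line_map :: "complex \<Rightarrow> complex ^ 2 \<Rightarrow> complex ^ 2" where
  "line_map s z = vec2 (z $ 1) (s * z $ 1)"

lemma map_germ0_line_map: "map_germ0 (line_map s)"
  unfolding map_germ0_def holo_map_germ_iff forall_2 line_map_def
  by (auto simp: vec_eq_iff forall_2 intro: holo_fun_germ_mult)

lemma pull_line_map_coord:
  "pull (line_map s) (coord 1) = coord 1" "pull (line_map s) (coord 2) = const s * coord 1"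
  unfolding pull_coord[OF map_germ0_line_map]
  by (simp_all add: line_map_def coord_def const_def germ_mult)

lemma pull_hform_const:
  "map_germ0 F \<Longrightarrow> pull F (hform x y n (\<lambda>i. const (c i))) = hform (pull F x) (pull F y) n (\<lambda>i. const (c i))"
  by (simp add: hform_def pull_sum pull_mult pull_power)

lemma lin_coords_coord: "lin_coords (coord 1) (coord 2)"
proof -
  have "coord 1 = const 1 * coord 1 + const 0 * coord 2" "coord 2 = const 0 * coord 1 + const 1 * coord 2"
    by simp_all
  then show ?thesis unfolding lin_coords_def by (intro conjI exI) (simp_all only: val_coord)
qed

lemma lowest_form:
  assumes "h \<noteq> 0"
  obtains n p where "degree p \<le> n" "p \<noteq> 0" "h \<in> mpow n"
    "h - pform (coord 1) (coord 2) n p \<in> mpow (Suc n)"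
proof -
  obtain k where k: "h \<notin> mpow k" using mpow_all_imp_0 assms by blast
  \<comment> \<open>With \<open>Suc n\<close> in the condition, \<open>n\<close> is the exact order
    of \<open>h\<close>, the last exponent whose power contains it.\<close>
  define n where "n = (LEAST n. h \<notin> mpow (Suc n))"
  have "k \<noteq> 0" using k by (cases k) auto
  then have n: "h \<notin> mpow (Suc n)"
    using LeastI[of "\<lambda>n. h \<notin> mpow (Suc n)" "k - 1"] k unfolding n_def by simp
  have hn: "h \<in> mpow n"
  proof (cases n)
    case (Suc j)
    then show ?thesis using not_less_Least[of j "\<lambda>n. h \<notin> mpow (Suc n)"] unfolding n_def by auto
  qed simp
  obtain p where p: "degree p \<le> n" "h - pform (coord 1) (coord 2) n p \<in> mpow (Suc n)"
    by (rule mpow_taylor_poly[OF lin_coords_coord hn])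
  have "p \<noteq> 0"
  proof
    assume "p = 0"
    then show False using p(2) n by (simp add: hform_def)
  qed
  with p hn that show ?thesis by blast
qed

text \<open>
  The coordinates \<open>x\<close>, \<open>y\<close> are dual to the vectors \<open>(1, s)\<close> and \<open>(1, t)\<close>, so the extreme
  coefficients of a binary form in \<open>x\<close>, \<open>y\<close> are its values at these vectors.
\<close>

lemma dual_coords:
  assumes st: "s \<noteq> t"
  obtains x y where "lin_coords x y"
    "pull (line_map s) x = coord 1" "pull (line_map s) y = 0"
    "pull (line_map t) x = 0" "pull (line_map t) y = coord 1"
proof -
  define k where "k = const (1 / (s - t))"
  have k: "k * const s - k * const t = 1"
  proof -
    have "k * const s - k * const t = const (1 / (s - t) * (s - t))"
      by (simp only: k_def const_mult const_diff right_diff_distrib)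
    then show ?thesis using st by simp
  qed
  define x y where "x = k * (coord 2 - const t * coord 1)" and "y = k * (const s * coord 1 - coord 2)"
  have "const 1 * x + const 1 * y = (k * const s - k * const t) * coord 1"
    by (simp add: x_def y_def algebra_simps)
  then have 1: "coord 1 = const 1 * x + const 1 * y" by (simp add: k)
  have "const s * x + const t * y = (k * const s - k * const t) * coord 2"
    by (simp add: x_def y_def algebra_simps)
  then have 2: "coord 2 = const s * x + const t * y" by (simp add: k)
  have "val x = 0" "val y = 0" by (simp_all add: x_def y_def)
  with 1 2 have "lin_coords x y" unfolding lin_coords_def by blast
  moreover have pull: "pull (line_map u) x = (k * const u - k * const t) * coord 1"
    "pull (line_map u) y = (k * const s - k * const u) * coord 1" for u
    by (simp_all add: x_def y_def k_def pull_mult pull_diff map_germ0_line_map pull_line_map_coord algebra_simps)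
  ultimately show ?thesis
    by (intro that[of x y]) (simp_all add: pull k)
qed

text \<open>On the line of slope \<open>s\<close> both expansions of \<open>h\<close> become
  multiples of \<open>coord 1 ^ n\<close>, with the coefficients \<open>poly p s\<close> and
  \<open>coeff p' 0\<close>; agreeing up to order \<open>n + 1\<close>, they are equal.\<close>

lemma pform_dual_coeff:
  assumes x: "pull (line_map s) x = coord 1" "pull (line_map s) y = 0"
    and p: "degree p \<le> n" "h - pform (coord 1) (coord 2) n p \<in> mpow (Suc n)"
    and p': "h - pform x y n p' \<in> mpow (Suc n)"
  shows "coeff p' 0 = poly p s"
proof -
  have "(h - pform x y n p') - (h - pform (coord 1) (coord 2) n p) \<in> mpow (Suc n)"
    by (rule mpow_diff[OF p' p(2)])
  from pull_mpow[OF map_germ0_line_map this, of s]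
  have "pform (coord 1) (const s * coord 1) n p - pform (coord 1) 0 n p' \<in> mpow (Suc n)"
    by (simp add: pull_diff map_germ0_line_map pull_hform_const pull_line_map_coord x)
  moreover have "pform (coord 1) (const s * coord 1) n p = const (poly p s) * coord 1 ^ n"
  proof -
    have "pform (coord 1) (const s * coord 1) n p = (\<Sum>i\<le>n. const (coeff p i * s ^ i)) * coord 1 ^ n"
      unfolding hform_def sum_distrib_right
      by (intro sum.cong refl)
        (simp add: power_mult_distrib const_mult const_power mult.assoc power_add[symmetric])
    also have "(\<Sum>i\<le>n. const (coeff p i * s ^ i)) = const (\<Sum>i\<le>n. coeff p i * s ^ i)"
      by (induction n) (simp_all add: const_add)
    also have "(\<Sum>i\<le>n. coeff p i * s ^ i) = poly p s"
      unfolding poly_altdef using p(1)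
      by (intro sum.mono_neutral_right) (auto simp: coeff_eq_0)
    finally show ?thesis .
  qed
  moreover have "pform (coord 1) 0 n p' = const (coeff p' 0) * coord 1 ^ n"
    unfolding hform_def by (subst sum.atMost_shift) simp
  ultimately have "const (poly p s - coeff p' 0) * coord 1 ^ n \<in> mpow (Suc n)"
    by (simp add: const_diff left_diff_distrib)
  from const_coord_power_mpow[OF this] show ?thesis by simp
qed

lemma pform_dual_lead_coeff:
  assumes y: "pull (line_map t) x = 0" "pull (line_map t) y = coord 1"
    and p: "degree p \<le> n" "h - pform (coord 1) (coord 2) n p \<in> mpow (Suc n)"
    and p': "h - pform x y n p' \<in> mpow (Suc n)"
  shows "coeff p' n = poly p t"
proof -
  have "hform x y n c = hform y x n (\<lambda>i. c (n - i))" for c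
    unfolding hform_def by (rule sum.reindex_bij_witness[of _ "\<lambda>i. n - i" "\<lambda>i. n - i"]) (auto simp: ac_simps)
  then have rev: "pform x y n p' = hform y x n (\<lambda>i. const (coeff p' (n - i)))" by simp
  define q where "q = (\<Sum>i\<le>n. monom (coeff p' (n - i)) i)"
  have coeff: "coeff q i = (if i \<le> n then coeff p' (n - i) else 0)" for i
    by (simp add: q_def coeff_sum if_distrib[of "\<lambda>x. _ * x"] sum.delta' cong: if_cong)
  have "pform x y n p' = pform y x n q"
    unfolding rev by (rule hform_cong) (simp add: coeff)
  then have "coeff q 0 = poly p t"
    using pform_dual_coeff[OF y(2,1) p, of q] p' by simp
  then show ?thesis by (simp add: coeff)
qed

text \<open>The classes of \<open>x\<close> and \<open>y\<close> modulo \<open>mpow 2\<close> are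
  independent, which makes the matrix of a linear part in these coordinates unique.\<close>

definition indep_coords :: "hgerm \<Rightarrow> hgerm \<Rightarrow> bool" where
  "indep_coords x y \<longleftrightarrow> (\<forall>c d. const c * x + const d * y \<in> mpow 2 \<longrightarrow> c = 0 \<and> d = 0)"

text \<open>The deforming flow will preserve the axes \<open>x = 0\<close> and \<open>y = 0\<close>,
  so a tangent of \<open>f\<close> there could never be moved; both axes must avoid the tangents of
  \<open>f\<close>. Keeping \<open>x = 0\<close> off the tangents of \<open>g\<close> makes both
  formal degrees equal to the orders. A tangent of \<open>g\<close> along \<open>y = 0\<close> is
  harmless, since \<open>coeff p 0 \<noteq> 0\<close>.\<close>

lemma adapted_coords:
  assumes "f \<noteq> 0" "g \<noteq> 0"
  obtains x y p q where "lin_coords x y" "indep_coords x y"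
    "coeff p 0 \<noteq> 0" "f - pform x y (degree p) p \<in> mpow (Suc (degree p))"
    "q \<noteq> 0" "g - pform x y (degree q) q \<in> mpow (Suc (degree q))"
proof -
  obtain n p where p: "degree p \<le> n" "p \<noteq> 0" "f \<in> mpow n" "f - pform (coord 1) (coord 2) n p \<in> mpow (Suc n)"
    by (rule lowest_form[OF assms(1)])
  obtain m q where q: "degree q \<le> m" "q \<noteq> 0" "g \<in> mpow m" "g - pform (coord 1) (coord 2) m q \<in> mpow (Suc m)"
    by (rule lowest_form[OF assms(2)])
  have "finite {z. poly p z = 0 \<or> poly q z = 0}"
    using poly_roots_finite[OF p(2)] poly_roots_finite[OF q(2)] by (simp add: Collect_disj_eq)
  then obtain t where t: "poly p t \<noteq> 0" "poly q t \<noteq> 0"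
    using ex_new_if_finite[OF infinite_UNIV_char_0, of "{z. poly p z = 0 \<or> poly q z = 0}"] by auto
  have "finite (insert t {z. poly p z = 0})" using poly_roots_finite[OF p(2)] by simp
  then obtain s where s: "poly p s \<noteq> 0" "s \<noteq> t"
    using ex_new_if_finite[OF infinite_UNIV_char_0, of "insert t {z. poly p z = 0}"] by auto
  obtain x y where xy: "lin_coords x y"
    and x: "pull (line_map s) x = coord 1" "pull (line_map s) y = 0"
    and y: "pull (line_map t) x = 0" "pull (line_map t) y = coord 1"
    by (rule dual_coords[OF s(2)])
  obtain p' where p': "degree p' \<le> n" "f - pform x y n p' \<in> mpow (Suc n)"
    by (rule mpow_taylor_poly[OF xy p(3)])
  obtain q' where q': "degree q' \<le> m" "g - pform x y m q' \<in> mpow (Suc m)"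
    by (rule mpow_taylor_poly[OF xy q(3)])
  have "coeff p' 0 \<noteq> 0" "coeff p' n \<noteq> 0" "coeff q' m \<noteq> 0"
    using pform_dual_coeff[OF x p(1,4) p'(2)] pform_dual_lead_coeff[OF y p(1,4) p'(2)]
      pform_dual_lead_coeff[OF y q(1,4) q'(2)] s t by simp_all
  moreover from this have "degree p' = n" "degree q' = m" "q' \<noteq> 0"
    using p'(1) q'(1) le_degree[of p' n] le_degree[of q' m] by auto
  moreover have "indep_coords x y"
    unfolding indep_coords_def
  proof (intro allI impI)
    fix c d assume cd: "const c * x + const d * y \<in> mpow 2"
    have "const c * coord 1 ^ 1 \<in> mpow (Suc 1)" "const d * coord 1 ^ 1 \<in> mpow (Suc 1)"
      using pull_mpow[OF map_germ0_line_map cd, of s] pull_mpow[OF map_germ0_line_map cd, of t]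
      by (simp_all add: pull_add pull_mult map_germ0_line_map x y numeral_2_eq_2)
    then show "c = 0 \<and> d = 0" using const_coord_power_mpow by blast
  qed
  ultimately show ?thesis using that[OF xy, of p' q'] p' q' by simp
qed

section \<open>Linear parts and their eigenvalues\<close>

lemma linear_part:
  assumes xy: "lin_coords x y" and "val h = 0"
  obtains a b where "h - (const a * x + const b * y) \<in> mpow 2"
proof -
  have "h \<in> mpow (Suc 0)" using assms(2) by (simp add: mpow_1_iff)
  then obtain c where "h - hform x y (Suc 0) (\<lambda>i. const (c i)) \<in> mpow (Suc (Suc 0))"
    by (rule mpow_taylor[OF xy])
  then have "h - (const (c 0) * x + const (c 1) * y) \<in> mpow 2"
    by (simp add: hform_def numeral_2_eq_2)
  then show ?thesis by (rule that)
qed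

text \<open>The linear part of a composite is the product of the matrices, so the inverse germ
  supplies an inverse matrix.\<close>

lemma linear_part_det:
  assumes xy: "lin_coords x y" and ind: "indep_coords x y" and F: "map_germ0 \<phi>" "map_germ0 \<theta>"
    and inv: "\<And>h. pull \<phi> (pull \<theta> h) = h"
    and x: "pull \<phi> x - (const a * x + const b * y) \<in> mpow 2"
    and y: "pull \<phi> y - (const c * x + const d * y) \<in> mpow 2"
  shows "a * d - b * c \<noteq> 0"
proof -
  have step: "p * a + q * c = e1 \<and> p * b + q * d = e2"
    if h: "h = const e1 * x + const e2 * y" and \<theta>: "pull \<theta> h - (const p * x + const q * y) \<in> mpow 2" for h p q e1 e2
  proof -
    have "pull \<phi> (pull \<theta> h - (const p * x + const q * y)) \<in> mpow 2"
      by (rule pull_mpow[OF F(1) \<theta>])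
    then have "h - (const p * pull \<phi> x + const q * pull \<phi> y) \<in> mpow 2"
      by (simp add: pull_diff pull_add pull_mult F inv)
    moreover have "const p * (pull \<phi> x - (const a * x + const b * y)) + const q * (pull \<phi> y - (const c * x + const d * y)) \<in> mpow 2"
      by (intro mpow_add mpow_mult_left x y)
    ultimately have "(h - (const p * pull \<phi> x + const q * pull \<phi> y)) +
        (const p * (pull \<phi> x - (const a * x + const b * y)) + const q * (pull \<phi> y - (const c * x + const d * y))) \<in> mpow 2"
      by (rule mpow_add)
    then have "const (e1 - (p * a + q * c)) * x + const (e2 - (p * b + q * d)) * y \<in> mpow 2"
      by (simp add: h const_add const_diff const_mult algebra_simps)
    then show ?thesis using ind unfolding indep_coords_def by (metis eq_iff_diff_eq_0)
  qed
  have v: "val (pull \<theta> x) = 0" "val (pull \<theta> y) = 0" using xy F by (simp_all add: lin_coords_def)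
  obtain p q where "pull \<theta> x - (const p * x + const q * y) \<in> mpow 2" by (rule linear_part[OF xy v(1)])
  then have 1: "p * a + q * c = 1" "p * b + q * d = 0" using step[of x 1 0 p q] by auto
  obtain r s where "pull \<theta> y - (const r * x + const s * y) \<in> mpow 2" by (rule linear_part[OF xy v(2)])
  then have 2: "r * a + s * c = 0" "r * b + s * d = 1" using step[of y 0 1 r s] by auto
  have "(p * s - q * r) * (a * d - b * c) = (p * a + q * c) * (r * b + s * d) - (p * b + q * d) * (r * a + s * c)"
    by (simp add: algebra_simps)
  also have "\<dots> = 1" by (simp add: 1 2)
  finally show ?thesis by auto
qed

lemma lin_coords_change:
  assumes xy: "lin_coords x y" and det: "c1 * d2 - c2 * d1 \<noteq> 0"
  shows "lin_coords (const c1 * x + const c2 * y) (const d1 * x + const d2 * y)"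
proof -
  have change: "\<exists>A B. const a * x + const b * y = const A * (const c1 * x + const c2 * y) + const B * (const d1 * x + const d2 * y)" for a b
  proof -
    define D where "D = c1 * d2 - c2 * d1"
    \<comment> \<open>Cramer's rule for the coefficients in the new coordinates.\<close>
    define A B where "A = (a * d2 - b * d1) / D" and "B = (b * c1 - a * c2) / D"
    have AB: "A * D = a * d2 - b * d1" "B * D = b * c1 - a * c2"
      using det by (simp_all add: A_def B_def D_def)
    have "(A * c1 + B * d1) * D = (A * D) * c1 + (B * D) * d1" "(A * c2 + B * d2) * D = (A * D) * c2 + (B * D) * d2"
      by (simp_all add: algebra_simps)
    then have "(A * c1 + B * d1) * D = a * D" "(A * c2 + B * d2) * D = b * D"
      unfolding AB by (simp_all add: D_def algebra_simps)
    then have eq: "A * c1 + B * d1 = a" "A * c2 + B * d2 = b" using det by (simp_all add: D_def)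
    have "const A * (const c1 * x + const c2 * y) + const B * (const d1 * x + const d2 * y)
        = const (A * c1 + B * d1) * x + const (A * c2 + B * d2) * y"
      by (simp add: const_add const_mult algebra_simps)
    then show ?thesis by (metis eq)
  qed
  obtain a b c d where "coord 1 = const a * x + const b * y" "coord 2 = const c * x + const d * y"
    using xy unfolding lin_coords_def by blast
  then show ?thesis
    using xy change[of a b] change[of c d] unfolding lin_coords_def by auto
qed

text \<open>Left eigenvectors, since pulling back acts on linear forms \<open>c1 x + c2 y\<close>. A
  vector orthogonal to one nonzero column of the matrix minus \<alpha> is orthogonal to both by the
  determinant condition; if both columns vanish, any vector will do.\<close>

lemma left_eigenvector2:
  fixes \<alpha> :: complex
  assumes "(m11 - \<alpha>) * (m22 - \<alpha>) = m12 * m21"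
  shows "\<exists>c1 c2. (c1 \<noteq> 0 \<or> c2 \<noteq> 0) \<and> c1 * m11 + c2 * m21 = \<alpha> * c1 \<and> c1 * m12 + c2 * m22 = \<alpha> * c2"
proof (cases "m21 = 0 \<and> m11 = \<alpha>")
  case False
  then show ?thesis using assms
    by (intro exI[of _ m21] exI[of _ "\<alpha> - m11"]) (auto simp: algebra_simps)
next
  case True
  show ?thesis
  proof (cases "m12 = 0 \<and> m22 = \<alpha>")
    case False
    then show ?thesis using True
      by (intro exI[of _ "m22 - \<alpha>"] exI[of _ "- m12"]) (auto simp: algebra_simps)
  next
    case 2: True
    then show ?thesis using True by (intro exI[of _ 1] exI[of _ 0]) auto
  qed
qed

lemma left_eigenvectors_indep:
  fixes \<alpha> \<beta> :: complex
  assumes ne: "\<alpha> \<noteq> \<beta>" and c: "c1 \<noteq> 0 \<or> c2 \<noteq> 0" "c1 * m11 + c2 * m21 = \<alpha> * c1" "c1 * m12 + c2 * m22 = \<alpha> * c2"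
    and d: "d1 \<noteq> 0 \<or> d2 \<noteq> 0" "d1 * m11 + d2 * m21 = \<beta> * d1" "d1 * m12 + d2 * m22 = \<beta> * d2"
  shows "c1 * d2 - c2 * d1 \<noteq> 0"
proof
  assume "c1 * d2 - c2 * d1 = 0"
  then have cd: "c1 * d2 = c2 * d1" by simp
  have "\<beta> * d1 * c1 = d1 * (c1 * m11) + (c1 * d2) * m21" using d(2)[symmetric] by (simp add: algebra_simps)
  also have "\<dots> = d1 * (\<alpha> * c1)" unfolding cd c(2)[symmetric] by (simp add: algebra_simps)
  finally have 1: "c1 * d1 = 0" using ne by auto
  have "\<beta> * d2 * c2 = (c2 * d1) * m12 + d2 * (c2 * m22)" using d(3)[symmetric] by (simp add: algebra_simps)
  also have "\<dots> = d2 * (\<alpha> * c2)" unfolding cd[symmetric] c(3)[symmetric] by (simp add: algebra_simps)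
  finally have 2: "c2 * d2 = 0" using ne by auto
  show False using 1 2 cd c(1) d(1) by auto
qed

section \<open>Exceptional parameters of the deformation\<close>

lemma complex_sum_prod_exists: "\<exists>\<alpha> \<beta> :: complex. \<alpha> + \<beta> = T \<and> \<alpha> * \<beta> = D"
proof (intro exI conjI)
  define r where "r = csqrt (T ^ 2 - 4 * D)"
  have r: "r ^ 2 = T ^ 2 - 4 * D" by (simp add: r_def)
  show "(T + r) / 2 + (T - r) / 2 = T" by (simp add: field_simps)
  have "(T + r) / 2 * ((T - r) / 2) = (T ^ 2 - r ^ 2) / 4" by (simp add: field_simps power2_eq_square)
  then show "(T + r) / 2 * ((T - r) / 2) = D" by (simp add: r)
qed

text \<open>Newton's recurrence. The eigenvalues need not be polynomial in \<open>u\<close>, but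
  their symmetric functions are, and these suffice to bound the exceptional parameters.\<close>

lemma power_sum_poly:
  fixes T D :: "complex poly"
  shows "\<exists>P. \<forall>u \<alpha> \<beta>. \<alpha> + \<beta> = poly T u \<longrightarrow> \<alpha> * \<beta> = poly D u \<longrightarrow> \<alpha> ^ m + \<beta> ^ m = poly P u"
proof (induction m rule: less_induct)
  case (less m)
  consider "m = 0" | "m = 1" | k where "m = Suc (Suc k)" by (metis One_nat_def not0_implies_Suc)
  then show ?case
  proof cases
    case 1 then show ?thesis by (intro exI[of _ "[:2:]"]) simp
  next
    case 2 then show ?thesis by (intro exI[of _ T]) simp
  next
    case 3
    obtain P where P: "\<And>u \<alpha> \<beta>. \<alpha> + \<beta> = poly T u \<Longrightarrow> \<alpha> * \<beta> = poly D u \<Longrightarrow> \<alpha> ^ k + \<beta> ^ k = poly P u"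
      using less.IH[of k] 3 by auto
    obtain Q where Q: "\<And>u \<alpha> \<beta>. \<alpha> + \<beta> = poly T u \<Longrightarrow> \<alpha> * \<beta> = poly D u \<Longrightarrow> \<alpha> ^ Suc k + \<beta> ^ Suc k = poly Q u"
      using less.IH[of "Suc k"] 3 by auto
    have "\<alpha> ^ m + \<beta> ^ m = poly (T * Q - D * P) u" if "\<alpha> + \<beta> = poly T u" "\<alpha> * \<beta> = poly D u" for u \<alpha> \<beta>
    proof -
      have "\<alpha> ^ m + \<beta> ^ m = (\<alpha> + \<beta>) * (\<alpha> ^ Suc k + \<beta> ^ Suc k) - \<alpha> * \<beta> * (\<alpha> ^ k + \<beta> ^ k)"
        by (simp add: 3 algebra_simps)
      then show ?thesis using P[OF that] Q[OF that] that by simp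
    qed
    then show ?thesis by blast
  qed
qed

text \<open>The common power of \<open>\<alpha> * \<beta>\<close> splits off and leaves a power
  sum.\<close>

lemma symmetric_sum_poly:
  fixes T D :: "complex poly"
  shows "\<exists>P. \<forall>u \<alpha> \<beta>. \<alpha> + \<beta> = poly T u \<longrightarrow> \<alpha> * \<beta> = poly D u \<longrightarrow> \<alpha> ^ i * \<beta> ^ j + \<alpha> ^ j * \<beta> ^ i = poly P u"
proof -
  have *: "\<exists>P. \<forall>u \<alpha> \<beta>. \<alpha> + \<beta> = poly T u \<longrightarrow> \<alpha> * \<beta> = poly D u \<longrightarrow> \<alpha> ^ i * \<beta> ^ (i + k) + \<alpha> ^ (i + k) * \<beta> ^ i = poly P u" for i k
  proof -
    obtain P where P: "\<forall>u \<alpha> \<beta>. \<alpha> + \<beta> = poly T u \<longrightarrow> \<alpha> * \<beta> = poly D u \<longrightarrow> \<alpha> ^ k + \<beta> ^ k = poly P u"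
      using power_sum_poly by blast
    have "\<alpha> ^ i * \<beta> ^ (i + k) + \<alpha> ^ (i + k) * \<beta> ^ i = poly (D ^ i * P) u"
      if ab: "\<alpha> + \<beta> = poly T u" "\<alpha> * \<beta> = poly D u" for u \<alpha> \<beta>
    proof -
      have "\<alpha> ^ i * \<beta> ^ (i + k) + \<alpha> ^ (i + k) * \<beta> ^ i = (\<alpha> * \<beta>) ^ i * (\<alpha> ^ k + \<beta> ^ k)"
        by (simp add: power_add power_mult_distrib algebra_simps)
      then show ?thesis using P ab by simp
    qed
    then show ?thesis by blast
  qed
  show ?thesis
  proof (cases "i \<le> j")
    case True
    then show ?thesis using *[of i "j - i"] by simp
  next
    case False
    then have "i = j + (i - j)" by simp
    then show ?thesis using *[of j "i - j"] by (metis add.commute)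
  qed
qed

text \<open>
  The product of the resonance equation and the one with the eigenvalues \<open>u\<^sup>2 \<alpha>\<close>, \<open>u\<^sup>2 \<beta>\<close>
  exchanged is symmetric, hence polynomial in \<open>u\<close>; it is \<open>u\<^sup>5\<close> times
  a polynomial with constant coefficient \<open>d \<noteq> 0\<close>.
\<close>

lemma finite_resonances:
  fixes d t0 t1 :: complex
  assumes d: "d \<noteq> 0" and ij: "2 \<le> i + j"
  shows "finite {u. \<exists>\<alpha> \<beta>. \<alpha> + \<beta> = t0 + t1 * u \<and> \<alpha> * \<beta> = d * u \<and> (u^2 * \<alpha>) ^ i * (u^2 * \<beta>) ^ j = u^2 * \<alpha>}"
    (is "finite ?B")
proof -
  obtain P where P: "\<And>u \<alpha> \<beta>. \<alpha> + \<beta> = poly [:t0, t1:] u \<Longrightarrow> \<alpha> * \<beta> = poly [:0, d:] u \<Longrightarrow>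
      \<alpha> ^ i * \<beta> ^ Suc j + \<alpha> ^ Suc j * \<beta> ^ i = poly P u"
    using symmetric_sum_poly by metis
  define k where "k = i + j - 2"
  have k: "i + j = k + 2" using ij by (simp add: k_def)
  \<comment> \<open>The exponents \<open>2 * k\<close> and \<open>5 * k + 4\<close> are what remains
    of \<open>2 * (k + 3)\<close> and \<open>5 * (k + 2)\<close> after removing \<open>u^5\<close>
    and the one factor \<open>u\<close> that \<open>pCons\<close> restores.\<close>
  define R where "R = pCons d (monom (d ^ (k + 2)) (5 * k + 4) - monom 1 (2 * k) * P)"
  have "R \<noteq> 0" using d by (simp add: R_def)
  have "?B \<subseteq> insert 0 {u. poly R u = 0}"
  proof
    fix u assume "u \<in> ?B"
    then obtain \<alpha> \<beta> where ab: "\<alpha> + \<beta> = t0 + t1 * u" "\<alpha> * \<beta> = d * u"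
      and res: "(u^2 * \<alpha>) ^ i * (u^2 * \<beta>) ^ j = u^2 * \<alpha>" by blast
    have S: "\<alpha> ^ i * \<beta> ^ Suc j + \<alpha> ^ Suc j * \<beta> ^ i = poly P u"
      using P[of \<alpha> \<beta> u] ab by (simp add: mult.commute)
    have "((u^2 * \<alpha>) ^ i * (u^2 * \<beta>) ^ j - u^2 * \<alpha>) * ((u^2 * \<beta>) ^ i * (u^2 * \<alpha>) ^ j - u^2 * \<beta>)
        = (u^2) ^ (2 * (i + j)) * (\<alpha> * \<beta>) ^ (i + j)
          - (u^2) ^ (i + j + 1) * (\<alpha> ^ i * \<beta> ^ Suc j + \<alpha> ^ Suc j * \<beta> ^ i) + u^4 * (\<alpha> * \<beta>)"
      by (simp add: power_mult_distrib power_add mult_2 algebra_simps numeral_eq_Suc)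
    also have "\<dots> = u^5 * poly R u"
      unfolding S ab(2) k
      by (simp add: R_def poly_monom power_mult_distrib power_mult[symmetric] power_add algebra_simps numeral_eq_Suc)
    finally have "u^5 * poly R u = 0" using res by simp
    then show "u \<in> insert 0 {u. poly R u = 0}" by simp
  qed
  then show ?thesis
    using poly_roots_finite[OF \<open>R \<noteq> 0\<close>] finite_subset by blast
qed

text \<open>The discriminant is a polynomial in \<open>u\<close>; if its outer coefficients vanish,
  the middle one is \<open>- 4 * d\<close>.\<close>

lemma finite_double_eigenvalues:
  fixes d t0 t1 :: complex
  assumes d: "d \<noteq> 0"
  shows "finite {u. \<exists>\<alpha>. \<alpha> + \<alpha> = t0 + t1 * u \<and> \<alpha> * \<alpha> = d * u}"
proof -
  define R where "R = [:t0 ^ 2, 2 * t0 * t1 - 4 * d, t1 ^ 2:]"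
  have "R \<noteq> 0" using d by (auto simp: R_def)
  moreover have "{u. \<exists>\<alpha>. \<alpha> + \<alpha> = t0 + t1 * u \<and> \<alpha> * \<alpha> = d * u} \<subseteq> {u. poly R u = 0}"
  proof safe
    fix u \<alpha> assume 1: "\<alpha> + \<alpha> = t0 + t1 * u" and 2: "\<alpha> * \<alpha> = d * u"
    have "poly R u = (t0 + t1 * u) ^ 2 - 4 * (d * u)"
      by (simp add: R_def algebra_simps power2_eq_square)
    also have "\<dots> = 0" by (simp add: 1[symmetric] 2[symmetric] power2_eq_square algebra_simps)
    finally show "poly R u = 0" .
  qed
  ultimately show ?thesis using poly_roots_finite finite_subset by blast
qed

subsection \<open>Connection by geodesics\<close>

text \<open>The surplus 2 in the order of the remainder puts the cofactor of \<open>f\<close> in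
  \<open>mpow 2\<close>, so \<open>G\<close> keeps the linear part \<open>x\<close> and can serve as
  a coordinate. In the application \<open>F\<close> is \<sigma> and \<open>f\<close> is the deformed
  equation; then \<open>pull F' f\<close> and \<open>g\<close> both vanish on \<Gamma>.\<close>

lemma eigen_germ_with_ideal:
  assumes F: "map_germ0 F" "map_germ0 F'" and inv: "\<And>h. pull F' (pull F h) = h"
    and xy: "lin_coords x y"
    and x: "pull F x - const \<alpha> * x \<in> mpow 2" and y: "pull F y - const \<beta> * y \<in> mpow 2"
    and nonres: "\<And>i j. 2 \<le> i + j \<Longrightarrow> i + j < 2 + N \<Longrightarrow> \<alpha> ^ i * \<beta> ^ j \<noteq> \<alpha>"
    and ideal: "\<And>h. h \<in> mpow (2 + N) \<Longrightarrow> \<exists>a\<in>mpow 2. \<exists>b. h = f * a + g * b"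
  shows "\<exists>G. G - x \<in> mpow 2 \<and> (\<exists>a b. G = const \<alpha> * pull F' G + pull F' f * a + g * b)"
proof -
  obtain p where p: "p - x \<in> mpow 2" "pull F p - const \<alpha> * p \<in> mpow (2 + N)"
    using eigen_germ_exists[OF F(1) xy x y nonres, of "2 + N" "2 + N"] by auto
  have "pull F' (pull F p - const \<alpha> * p) \<in> mpow (2 + N)"
    by (rule pull_mpow[OF F(2) p(2)])
  then have "const \<alpha> * pull F' p - p \<in> mpow (2 + N)"
    using mpow_uminus[of "p - const \<alpha> * pull F' p"] by (simp add: pull_diff pull_mult F inv)
  then obtain k l where k: "k \<in> mpow 2" and kl: "const \<alpha> * pull F' p - p = f * k + g * l"
    using ideal by blast
  define G where "G = p + f * k"
  have "G - x = (p - x) + f * k" by (simp add: G_def)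
  also have "\<dots> \<in> mpow 2" by (intro mpow_add p mpow_mult_left k)
  finally have "G - x \<in> mpow 2" .
  moreover have "G = const \<alpha> * pull F' p - g * l"
    using kl by (simp add: G_def algebra_simps)
  then have "G = const \<alpha> * pull F' G + pull F' f * (- const \<alpha> * pull F' k) + g * (- l)"
    by (subst (2) G_def) (simp add: pull_add pull_mult F algebra_simps)
  ultimately show ?thesis by blast
qed

text \<open>On the slope \<open>y / x\<close> the map acts by the factor
  \<open>u ^ 2 / u ^ 3 = 1 / u\<close>, so the roots of the lowest form are multiplied by
  \<open>u\<close>.\<close>

lemma pull_scaled_pform:
  assumes S: "map_germ0 S" and xy: "lin_coords x y" and u: "u \<noteq> 0"
    and x: "pull S x = const (u ^ 3) * x" and y: "pull S y = const (u ^ 2) * y"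
    and f: "f - pform x y n p \<in> mpow (Suc n)"
  shows "pull S f - pform x y n (smult (u ^ (3 * n)) (p \<circ>\<^sub>p [:0, inverse u:])) \<in> mpow (Suc n)"
proof -
  have "pform x y n (smult (u ^ (3 * n)) (p \<circ>\<^sub>p [:0, inverse u:])) =
      hform x y n (\<lambda>i. const (coeff p i * ((u ^ 3) ^ (n - i) * (u ^ 2) ^ i)))"
  proof (rule hform_cong)
    fix i assume "i \<le> n"
    then obtain k where "n = i + k" using le_Suc_ex by blast
    then have eq: "u ^ (3 * n) * inverse u ^ i = (u ^ 3) ^ (n - i) * (u ^ 2) ^ i"
      using u by (simp add: power_mult[symmetric] power_add[symmetric] power_inverse field_simps)
    have "coeff (smult (u ^ (3 * n)) (p \<circ>\<^sub>p [:0, inverse u:])) i = (u ^ (3 * n) * inverse u ^ i) * coeff p i"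
      by (simp add: coeff_pcompose_linear)
    then show "const (coeff (smult (u ^ (3 * n)) (p \<circ>\<^sub>p [:0, inverse u:])) i) =
        const (coeff p i * ((u ^ 3) ^ (n - i) * (u ^ 2) ^ i))"
      unfolding eq by (simp only: mult.commute)
  qed
  then have "pull S (pform x y n p) - pform x y n (smult (u ^ (3 * n)) (p \<circ>\<^sub>p [:0, inverse u:])) \<in> mpow (Suc n)"
    using pull_hform_cong[OF S xy, of "u ^ 3" "u ^ 2" n "coeff p"] by (simp add: x y)
  moreover have "pull S (f - pform x y n p) \<in> mpow (Suc n)"
    by (rule pull_mpow[OF S f])
  ultimately have "pull S (f - pform x y n p) +
      (pull S (pform x y n p) - pform x y n (smult (u ^ (3 * n)) (p \<circ>\<^sub>p [:0, inverse u:]))) \<in> mpow (Suc n)"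
    by (intro mpow_add)
  then show ?thesis by (simp add: pull_diff S)
qed

text \<open>The coordinates and \<open>B\<close> depend only on \<open>f\<close>, \<open>g\<close>,
  \<phi> and \<theta>. They come before \<open>S\<close>, because the deforming flow is built to be
  diagonal in \<open>x\<close>, \<open>y\<close>; \<open>S\<close> enters only through its action on
  these coordinates, with \<open>u\<close> in the role of \<open>exp \<epsilon>\<close>.\<close>

lemma geodesic_coords:
  assumes fg: "f \<noteq> 0" "g \<noteq> 0" and F: "map_germ0 \<phi>" "map_germ0 \<theta>"
    and inv: "\<And>h. pull \<phi> (pull \<theta> h) = h" "\<And>h. pull \<theta> (pull \<phi> h) = h"
  obtains x y B where "lin_coords x y" "finite B"
    "\<And>u S S'. u \<notin> B \<Longrightarrow> map_germ0 S \<Longrightarrow> map_germ0 S' \<Longrightarrow> (\<And>h. pull S' (pull S h) = h) \<Longrightarrow>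
       pull S x = const (u ^ 3) * x \<Longrightarrow> pull S y = const (u ^ 2) * y \<Longrightarrow>
       \<exists>\<alpha> \<beta> l1 l2 G1 G2. \<alpha> \<noteq> 0 \<and> \<beta> \<noteq> 0 \<and> lin_coords l1 l2 \<and> G1 - l1 \<in> mpow 2 \<and> G2 - l2 \<in> mpow 2 \<and>
         (\<exists>a b. G1 = const \<alpha> * pull \<theta> (pull S' G1) + pull \<theta> f * a + g * b) \<and>
         (\<exists>a b. G2 = const \<beta> * pull \<theta> (pull S' G2) + pull \<theta> f * a + g * b)"
proof -
  obtain x y p q where xy: "lin_coords x y" "indep_coords x y"
    and p: "coeff p 0 \<noteq> 0" "f - pform x y (degree p) p \<in> mpow (Suc (degree p))"
    and q: "q \<noteq> 0" "g - pform x y (degree q) q \<in> mpow (Suc (degree q))"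
    by (rule adapted_coords[OF fg])
  have val: "val (pull \<phi> x) = 0" "val (pull \<phi> y) = 0" using xy F by (simp_all add: lin_coords_def)
  obtain a b where ab: "pull \<phi> x - (const a * x + const b * y) \<in> mpow 2" by (rule linear_part[OF xy(1) val(1)])
  obtain c d where cd: "pull \<phi> y - (const c * x + const d * y) \<in> mpow 2" by (rule linear_part[OF xy(1) val(2)])
  define D where "D = a * d - b * c"
  have D: "D \<noteq> 0" unfolding D_def by (rule linear_part_det[OF xy F inv(1) ab cd])
  define N where "N = degree p + degree q"
  \<comment> \<open>The linear part of \<sigma> has trace \<open>u^2 * (d + a * u)\<close> and
    determinant \<open>u^4 * (D * u)\<close>; taking \<open>u^2\<close> out of both eigenvalues
    leaves a sum and a product of degree at most 1 in \<open>u\<close>.\<close>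
  define res where "res = (\<lambda>(i, j). {u. \<exists>\<alpha> \<beta>. \<alpha> + \<beta> = d + a * u \<and> \<alpha> * \<beta> = D * u \<and>
      (u^2 * \<alpha>) ^ i * (u^2 * \<beta>) ^ j = u^2 * \<alpha>})"
  \<comment> \<open>Excluded are 0, double eigenvalues, resonances in the relevant degrees, and the
    quotients \<open>s / r\<close> for which the deformation moves a tangent slope \<open>r\<close>
    of \<open>f\<close> onto a tangent slope \<open>s\<close> of \<open>g\<close>.\<close>
  define B where "B = insert 0 ({u. \<exists>\<alpha>. \<alpha> + \<alpha> = d + a * u \<and> \<alpha> * \<alpha> = D * u} \<union>
      (\<Union>ij\<in>{ij \<in> {..2 + N} \<times> {..2 + N}. 2 \<le> fst ij + snd ij}. res ij) \<union>
      (\<lambda>(r, s). s / r) ` ({z. poly p z = 0} \<times> {z. poly q z = 0}))"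
  have p0: "p \<noteq> 0" using p(1) by auto
  have "finite B"
    unfolding B_def res_def
    using finite_double_eigenvalues[OF D] finite_resonances[OF D] poly_roots_finite[OF p0] poly_roots_finite[OF q(1)]
    by (auto split: prod.split)
  moreover have "\<exists>\<alpha> \<beta> l1 l2 G1 G2. \<alpha> \<noteq> 0 \<and> \<beta> \<noteq> 0 \<and> lin_coords l1 l2 \<and> G1 - l1 \<in> mpow 2 \<and> G2 - l2 \<in> mpow 2 \<and>
         (\<exists>a b. G1 = const \<alpha> * pull \<theta> (pull S' G1) + pull \<theta> f * a + g * b) \<and>
         (\<exists>a b. G2 = const \<beta> * pull \<theta> (pull S' G2) + pull \<theta> f * a + g * b)"
    if u: "u \<notin> B" and S: "map_germ0 S" "map_germ0 S'" and SS': "\<And>h. pull S' (pull S h) = h"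
      and Sx: "pull S x = const (u ^ 3) * x" and Sy: "pull S y = const (u ^ 2) * y" for u S S'
  proof -
    have u0: "u \<noteq> 0" using u by (auto simp: B_def)
    define pu where "pu = smult (u ^ (3 * degree p)) (p \<circ>\<^sub>p [:0, inverse u:])"
    have pu: "degree pu = degree p" "pu \<noteq> 0" "\<And>z. poly pu z = u ^ (3 * degree p) * poly p (z / u)"
      using u0 p0 by (auto simp: pu_def degree_pcompose poly_pcompose divide_inverse pcompose_eq_0_iff mult.commute)
    have fu: "pull S f - pform x y (degree pu) pu \<in> mpow (Suc (degree pu))"
      unfolding pu(1) unfolding pu_def by (rule pull_scaled_pform[OF S(1) xy(1) u0 Sx Sy p(2)])
    have no_common: "poly q z \<noteq> 0" if "poly pu z = 0" for z
    proof
      assume qz: "poly q z = 0"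
      have pz: "poly p (z / u) = 0" using that u0 by (simp add: pu(3))
      then have z0: "z \<noteq> 0" using p(1) by (auto simp: poly_0_coeff_0)
      have "u = z / (z / u)" using z0 u0 by simp
      then have "u \<in> (\<lambda>(r, s). s / r) ` ({z. poly p z = 0} \<times> {z. poly q z = 0})"
        using pz qz by (intro image_eqI[of _ _ "(z / u, z)"]) auto
      then show False using u by (simp add: B_def)
    qed
    have ideal: "\<exists>a\<in>mpow 2. \<exists>b. h = pull S f * a + g * b" if h: "h \<in> mpow (2 + N)" for h
    proof -
      obtain a b where "a \<in> mpow 2" "b \<in> mpow 2" "h = pull S f * a + g * b"
        by (rule mpow_subset_ideal[OF xy(1) pu(2) no_common q(1) fu q(2), of h 2])
          (use h in \<open>simp_all add: pu(1) N_def\<close>)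
      then show ?thesis by blast
    qed
    \<comment> \<open>\<sigma> carries the deformed branch to \<Gamma>, and \<tau> leads
      back.\<close>
    define \<sigma> \<tau> where "\<sigma> = (\<lambda>z. \<phi> (S z))" and "\<tau> = (\<lambda>z. S' (\<theta> z))"
    have \<sigma>\<tau>: "map_germ0 \<sigma>" "map_germ0 \<tau>"
      unfolding \<sigma>_def \<tau>_def using F S by (simp_all add: map_germ0_compose)
    have pull_\<sigma>: "pull \<sigma> h = pull S (pull \<phi> h)" and pull_\<tau>: "pull \<tau> h = pull \<theta> (pull S' h)" for h
      unfolding \<sigma>_def \<tau>_def using F S by (simp_all add: pull_pull)
    have \<tau>\<sigma>: "pull \<tau> (pull \<sigma> h) = h" for h by (simp add: pull_\<sigma> pull_\<tau> SS' inv)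
    have "pull S (pull \<phi> x - (const a * x + const b * y)) \<in> mpow 2" by (rule pull_mpow[OF S(1) ab])
    then have \<sigma>x: "pull \<sigma> x - (const (a * u^3) * x + const (b * u^2) * y) \<in> mpow 2"
      by (simp add: pull_\<sigma> pull_diff pull_add pull_mult S Sx Sy const_mult mult.assoc)
    have "pull S (pull \<phi> y - (const c * x + const d * y)) \<in> mpow 2" by (rule pull_mpow[OF S(1) cd])
    then have \<sigma>y: "pull \<sigma> y - (const (c * u^3) * x + const (d * u^2) * y) \<in> mpow 2"
      by (simp add: pull_\<sigma> pull_diff pull_add pull_mult S Sx Sy const_mult mult.assoc)
    obtain \<alpha>' \<beta>' where sum: "\<alpha>' + \<beta>' = d + a * u" and prod: "\<alpha>' * \<beta>' = D * u"
      using complex_sum_prod_exists by blast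
    define \<alpha> \<beta> where "\<alpha> = u^2 * \<alpha>'" and "\<beta> = u^2 * \<beta>'"
    have "\<alpha>' * \<beta>' \<noteq> 0" using prod D u0 by simp
    then have nz: "\<alpha> \<noteq> 0" "\<beta> \<noteq> 0" using u0 by (simp_all add: \<alpha>_def \<beta>_def)
    have ne: "\<alpha> \<noteq> \<beta>"
    proof
      assume "\<alpha> = \<beta>"
      then have "\<alpha>' = \<beta>'" using u0 by (simp add: \<alpha>_def \<beta>_def)
      then show False using u sum prod by (auto simp: B_def)
    qed
    \<comment> \<open>Stated for any pair with this sum and product, so that it applies to the
      eigenvalues in either order.\<close>
    have not_res: False if "2 \<le> i + j" "i + j < 2 + N" "\<alpha>0 + \<beta>0 = d + a * u" "\<alpha>0 * \<beta>0 = D * u"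
        "(u^2 * \<alpha>0) ^ i * (u^2 * \<beta>0) ^ j = u^2 * \<alpha>0" for i j \<alpha>0 \<beta>0
    proof -
      have "u \<in> res (i, j)" unfolding res_def using that(3-5) by blast
      moreover have "(i, j) \<in> {ij \<in> {..2 + N} \<times> {..2 + N}. 2 \<le> fst ij + snd ij}"
        using that(1,2) by simp
      ultimately show False using u unfolding B_def by blast
    qed
    have nonres1: "\<alpha> ^ i * \<beta> ^ j \<noteq> \<alpha>" if "2 \<le> i + j" "i + j < 2 + N" for i j
      using not_res[OF that sum prod] unfolding \<alpha>_def \<beta>_def by blast
    have nonres2: "\<beta> ^ i * \<alpha> ^ j \<noteq> \<beta>" if "2 \<le> i + j" "i + j < 2 + N" for i j
      using not_res[OF that sum[unfolded add.commute[of \<alpha>']] prod[unfolded mult.commute[of \<alpha>']]]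
      unfolding \<alpha>_def \<beta>_def by blast
    have tr: "\<alpha> + \<beta> = a * u^3 + d * u^2"
    proof -
      have "\<alpha> + \<beta> = u^2 * (\<alpha>' + \<beta>')" by (simp add: \<alpha>_def \<beta>_def distrib_left)
      then show ?thesis unfolding sum by (simp add: algebra_simps numeral_eq_Suc)
    qed
    have det: "\<alpha> * \<beta> = (a * u^3) * (d * u^2) - (b * u^2) * (c * u^3)"
    proof -
      have "\<alpha> * \<beta> = u^4 * (\<alpha>' * \<beta>')" by (simp add: \<alpha>_def \<beta>_def numeral_eq_Suc)
      then show ?thesis unfolding prod by (simp add: D_def algebra_simps numeral_eq_Suc)
    qed
    have char_poly: "(a * u^3 - r) * (d * u^2 - r) = (b * u^2) * (c * u^3)" if "r = \<alpha> \<or> r = \<beta>" for r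
    proof -
      have "(a * u^3 - r) * (d * u^2 - r) = (a * u^3) * (d * u^2) - r * (a * u^3 + d * u^2) + r * r"
        by (simp add: algebra_simps)
      also have "\<dots> = (a * u^3) * (d * u^2) - \<alpha> * \<beta>"
        unfolding tr[symmetric] using that by (auto simp: algebra_simps)
      also have "\<dots> = (b * u^2) * (c * u^3)" unfolding det by simp
      finally show ?thesis .
    qed
    obtain c1 c2 where cc: "c1 \<noteq> 0 \<or> c2 \<noteq> 0" "c1 * (a * u^3) + c2 * (c * u^3) = \<alpha> * c1"
        "c1 * (b * u^2) + c2 * (d * u^2) = \<alpha> * c2"
      using left_eigenvector2[OF char_poly, of \<alpha>] by blast
    obtain d1 d2 where dd: "d1 \<noteq> 0 \<or> d2 \<noteq> 0" "d1 * (a * u^3) + d2 * (c * u^3) = \<beta> * d1"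
        "d1 * (b * u^2) + d2 * (d * u^2) = \<beta> * d2"
      using left_eigenvector2[OF char_poly, of \<beta>] by blast
    have eigen: "pull \<sigma> (const e1 * x + const e2 * y) - const r * (const e1 * x + const e2 * y) \<in> mpow 2"
      if "e1 * (a * u^3) + e2 * (c * u^3) = r * e1" "e1 * (b * u^2) + e2 * (d * u^2) = r * e2" for e1 e2 r
    proof -
      have "pull \<sigma> (const e1 * x + const e2 * y) - const r * (const e1 * x + const e2 * y) =
          pull \<sigma> (const e1 * x + const e2 * y) - (const (r * e1) * x + const (r * e2) * y)"
        by (simp add: const_mult algebra_simps)
      also have "\<dots> = const e1 * (pull \<sigma> x - (const (a * u^3) * x + const (b * u^2) * y))
          + const e2 * (pull \<sigma> y - (const (c * u^3) * x + const (d * u^2) * y))"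
        unfolding that[symmetric] by (simp add: pull_add pull_mult \<sigma>\<tau> const_add const_mult algebra_simps)
      also have "\<dots> \<in> mpow 2" by (intro mpow_add mpow_mult_left \<sigma>x \<sigma>y)
      finally show ?thesis .
    qed
    define l1 l2 where "l1 = const c1 * x + const c2 * y" and "l2 = const d1 * x + const d2 * y"
    have l: "lin_coords l1 l2"
      unfolding l1_def l2_def
      by (rule lin_coords_change[OF xy(1) left_eigenvectors_indep[OF ne cc dd]])
    have e1: "pull \<sigma> l1 - const \<alpha> * l1 \<in> mpow 2" unfolding l1_def by (rule eigen[OF cc(2,3)])
    have e2: "pull \<sigma> l2 - const \<beta> * l2 \<in> mpow 2" unfolding l2_def by (rule eigen[OF dd(2,3)])
    obtain G1 where G1: "G1 - l1 \<in> mpow 2" "\<exists>a b. G1 = const \<alpha> * pull \<tau> G1 + pull \<tau> (pull S f) * a + g * b"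
      using eigen_germ_with_ideal[OF \<sigma>\<tau> \<tau>\<sigma> l e1 e2 nonres1 ideal] by blast
    obtain G2 where G2: "G2 - l2 \<in> mpow 2" "\<exists>a b. G2 = const \<beta> * pull \<tau> G2 + pull \<tau> (pull S f) * a + g * b"
      using eigen_germ_with_ideal[OF \<sigma>\<tau> \<tau>\<sigma> lin_coords_swap[OF l] e2 e1 nonres2 ideal] by blast
    \<comment> \<open>As \<open>S'\<close> undoes \<open>S\<close>,
      \<open>pull \<tau> (pull S f)\<close> is \<open>pull \<theta> f\<close>, the equation of
      \<Gamma>' transported to \<Gamma>.\<close>
    show ?thesis
      by (rule exI[of _ \<alpha>], rule exI[of _ \<beta>], rule exI[of _ l1], rule exI[of _ l2],
          rule exI[of _ G1], rule exI[of _ G2])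
        (intro conjI nz l G1(1) G2(1) G1(2)[unfolded pull_\<tau> SS'] G2(2)[unfolded pull_\<tau> SS'])
  qed
  ultimately show ?thesis using that[OF xy(1)] by blast
qed

section \<open>From ring identities to flows and germs of sets\<close>

lemma pull_flow_coords:
  assumes H: "H = (\<lambda>z. vec2 (rep_hgerm x z) (rep_hgerm y z))" and bih: "local_biholo H h U V"
  shows "pull (\<lambda>z. h (diag_flow a b s (H z))) x = const (exp (a * s)) * x"
    "pull (\<lambda>z. h (diag_flow a b s (H z))) y = const (exp (b * s)) * y"
proof -
  note g = local_biholo_germs[OF bih]
  define S where "S = (\<lambda>z. h (diag_flow a b s (H z)))"
  have DH: "map_germ0 (\<lambda>z. diag_flow a b s (H z))"
    using map_germ0_compose[OF map_germ0_diag_flow g(1)] .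
  have S: "map_germ0 S"
    unfolding S_def by (rule map_germ0_compose[OF g(2) DH])
  have "\<forall>\<^sub>F z in nhds 0. H (S z) = diag_flow a b s (H z)"
    using map_germ0_tendsto[OF DH] g(4) unfolding S_def filterlim_iff by blast
  then have ev: "\<forall>\<^sub>F z in nhds 0. rep_hgerm x (S z) = exp (a * s) * rep_hgerm x z"
    "\<forall>\<^sub>F z in nhds 0. rep_hgerm y (S z) = exp (b * s) * rep_hgerm y z"
    unfolding H by (auto elim!: eventually_mono simp: vec_eq_iff forall_2)
  have "pull S w = const c * w" if "\<forall>\<^sub>F z in nhds 0. rep_hgerm w (S z) = c * rep_hgerm w z" for w c
  proof -
    have "pull S w = germ (\<lambda>z. rep_hgerm w (S z))" by (simp add: pull_def)
    also have "\<dots> = germ (\<lambda>z. c * rep_hgerm w z)"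
      using that holo_fun_germ_pull[OF S rep_hgerm(1)[of w]]
      by (subst germ_eq_iff) (auto simp: germ_eq_def intro: holo_fun_germ_mult rep_hgerm)
    also have "\<dots> = const c * w"
      by (simp add: germ_mult rep_hgerm const_def)
    finally show ?thesis .
  qed
  from this[OF ev(1)] this[OF ev(2)] show
    "pull (\<lambda>z. h (diag_flow a b s (H z))) x = const (exp (a * s)) * x"
    "pull (\<lambda>z. h (diag_flow a b s (H z))) y = const (exp (b * s)) * y"
    by (simp_all add: S_def)
qed

lemma flow_inverse:
  assumes bih: "local_biholo H h U V"
  shows "\<forall>\<^sub>F z in nhds 0. h (diag_flow a b s (H (h (diag_flow a b (- s) (H z))))) = z"
proof -
  note g = local_biholo_germs[OF bih]
  have "\<forall>\<^sub>F z in nhds 0. H (h (diag_flow a b (- s) (H z))) = diag_flow a b (- s) (H z)"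
    using map_germ0_tendsto[OF map_germ0_compose[OF map_germ0_diag_flow g(1)]] g(4)
    unfolding filterlim_iff by blast
  then show ?thesis using g(3)
  proof eventually_elim
    case (elim z)
    have "diag_flow a b s (diag_flow a b (- s) w) = w" for w
      by (simp add: vec_eq_iff forall_2 mult.assoc[symmetric] exp_add[symmetric])
    then show ?case using elim by simp
  qed
qed

text \<open>Only values along the filter count, so a map may be replaced by one that agrees with it
  on the branch alone. This is how a flow that differs from \<tau> off \<Gamma> can still connect
  the branches.\<close>

lemma filtermap_eventually_cong:
  assumes "\<forall>\<^sub>F x in F. f x = g x" shows "filtermap f F = filtermap g F"
  unfolding filter_eq_iff eventually_filtermap
proof
  fix P
  show "(\<forall>\<^sub>F x in F. P (f x)) = (\<forall>\<^sub>F x in F. P (g x))"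
    by (rule eventually_subst) (use assms in eventually_elim, simp)
qed

lemma germ_of_le_nhds: "germ_of A \<le> nhds 0"
  by (simp add: germ_of_def)

text \<open>The pointwise form of the ring identity can be restricted to \<Gamma>, where
  \<open>f (\<theta> w)\<close> and \<open>g w\<close> vanish.\<close>

lemma eigen_equation_eventually:
  assumes G: "G = const \<alpha> * pull \<theta> (pull S' G) + pull \<theta> (germ f) * a + germ g * b"
    and hol: "holo_fun_germ f" "holo_fun_germ g" "map_germ0 \<theta>" "map_germ0 S'"
  shows "\<forall>\<^sub>F w in nhds 0. rep_hgerm G w = \<alpha> * rep_hgerm G (S' (\<theta> w))
      + f (\<theta> w) * rep_hgerm a w + g w * rep_hgerm b w"
proof -
  let ?R = "\<lambda>w. \<alpha> * rep_hgerm G (S' (\<theta> w)) + f (\<theta> w) * rep_hgerm a w + g w * rep_hgerm b w"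
  have h1: "holo_fun_germ (\<lambda>w. rep_hgerm G (S' w))"
    by (rule holo_fun_germ_pull[OF hol(4) rep_hgerm(1)])
  note h2 = holo_fun_germ_pull[OF hol(3) h1]
  note h3 = holo_fun_germ_pull[OF hol(3,1)]
  note h = h1 h2 h3 hol rep_hgerm(1) holo_fun_germ_add holo_fun_germ_mult holo_fun_germ_const
  have 1: "pull \<theta> (pull S' G) = germ (\<lambda>w. rep_hgerm G (S' (\<theta> w)))"
    unfolding pull_def[of S'] by (rule pull_germ[OF hol(3) h1])
  have 2: "pull \<theta> (germ f) = germ (\<lambda>w. f (\<theta> w))"
    by (rule pull_germ[OF hol(3,1)])
  have "germ ?R = const \<alpha> * pull \<theta> (pull S' G) + pull \<theta> (germ f) * a + germ g * b"
    unfolding 1 2 by (simp add: germ_add germ_mult h rep_hgerm(2) const_def)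
  also have "\<dots> = G" by (rule G[symmetric])
  finally have "germ ?R = G" .
  then have "germ (rep_hgerm G) = germ ?R" by (simp add: rep_hgerm)
  then show ?thesis
    by (subst (asm) germ_eq_iff) (auto simp: germ_eq_def intro!: h)
qed

theorem proposition3:
  fixes \<Gamma> \<Gamma>' :: set_germ
  assumes "plane_branch \<Gamma>"
    and "\<Gamma>' \<in> conjugacy_class \<Gamma>"
  shows "\<exists>X E \<Delta> \<gamma>.
           singular_vector_field X \<and> open E \<and> 0 \<in> E \<and>
           holomorphic_deformation E X \<Gamma>' \<Delta> \<and> \<Delta> 0 = \<Gamma>' \<and>
           arc \<gamma> \<and> path_image \<gamma> \<subseteq> E \<and> pathstart \<gamma> = 0 \<and>
           (\<forall>t\<in>{0<..1}. connected_by_geodesic \<Gamma> (\<Delta> (\<gamma> t)))"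
proof -
  obtain g where g: "irreducible_germ g" and \<Gamma>: "\<Gamma> = germ_of {z. g z = 0}"
    using assms(1) by (auto simp: plane_branch_def)
  obtain f where f: "irreducible_germ f" and \<Gamma>': "\<Gamma>' = germ_of {z. f z = 0}"
    using assms(2) by (auto simp: conjugacy_class_def plane_branch_def)
  obtain \<phi> where \<phi>: "biholo_germ \<phi>" "filtermap \<phi> \<Gamma>' = \<Gamma>"
    using assms(2) by (auto simp: conjugacy_class_def analytically_conjugated_def)
  then obtain \<theta> where F: "map_germ0 \<phi>" "map_germ0 \<theta>"
    and \<theta>\<phi>: "\<forall>\<^sub>F z in nhds 0. \<theta> (\<phi> z) = z" and \<phi>\<theta>: "\<forall>\<^sub>F z in nhds 0. \<phi> (\<theta> z) = z"
    unfolding biholo_germ_def map_germ0_def germ_eq_def by blast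
  have hol: "holo_fun_germ f" "holo_fun_germ g" and "germ f \<noteq> 0" "germ g \<noteq> 0"
    using f g by (auto simp: irreducible_germ_def zero_hgerm.abs_eq germ_eq_iff)
  obtain x y B where xy: "lin_coords x y" and B: "finite B"
    and main: "\<And>u S S'. u \<notin> B \<Longrightarrow> map_germ0 S \<Longrightarrow> map_germ0 S' \<Longrightarrow> (\<And>h. pull S' (pull S h) = h) \<Longrightarrow>
       pull S x = const (u ^ 3) * x \<Longrightarrow> pull S y = const (u ^ 2) * y \<Longrightarrow>
       \<exists>\<alpha> \<beta> l1 l2 G1 G2. \<alpha> \<noteq> 0 \<and> \<beta> \<noteq> 0 \<and> lin_coords l1 l2 \<and> G1 - l1 \<in> mpow 2 \<and> G2 - l2 \<in> mpow 2 \<and>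
         (\<exists>a b. G1 = const \<alpha> * pull \<theta> (pull S' G1) + pull \<theta> (germ f) * a + germ g * b) \<and>
         (\<exists>a b. G2 = const \<beta> * pull \<theta> (pull S' G2) + pull \<theta> (germ f) * a + germ g * b)"
    by (rule geodesic_coords[OF \<open>germ f \<noteq> 0\<close> \<open>germ g \<noteq> 0\<close> F pull_pull_eq_self[OF F(2,1) \<theta>\<phi>] pull_pull_eq_self[OF F \<phi>\<theta>]])
      (rule that, assumption, assumption, blast)
  \<comment> \<open>Using the adapted coordinates themselves makes the action of the flow on
    \<open>x\<close> and \<open>y\<close> exactly diagonal, as \<open>main\<close> requires.\<close>
  define H where "H = (\<lambda>z. vec2 (rep_hgerm x z) (rep_hgerm y z))"
  obtain h U V where bih: "local_biholo H h U V"
    unfolding H_def by (rule local_biholo_exists[OF xy, of x y]) simp_all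
  define \<psi> where "\<psi> = (\<lambda>s z. h (diag_flow 3 2 s (H z)))"
  obtain X where X: "singular_vector_field X" "is_flow X \<psi>"
    using local_biholo_flow[OF bih, of 3 2] unfolding \<psi>_def by blast
  have \<psi>: "map_germ0 (\<psi> s)" for s
    unfolding \<psi>_def using local_biholo_germs(1,2)[OF bih]
    by (rule map_germ0_compose[OF _ map_germ0_compose[OF map_germ0_diag_flow], rotated])
  have \<psi>_inv: "\<forall>\<^sub>F z in nhds 0. \<psi> s (\<psi> (- s) z) = z" for s
    unfolding \<psi>_def by (rule flow_inverse[OF bih])
  define \<Delta> where "\<Delta> = (\<lambda>\<epsilon>. filtermap (\<psi> (- \<epsilon>)) \<Gamma>')"
  have le: "\<Gamma> \<le> nhds 0" "\<Gamma>' \<le> nhds 0"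
    unfolding \<Gamma> \<Gamma>' by (rule germ_of_le_nhds)+
  have \<Gamma>_\<theta>: "filtermap \<theta> \<Gamma> = \<Gamma>'"
  proof -
    have "filtermap \<theta> \<Gamma> = filtermap (\<lambda>z. \<theta> (\<phi> z)) \<Gamma>'"
      unfolding \<phi>(2)[symmetric] by (simp add: filtermap_filtermap)
    also have "\<dots> = filtermap (\<lambda>z. z) \<Gamma>'"
      by (rule filtermap_eventually_cong[OF filter_leD[OF le(2) \<theta>\<phi>]])
    finally show ?thesis by (simp add: filtermap_ident)
  qed
  have f_\<theta>: "\<forall>\<^sub>F w in \<Gamma>. f (\<theta> w) = 0"
  proof -
    have "\<forall>\<^sub>F z in \<Gamma>'. f z = 0" unfolding \<Gamma>' by (simp add: eventually_germ_of)
    then show ?thesis unfolding \<Gamma>_\<theta>[symmetric] eventually_filtermap .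
  qed
  have g_0: "\<forall>\<^sub>F w in \<Gamma>. g w = 0" unfolding \<Gamma> by (simp add: eventually_germ_of)
  have \<Delta>0: "\<Delta> 0 = \<Gamma>'"
  proof -
    have "\<forall>\<^sub>F z in nhds 0. \<psi> (- 0) z = z"
      using local_biholo_germs(3)[OF bih] by (simp add: \<psi>_def)
    then have "filtermap (\<psi> (- 0)) \<Gamma>' = filtermap (\<lambda>z. z) \<Gamma>'"
      by (intro filtermap_eventually_cong filter_leD[OF le(2)])
    then show ?thesis by (simp add: \<Delta>_def filtermap_ident)
  qed
  \<comment> \<open>Proved for every complex time outside the exceptional set; the real segment is
    chosen only at the end.\<close>
  have geodesic: "connected_by_geodesic \<Gamma> (\<Delta> s)" if s: "exp s \<notin> B" for s
  proof -
    have S: "pull (\<psi> s) x = const (exp s ^ 3) * x" "pull (\<psi> s) y = const (exp s ^ 2) * y"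
      using pull_flow_coords[OF H_def bih, of 3 2 s] exp_of_nat_mult[of 3 s] exp_of_nat_mult[of 2 s]
      by (simp_all add: \<psi>_def)
    obtain \<alpha> \<beta> l1 l2 G1 G2 where nz: "\<alpha> \<noteq> 0" "\<beta> \<noteq> 0" and l: "lin_coords l1 l2"
      and G: "G1 - l1 \<in> mpow 2" "G2 - l2 \<in> mpow 2"
      and G1: "\<exists>a b. G1 = const \<alpha> * pull \<theta> (pull (\<psi> (- s)) G1) + pull \<theta> (germ f) * a + germ g * b"
      and G2: "\<exists>a b. G2 = const \<beta> * pull \<theta> (pull (\<psi> (- s)) G2) + pull \<theta> (germ f) * a + germ g * b"
      using main[OF s \<psi> \<psi> pull_pull_eq_self[OF \<psi> \<psi> \<psi>_inv] S] by blast
    define G where "G = (\<lambda>z. vec2 (rep_hgerm G1 z) (rep_hgerm G2 z))"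
    obtain k U' V' where bihG: "local_biholo G k U' V'"
      unfolding G_def by (rule local_biholo_exists[OF l G])
    \<comment> \<open>On \<Gamma> the two equations say that \<tau> multiplies \<open>G1\<close> and
      \<open>G2\<close> by \<open>1 / \<alpha>\<close> and \<open>1 / \<beta>\<close>; hence the
      exponents \<open>- Ln \<alpha>\<close> and \<open>- Ln \<beta>\<close> for time 1.\<close>
    define \<Psi> where "\<Psi> = (\<lambda>s z. k (diag_flow (- Ln \<alpha>) (- Ln \<beta>) s (G z)))"
    obtain Y where Y: "singular_vector_field Y" "is_flow Y \<Psi>"
      using local_biholo_flow[OF bihG, of "- Ln \<alpha>" "- Ln \<beta>"] unfolding \<Psi>_def by blast
    define \<tau> where "\<tau> = (\<lambda>w. \<psi> (- s) (\<theta> w))"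
    have \<tau>: "map_germ0 \<tau>" unfolding \<tau>_def by (rule map_germ0_compose[OF \<psi> F(2)])
    obtain a1 b1 where 1: "G1 = const \<alpha> * pull \<theta> (pull (\<psi> (- s)) G1) + pull \<theta> (germ f) * a1 + germ g * b1"
      using G1 by blast
    obtain a2 b2 where 2: "G2 = const \<beta> * pull \<theta> (pull (\<psi> (- s)) G2) + pull \<theta> (germ f) * a2 + germ g * b2"
      using G2 by blast
    have ev1: "\<forall>\<^sub>F w in \<Gamma>. rep_hgerm G1 w = \<alpha> * rep_hgerm G1 (\<tau> w) + f (\<theta> w) * rep_hgerm a1 w + g w * rep_hgerm b1 w"
      unfolding \<tau>_def by (rule filter_leD[OF le(1) eigen_equation_eventually[OF 1 hol F(2) \<psi>]])
    have ev2: "\<forall>\<^sub>F w in \<Gamma>. rep_hgerm G2 w = \<beta> * rep_hgerm G2 (\<tau> w) + f (\<theta> w) * rep_hgerm a2 w + g w * rep_hgerm b2 w"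
      unfolding \<tau>_def by (rule filter_leD[OF le(1) eigen_equation_eventually[OF 2 hol F(2) \<psi>]])
    have "\<forall>\<^sub>F w in nhds 0. k (G (\<tau> w)) = \<tau> w"
      using map_germ0_tendsto[OF \<tau>] local_biholo_germs(3)[OF bihG] unfolding filterlim_iff by blast
    then have "\<forall>\<^sub>F w in \<Gamma>. k (G (\<tau> w)) = \<tau> w" by (rule filter_leD[OF le(1)])
    with ev1 ev2 f_\<theta> g_0 have "\<forall>\<^sub>F w in \<Gamma>. \<Psi> 1 w = \<tau> w"
    proof eventually_elim
      case (elim w)
      have "diag_flow (- Ln \<alpha>) (- Ln \<beta>) 1 (G w) = G (\<tau> w)"
        using elim nz by (simp add: vec_eq_iff forall_2 G_def exp_minus)
      then show ?case using elim by (simp add: \<Psi>_def)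
    qed
    then have "filtermap (\<Psi> 1) \<Gamma> = filtermap \<tau> \<Gamma>" by (rule filtermap_eventually_cong)
    also have "\<dots> = \<Delta> s"
      unfolding \<Delta>_def \<Gamma>_\<theta>[symmetric] by (simp add: \<tau>_def filtermap_filtermap)
    finally show ?thesis
      using Y unfolding connected_by_geodesic_def by blast
  qed
  \<comment> \<open>The exponential is injective on the real axis, so only finitely many real times
    are bad. As 0 may be one of them, \<open>d\<close> separates it only from the others.\<close>
  have "finite ((\<lambda>t. exp (complex_of_real t)) -` B)"
  proof (rule finite_vimageI[OF B])
    show "inj (\<lambda>t. exp (complex_of_real t))"
      by (rule injI) (simp add: exp_of_real)
  qed
  then obtain d where d: "d > 0" "\<And>t. exp (complex_of_real t) \<in> B \<Longrightarrow> t \<noteq> 0 \<Longrightarrow> d \<le> dist 0 t"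
    using finite_set_avoid[of "(\<lambda>t. exp (complex_of_real t)) -` B" 0] by auto
  \<comment> \<open>Half of \<open>d\<close> keeps the end point \<open>t = 1\<close> away from the
    bad times.\<close>
  define \<gamma> where "\<gamma> = linepath 0 (complex_of_real (d / 2))"
  have "connected_by_geodesic \<Gamma> (\<Delta> (\<gamma> t))" if t: "t \<in> {0<..1}" for t
  proof (rule geodesic)
    have eq: "\<gamma> t = complex_of_real (t * (d / 2))"
      by (simp add: \<gamma>_def linepath_def scaleR_conv_of_real)
    have "t * (d / 2) < d" "0 < t * (d / 2)"
      using t d(1) mult_left_le_one_le[of "d / 2" t] by auto
    then have "\<not> d \<le> dist 0 (t * (d / 2))" "t * (d / 2) \<noteq> 0"
      by (simp_all only: dist_real_def)
    then show "exp (\<gamma> t) \<notin> B"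
      unfolding eq using d(2)[of "t * (d / 2)"] by blast
  qed
  moreover have "arc \<gamma>" "pathstart \<gamma> = 0"
    using d(1) by (auto simp: \<gamma>_def)
  \<comment> \<open>The germs of the flow exist for all complex times, so the whole plane serves as
    \<open>E\<close>.\<close>
  moreover have "holomorphic_deformation UNIV X \<Gamma>' \<Delta>"
    unfolding holomorphic_deformation_def \<Delta>_def using X(2) by blast
  ultimately show ?thesis
    using X(1) \<Delta>0 by (intro exI[of _ X] exI[of _ UNIV] exI[of _ \<Delta>] exI[of _ \<gamma>]) simp
qed

end
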